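(* Let $k$ be a field, $m\ge 2$ an integer, and $T=k[[X_1,\ldots,X_m,Y_1,\ldots,Y_m,Z_1,\ldots,Z_m]]$ the formal power series ring. Let $P_1=(X_1,\ldots,X_m)$, $P_2=(Y_1,\ldots,Y_m)$, $P_3=(Z_1,\ldots,Z_m)$, $A=T/(P_1\cap P_2\cap P_3)$, and $B=T/P_1\oplus T/P_2\oplus T/P_3$. Then $\dim A=2m\ge 4$, $\operatorname{depth}A=2$, and $\widetilde A=B$ is a regular ring.
   Context: $A$ is regarded as a subring of $B$ via the diagonal embedding, and $B$ (the integral closure of $A$) is regarded as a subring of the total ring of fractions $Q(A)$ of $A$. The $(S_2)$-ification of $A$ is $\widetilde A=\{f\in Q(A)\mid Jf\subseteq A\text{ for some ideal }J\text{ of }A\text{ with }\operatorname{ht}_A J\ge 2\}$. A Noetherian ring is regular if all its localizations at maximal ideals are regular local rings. *)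

theory Defs
  imports
    "HOL-Algebra.Algebra"
    "HOL-Library.Extended_Nat"
begin

section \<open>Formal power series\<close>

text \<open>
  As in \<^theory>\<open>HOL-Algebra.Indexed_Polynomials\<close>, a monomial in the variables \<open>V\<close> is a
  multiset with support in \<open>V\<close>, and a power series is its coefficient function. Coefficient functions
  are normalised to be zero at all other multisets. Every multiset is a sum of two multisets in only
  finitely many ways, so the Cauchy product is a finite sum.
\<close>

definition power_series_ring :: "('a, 'b) ring_scheme \<Rightarrow> 'v set \<Rightarrow> ('v multiset \<Rightarrow> 'a) ring"
  where "power_series_ring R V =
    \<lparr> carrier = {f. (\<forall>M. f M \<in> carrier R) \<and> (\<forall>M. \<not> set_mset M \<subseteq> V \<longrightarrow> f M = \<zero>\<^bsub>R\<^esub>)},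
      monoid.mult = (\<lambda>f g M. \<Oplus>\<^bsub>R\<^esub>p\<in>{(M1, M2). M1 + M2 = M}. f (fst p) \<otimes>\<^bsub>R\<^esub> g (snd p)),
      one = ring.indexed_const R \<one>\<^bsub>R\<^esub>,
      ring.zero = ring.indexed_const R \<zero>\<^bsub>R\<^esub>,
      add = ring.indexed_padd R \<rparr>"

datatype xyz = X_var nat | Y_var nat | Z_var nat


section \<open>Dimension, height and depth\<close>

definition prime_chain :: "('a, 'b) ring_scheme \<Rightarrow> (nat \<Rightarrow> 'a set) \<Rightarrow> nat \<Rightarrow> bool"
  where "prime_chain R c n \<longleftrightarrow>
    (\<forall>i\<le>n. primeideal (c i) R) \<and> (\<forall>i<n. c i \<subset> c (Suc i))"

definition krull_dim :: "('a, 'b) ring_scheme \<Rightarrow> enat"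
  where "krull_dim R = Sup {enat n | n. \<exists>c. prime_chain R c n}"

definition prime_height :: "('a, 'b) ring_scheme \<Rightarrow> 'a set \<Rightarrow> enat"
  where "prime_height R P = Sup {enat n | n. \<exists>c. prime_chain R c n \<and> c n = P}"

text \<open>The unit ideal is contained in no prime ideal, so its height is \<open>\<infinity>\<close>.\<close>

definition ideal_height :: "('a, 'b) ring_scheme \<Rightarrow> 'a set \<Rightarrow> enat"
  where "ideal_height R J = Inf {prime_height R P | P. primeideal P R \<and> J \<subseteq> P}"

definition nonzerodivisors :: "('a, 'b) ring_scheme \<Rightarrow> 'a set"
  where "nonzerodivisors R =
    {s \<in> carrier R. \<forall>x\<in>carrier R. s \<otimes>\<^bsub>R\<^esub> x = \<zero>\<^bsub>R\<^esub> \<longrightarrow> x = \<zero>\<^bsub>R\<^esub>}"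

definition regular_sequence :: "('a, 'b) ring_scheme \<Rightarrow> 'a list \<Rightarrow> bool"
  where "regular_sequence R xs \<longleftrightarrow>
    set xs \<subseteq> carrier R \<and>
    Idl\<^bsub>R\<^esub> (set xs) \<noteq> carrier R \<and>
    (\<forall>i<length xs. let I = Idl\<^bsub>R\<^esub> (set (take i xs))
                   in I +>\<^bsub>R\<^esub> (xs ! i) \<in> nonzerodivisors (R Quot I))"

definition local_ring :: "('a, 'b) ring_scheme \<Rightarrow> bool"
  where "local_ring R \<longleftrightarrow> cring R \<and> (\<exists>!M. maximalideal M R)"

definition maximal_ideal_of :: "('a, 'b) ring_scheme \<Rightarrow> 'a set"
  where "maximal_ideal_of R = (THE M. maximalideal M R)"

text \<open>Only meaningful for a Noetherian local ring.\<close>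

definition depth :: "('a, 'b) ring_scheme \<Rightarrow> enat"
  where "depth R =
    Sup {enat (length xs) | xs. set xs \<subseteq> maximal_ideal_of R \<and> regular_sequence R xs}"


section \<open>Localization and the total ring of fractions\<close>

text \<open>In what follows \<open>S\<close> is a multiplicative subset of the commutative ring \<open>R\<close>.\<close>

definition fraction_rel :: "('a, 'b) ring_scheme \<Rightarrow> 'a set \<Rightarrow> (('a \<times> 'a) \<times> ('a \<times> 'a)) set"
  where "fraction_rel R S =
    {((a, s), (b, t)). a \<in> carrier R \<and> s \<in> S \<and> b \<in> carrier R \<and> t \<in> S \<and>
       (\<exists>u\<in>S. u \<otimes>\<^bsub>R\<^esub> (t \<otimes>\<^bsub>R\<^esub> a) = u \<otimes>\<^bsub>R\<^esub> (s \<otimes>\<^bsub>R\<^esub> b))}"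

definition fraction :: "('a, 'b) ring_scheme \<Rightarrow> 'a set \<Rightarrow> 'a \<Rightarrow> 'a \<Rightarrow> ('a \<times> 'a) set"
  where "fraction R S a s = fraction_rel R S `` {(a, s)}"

text \<open>
  The operations are given on representatives; the classes in each union all coincide.
\<close>

definition localization :: "('a, 'b) ring_scheme \<Rightarrow> 'a set \<Rightarrow> ('a \<times> 'a) set ring"
  where "localization R S =
    \<lparr> carrier = (carrier R \<times> S) // fraction_rel R S,
      monoid.mult = (\<lambda>F G. \<Union>(a, s)\<in>F. \<Union>(b, t)\<in>G. fraction R S (a \<otimes>\<^bsub>R\<^esub> b) (s \<otimes>\<^bsub>R\<^esub> t)),
      one = fraction R S \<one>\<^bsub>R\<^esub> \<one>\<^bsub>R\<^esub>,
      ring.zero = fraction R S \<zero>\<^bsub>R\<^esub> \<one>\<^bsub>R\<^esub>,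
      add = (\<lambda>F G. \<Union>(a, s)\<in>F. \<Union>(b, t)\<in>G.
               fraction R S (t \<otimes>\<^bsub>R\<^esub> a \<oplus>\<^bsub>R\<^esub> s \<otimes>\<^bsub>R\<^esub> b) (s \<otimes>\<^bsub>R\<^esub> t)) \<rparr>"

definition total_fractions :: "('a, 'b) ring_scheme \<Rightarrow> ('a \<times> 'a) set ring"
  where "total_fractions R = localization R (nonzerodivisors R)"

definition to_fractions :: "('a, 'b) ring_scheme \<Rightarrow> 'a \<Rightarrow> ('a \<times> 'a) set"
  where "to_fractions R a = fraction R (nonzerodivisors R) a \<one>\<^bsub>R\<^esub>"

definition S2_ification :: "('a, 'b) ring_scheme \<Rightarrow> ('a \<times> 'a) set set"
  where "S2_ification R =
    {f \<in> carrier (total_fractions R).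
       \<exists>J. ideal J R \<and> ideal_height R J \<ge> 2 \<and>
           (\<forall>x\<in>J. to_fractions R x \<otimes>\<^bsub>total_fractions R\<^esub> f \<in> to_fractions R ` carrier R)}"


section \<open>Regular rings\<close>

definition regular_local_ring :: "('a, 'b) ring_scheme \<Rightarrow> bool"
  where "regular_local_ring R \<longleftrightarrow>
    local_ring R \<and> noetherian_ring R \<and>
    (\<exists>G. finite G \<and> G \<subseteq> carrier R \<and> maximal_ideal_of R = Idl\<^bsub>R\<^esub> G \<and>
         enat (card G) = krull_dim R)"

definition regular_ring :: "('a, 'b) ring_scheme \<Rightarrow> bool"
  where "regular_ring R \<longleftrightarrow>
    cring R \<and> noetherian_ring R \<and>
    (\<forall>M. maximalideal M R \<longrightarrow> regular_local_ring (localization R (carrier R - M)))"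


section \<open>The diagonal map\<close>

text \<open>
  The map from \<open>T / (P1 \<inter> P2 \<inter> P3)\<close> to \<open>T / P1 \<oplus> T / P2 \<oplus> T / P3\<close> induced by
  \<open>x \<mapsto> (x + P1, x + P2, x + P3)\<close>: that triple is the same for all \<open>x\<close> in the coset \<open>a\<close>.
\<close>

definition diagonal_map ::
    "('a, 'b) ring_scheme \<Rightarrow> 'a set \<Rightarrow> 'a set \<Rightarrow> 'a set \<Rightarrow> 'a set \<Rightarrow> 'a set \<times> 'a set \<times> 'a set"
  where "diagonal_map T P1 P2 P3 a =
    the_elem ((\<lambda>x. (P1 +>\<^bsub>T\<^esub> x, P2 +>\<^bsub>T\<^esub> x, P3 +>\<^bsub>T\<^esub> x)) ` a)"

end

theory Submission
  imports Defs "HOL-Library.Infinite_Set" "HOL-Library.Countable" "HOL-Computational_Algebra.Primes"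
begin

text \<open>
  Everything is computed in \<open>T = K[[V]]\<close> itself. For a set \<open>W\<close> of variables, discarding all monomials
  that are not in \<open>W\<close> is an endomorphism of \<open>T\<close> with image \<open>K[[W]]\<close>; its kernel is the prime generated
  by the variables outside \<open>W\<close>, so the three primes are such kernels and congruences become equations
  in the domain \<open>T\<close>.

  Monomials are ordered by a weight that sends the variables to distinct prime numbers. By unique
  factorization this is a total order of type \<open>\<omega>\<close> compatible with multiplication, and division with
  remainder by finitely many series becomes a triangular linear system. This gives finite standard bases,
  hence the Noetherian property, and an Artin--Rees estimate. The latter makes the growth of the number of
  standard monomials drop at every step of a chain of primes, which bounds the dimension. It also shows
  that \<open>K[[W]]\<close> is completely integrally closed, which replaces factoriality in the computation of the
  \<open>S\<^sub>2\<close>-ification: an ideal of denominators of a fraction outside the ring lies in a prime of height at most one.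

  The symmetric polynomials \<open>e\<^sub>2\<close>, \<open>e\<^sub>1\<close> in one variable of each block form a regular sequence. For an
  arbitrary regular sequence \<open>p, q\<close> the module \<open>A/(p, q)\<close> has a socle, which comes from the
  cokernel of \<open>A \<rightarrow> B\<close>, so the depth is two. Finally \<open>e\<^sub>2\<close> is a nonzerodivisor that multiplies \<open>B\<close> into \<open>A\<close>,
  which embeds \<open>B\<close> into the total ring of fractions.
\<close>

section \<open>Power series rings\<close>

text \<open>The depth is two because of the exact sequence
  \<open>0 -> A -> B -> K[[X]] + K[[Y]] + K[[Z]] -> K -> 0\<close>: an element of \<open>B\<close>
  lies in \<open>A\<close> iff its components agree on the three overlaps
  \<open>T / (Pi + Pj)\<close>, and the differences on the overlaps are arbitrary except that their
  constant terms, taken cyclically, add up to zero. The last term \<open>K\<close> is what produces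
  the socle of \<open>A / (p, q)\<close>. Since the depth is a supremum over all regular sequences,
  exhibiting one maximal sequence does not bound it; the class from \<open>K\<close> has to be
  followed through an arbitrary regular pair. For this the pair must remain regular on
  \<open>B\<close>, and comparing \<open>A\<close> with \<open>B\<close> introduces the denominator
  \<open>e2\<close>. It is removed by a second such element, built from other variables and
  componentwise coprime to the first; here \<open>m >= 2\<close> enters. It enters again through the
  conductor of \<open>A\<close> in \<open>B\<close>, which then has height at least two, so that
  \<open>B\<close> lies in the \<open>S2\<close>-ification. Weights are multiplicative, so orders of
  series are measured by cutoffs \<open>2 ^ k\<close>: a bounded factor in the weight becomes a
  bounded shift of \<open>k\<close>.\<close>

lemma (in comm_monoid) finprod_Sigma:
  assumes "finite A" "\<And>a. a \<in> A \<Longrightarrow> finite (B a)"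
    and "\<And>a b. a \<in> A \<Longrightarrow> b \<in> B a \<Longrightarrow> f a b \<in> carrier G"
  shows "finprod G (\<lambda>a. finprod G (f a) (B a)) A = finprod G (\<lambda>(a, b). f a b) (Sigma A B)"
proof -
  have "finprod G (\<lambda>(a, b). f a b) (\<Union>a\<in>A. Pair a ` B a)
      = finprod G (\<lambda>a. finprod G (\<lambda>(a, b). f a b) (Pair a ` B a)) A"
    by (intro finprod_UN_disjoint) (auto simp: assms pairwise_def disjnt_def)
  also have "\<dots> = finprod G (\<lambda>a. finprod G (f a) (B a)) A"
  proof (intro finprod_cong')
    fix a assume a: "a \<in> A"
    show "finprod G (\<lambda>(a, b). f a b) (Pair a ` B a) = finprod G (f a) (B a)"
      by (subst finprod_reindex) (use a assms in \<open>auto simp: inj_on_def Pi_def\<close>)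
  qed (auto simp: assms Pi_def)
  also have "(\<Union>a\<in>A. Pair a ` B a) = Sigma A B"
    by auto
  finally show ?thesis by simp
qed

lemmas (in abelian_monoid) finsum_Sigma = add.finprod_Sigma

lemma (in abelian_monoid) finsum_single:
  assumes "finite A" "a \<in> A" "f a \<in> carrier G" "\<And>x. x \<in> A \<Longrightarrow> x \<noteq> a \<Longrightarrow> f x = \<zero>"
  shows "finsum G f A = f a"
proof -
  have "finsum G f A = finsum G f {a}"
    by (rule add.finprod_mono_neutral_cong_right) (use assms in \<open>force simp: Pi_def\<close>)+
  then show ?thesis
    using assms by simp
qed

definition splits :: "'v multiset \<Rightarrow> ('v multiset \<times> 'v multiset) set"
  where "splits M = {(M1, M2). M1 + M2 = M}"

lemma mem_splits: "p \<in> splits M \<longleftrightarrow> fst p + snd p = M"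
  by (cases p) (simp add: splits_def)

lemma finite_multisets_below: "finite {N. N \<subseteq># M}"
proof (induction M)
  case (add x M)
  have "{N. N \<subseteq># add_mset x M} \<subseteq> {N. N \<subseteq># M} \<union> add_mset x ` {N. N \<subseteq># M}"
  proof
    fix N assume N: "N \<in> {N. N \<subseteq># add_mset x M}"
    show "N \<in> {N. N \<subseteq># M} \<union> add_mset x ` {N. N \<subseteq># M}"
    proof (cases "x \<in># N")
      case True
      then obtain N' where N': "N = add_mset x N'"
        by (metis insert_DiffM)
      then show ?thesis using N by auto
    next
      case False
      then have "count N y \<le> count M y" for y
        using N by (cases "y = x") (auto simp: subseteq_mset_def not_in_iff dest: spec[of _ y])
      then show ?thesis
        by (auto simp: subseteq_mset_def)
    qed
  qed
  then show ?case
    using add by (auto intro: finite_subset)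
qed simp

lemma finite_splits [simp]: "finite (splits M)"
proof (rule finite_subset)
  show "splits M \<subseteq> {N. N \<subseteq># M} \<times> {N. N \<subseteq># M}"
    by (auto simp: splits_def)
qed (simp add: finite_multisets_below)

context cring
begin

abbreviation PS :: "'v set \<Rightarrow> ('v multiset \<Rightarrow> 'a) ring"
  where "PS V \<equiv> power_series_ring R V"

definition conv :: "('v multiset \<Rightarrow> 'a) \<Rightarrow> ('v multiset \<Rightarrow> 'a) \<Rightarrow> 'v multiset \<Rightarrow> 'a" (infixl \<open>\<star>\<close> 70)
  where "(f \<star> g) M = (\<Oplus>p\<in>splits M. f (fst p) \<otimes> g (snd p))"

lemma PS_mem: "f \<in> carrier (PS V) \<longleftrightarrow> (\<forall>M. f M \<in> carrier R) \<and> (\<forall>M. \<not> set_mset M \<subseteq> V \<longrightarrow> f M = \<zero>)"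
  by (simp add: power_series_ring_def)

lemma PS_coeff: "f \<in> carrier (PS V) \<Longrightarrow> f M \<in> carrier R"
  by (simp add: PS_mem)

lemma PS_ops [simp]:
  "\<zero>\<^bsub>PS V\<^esub> = (\<lambda>M. \<zero>)"
  "\<one>\<^bsub>PS V\<^esub> = indexed_const \<one>"
  "f \<oplus>\<^bsub>PS V\<^esub> g = (\<lambda>M. f M \<oplus> g M)"
  "f \<otimes>\<^bsub>PS V\<^esub> g = f \<star> g"
  unfolding power_series_ring_def splits_def[symmetric]
  by (simp_all add: indexed_zero_def indexed_padd_def conv_def[abs_def])

lemma conv_closed [simp]:
  assumes "\<And>M. f M \<in> carrier R" "\<And>M. g M \<in> carrier R"
  shows "(f \<star> g) M \<in> carrier R"
  unfolding conv_def by (rule finsum_closed) (use assms in auto)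

lemma conv_comm:
  fixes f g :: "'v multiset \<Rightarrow> 'a"
  assumes "\<And>M. f M \<in> carrier R" "\<And>M. g M \<in> carrier R"
  shows "f \<star> g = g \<star> f"
proof
  fix M :: "'v multiset"
  have sw: "splits M = prod.swap ` splits M"
    by (auto simp: splits_def image_iff add.commute)
  have "(f \<star> g) M = (\<Oplus>p\<in>prod.swap ` splits M. f (fst p) \<otimes> g (snd p))"
    unfolding conv_def using sw by simp
  also have "\<dots> = (\<Oplus>p\<in>splits M. f (fst (prod.swap p)) \<otimes> g (snd (prod.swap p)))"
    by (subst finsum_reindex) (use assms in auto)
  also have "\<dots> = (g \<star> f) M"
    unfolding conv_def by (intro finsum_cong') (use assms m_comm in auto)
  finally show "(f \<star> g) M = (g \<star> f) M" .
qed

lemma conv_add_left: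
  assumes "\<And>M. f M \<in> carrier R" "\<And>M. g M \<in> carrier R" "\<And>M. h M \<in> carrier R"
  shows "(\<lambda>M. f M \<oplus> g M) \<star> h = (\<lambda>M. (f \<star> h) M \<oplus> (g \<star> h) M)"
  unfolding conv_def
  by (subst finsum_addf[symmetric]) (auto simp: fun_eq_iff assms l_distr intro!: finsum_cong')

text \<open>Both bracketings are reindexed to one sum over the triples of monomials with total
  \<open>M\<close>.\<close>

lemma conv_assoc:
  fixes f g h :: "'v multiset \<Rightarrow> 'a"
  assumes "\<And>M. f M \<in> carrier R" "\<And>M. g M \<in> carrier R" "\<And>M. h M \<in> carrier R"
  shows "(f \<star> g) \<star> h = f \<star> (g \<star> h)"
proof
  fix M :: "'v multiset"
  define t where "t = (\<lambda>(x, y, z). f x \<otimes> (g y \<otimes> h z))"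
  have "((f \<star> g) \<star> h) M =
      (\<Oplus>p\<in>splits M. \<Oplus>q\<in>splits (fst p). f (fst q) \<otimes> g (snd q) \<otimes> h (snd p))"
    unfolding conv_def
    by (intro finsum_cong' finsum_ldistr) (auto simp: assms)
  also have "\<dots> = finsum R (\<lambda>(p, q). f (fst q) \<otimes> g (snd q) \<otimes> h (snd p)) (Sigma (splits M) (\<lambda>p. splits (fst p)))"
    by (intro finsum_Sigma) (auto simp: assms)
  also have "\<dots> = (\<Oplus>x\<in>Sigma (splits M) (\<lambda>p. splits (fst p)). t (fst (snd x), snd (snd x), snd (fst x)))"
    by (intro finsum_cong') (auto simp: assms t_def m_assoc)
  also have "\<dots> = finsum R t ((\<lambda>x. (fst (snd x), snd (snd x), snd (fst x))) ` Sigma (splits M) (\<lambda>p. splits (fst p)))"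
    by (subst finsum_reindex) (auto simp: assms t_def inj_on_def splits_def)
  also have "(\<lambda>x. (fst (snd x), snd (snd x), snd (fst x))) ` Sigma (splits M) (\<lambda>p. splits (fst p)) = {(x, y, z). x + y + z = M}"
    by (force simp: splits_def image_iff)
  also have "\<dots> = (\<lambda>x. (fst (fst x), fst (snd x), snd (snd x))) ` Sigma (splits M) (\<lambda>p. splits (snd p))"
    by (force simp: splits_def image_iff add.assoc)
  also have "finsum R t \<dots> = (\<Oplus>x\<in>Sigma (splits M) (\<lambda>p. splits (snd p)). t (fst (fst x), fst (snd x), snd (snd x)))"
    by (subst finsum_reindex) (auto simp: assms t_def inj_on_def splits_def)
  also have "\<dots> = finsum R (\<lambda>(p, q). t (fst p, fst q, snd q)) (Sigma (splits M) (\<lambda>p. splits (snd p)))"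
    by (intro finsum_cong') (auto simp: assms t_def)
  also have "\<dots> = (\<Oplus>p\<in>splits M. \<Oplus>q\<in>splits (snd p). t (fst p, fst q, snd q))"
    by (intro finsum_Sigma[symmetric]) (auto simp: assms t_def)
  also have "\<dots> = (f \<star> (g \<star> h)) M"
    unfolding conv_def t_def
    by (intro finsum_cong') (auto simp: assms split_def intro!: finsum_rdistr[symmetric])
  finally show "((f \<star> g) \<star> h) M = (f \<star> (g \<star> h)) M" .
qed

lemma conv_const:
  fixes f :: "'v multiset \<Rightarrow> 'a"
  assumes "c \<in> carrier R" "\<And>M. f M \<in> carrier R"
  shows "indexed_const c \<star> f = (\<lambda>M. c \<otimes> f M)"
proof
  fix M :: "'v multiset"
  have "(indexed_const c \<star> f) M = indexed_const c (fst ({#} :: 'v multiset, M)) \<otimes> f (snd ({#} :: 'v multiset, M))"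
    unfolding conv_def
    by (rule finsum_single[where f = "\<lambda>p. indexed_const c (fst p) \<otimes> f (snd p)"]) (auto simp: mem_splits indexed_const_def assms)
  then show "(indexed_const c \<star> f) M = c \<otimes> f M"
    by (simp add: indexed_const_def)
qed

lemma PS_cring: "cring (PS V)"
proof (rule cringI)
  show "abelian_group (PS V)"
  proof (rule abelian_groupI)
    fix f assume f: "f \<in> carrier (PS V)"
    show "\<exists>g\<in>carrier (PS V). g \<oplus>\<^bsub>PS V\<^esub> f = \<zero>\<^bsub>PS V\<^esub>"
      by (rule bexI[of _ "\<lambda>M. \<ominus> f M"]) (use f in \<open>auto simp: PS_mem l_neg\<close>)
  qed (auto simp: PS_mem a_assoc intro!: ext intro: a_comm)
  show "comm_monoid (PS V)"
  proof (rule comm_monoidI)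
    fix f g assume "f \<in> carrier (PS V)" "g \<in> carrier (PS V)"
    then have f: "\<And>M. f M \<in> carrier R" "\<And>M. \<not> set_mset M \<subseteq> V \<Longrightarrow> f M = \<zero>"
      and g: "\<And>M. g M \<in> carrier R" "\<And>M. \<not> set_mset M \<subseteq> V \<Longrightarrow> g M = \<zero>"
      by (auto simp: PS_mem)
    have "(f \<star> g) M = \<zero>" if "\<not> set_mset M \<subseteq> V" for M
    proof -
      have "f (fst p) \<otimes> g (snd p) = \<zero>" if p: "p \<in> splits M" for p
      proof -
        have "\<not> set_mset (fst p) \<subseteq> V \<or> \<not> set_mset (snd p) \<subseteq> V"
          using p \<open>\<not> set_mset M \<subseteq> V\<close> by (auto simp: splits_def)
        then show ?thesis using f(2)[of "fst p"] g(2)[of "snd p"] f(1) g(1) by (elim disjE) simp_all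
      qed
      then show ?thesis
        unfolding conv_def by (simp add: add.finprod_one_eqI)
    qed
    then show "f \<otimes>\<^bsub>PS V\<^esub> g \<in> carrier (PS V)"
      by (simp add: PS_mem f g)
  next
    show "\<one>\<^bsub>PS V\<^esub> \<in> carrier (PS V)"
      by (auto simp: PS_mem indexed_const_def)
  qed (auto simp: conv_assoc conv_const PS_coeff intro: conv_comm)
qed (simp add: conv_add_left PS_coeff)

lemma PS_conv_closed [simp, intro]:
  "f \<in> carrier (PS V) \<Longrightarrow> g \<in> carrier (PS V) \<Longrightarrow> f \<star> g \<in> carrier (PS V)"
  using cring.cring_simprules(5)[OF PS_cring, of f V g] by simp

end


section \<open>Weights of monomials and division\<close>

definition wt :: "'v::countable multiset \<Rightarrow> nat"
  where "wt M = (\<Prod>v\<in>#M. enumerate {p::nat. normalization_semidom_class.prime p} (to_nat v))"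

lemma wt_prime: "normalization_semidom_class.prime (enumerate {p::nat. normalization_semidom_class.prime p} n)"
  using enumerate_in_set[OF primes_infinite, of n] by simp

lemma wt_empty [simp]: "wt {#} = 1"
  by (simp add: wt_def)

lemma wt_union [simp]: "wt (M + N) = wt M * wt N"
  by (simp add: wt_def)

lemma wt_pos [simp]: "wt M > 0"
  unfolding wt_def by (induction M) (auto simp: prime_gt_0_nat wt_prime)

lemma wt_ge_1 [simp]: "wt M \<ge> Suc 0"
  using wt_pos[of M] by linarith

lemma wt_nonzero [simp]: "wt M \<noteq> 0"
  using wt_pos[of M] by linarith

lemma wt_inj: "wt M = wt N \<longleftrightarrow> M = N"
proof
  let ?f = "\<lambda>v::'a. enumerate {p::nat. normalization_semidom_class.prime p} (to_nat v)"
  assume "wt M = wt N"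
  then have "prime_factorization (prod_mset (image_mset ?f M)) = prime_factorization (prod_mset (image_mset ?f N))"
    by (simp add: wt_def)
  then have *: "image_mset ?f M = image_mset ?f N"
    by (subst (asm) (1 2) prime_factorization_prod_mset_primes) (auto simp: wt_prime)
  have inj: "inj ?f"
    using strict_mono_enumerate[OF primes_infinite]
    using inj_compose[OF strict_mono_imp_inj_on inj_to_nat] by (simp add: comp_def)
  then have "image_mset (inv_into UNIV ?f) (image_mset ?f K) = K" for K
    by (simp add: multiset.map_comp comp_def inv_into_f_f[OF inj UNIV_I])
  then show "M = N"
    using * by metis
qed simp

text \<open>This compares weight with degree: monomials of weight below \<open>2 ^ k\<close> have
  degree below \<open>k\<close>, so the cutoff \<open>2 ^ k\<close> admits only polynomially many of
  them.\<close>

lemma two_power_size_le_wt: "2 ^ size M \<le> wt M"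
proof (induction M)
  case (add x M)
  have "wt (add_mset x M) = wt {#x#} * wt M"
    by (metis add_mset_add_single mult.commute wt_union)
  moreover have "wt {#x#} \<ge> 2"
    using prime_ge_2_nat[OF wt_prime] by (simp add: wt_def)
  ultimately show ?case
    using mult_le_mono[OF _ add] by fastforce
qed simp

lemma finite_wt_le: "finite {M. wt M \<le> n}"
  by (rule inj_on_finite[of wt _ "{..n}"]) (auto simp: inj_on_def wt_inj)

context cring
begin

text \<open>For power series the leading monomial is the lightest one; natural numbers as weights
  provide it for every nonzero series. At zero \<open>lm\<close> is arbitrary, which is why zero is
  excluded from sets of divisors.\<close>

definition lead :: "('v::countable multiset \<Rightarrow> 'a) \<Rightarrow> 'v multiset \<Rightarrow> bool"
  where "lead f M \<longleftrightarrow> f M \<noteq> \<zero> \<and> (\<forall>N. wt N < wt M \<longrightarrow> f N = \<zero>)"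

definition lm :: "('v::countable multiset \<Rightarrow> 'a) \<Rightarrow> 'v multiset"
  where "lm f = (THE M. lead f M)"

lemma lead_unique: "lead f M \<Longrightarrow> lead f N \<Longrightarrow> M = N"
  unfolding lead_def by (metis linorder_neqE_nat wt_inj)

lemma lm_eq: "lead f M \<Longrightarrow> lm f = M"
  unfolding lm_def using lead_unique by blast

lemma lead_exists:
  assumes "f M \<noteq> \<zero>"
  obtains N where "lead f N" "wt N \<le> wt M"
proof -
  obtain N where "f N \<noteq> \<zero>" "\<forall>K. f K \<noteq> \<zero> \<longrightarrow> wt N \<le> wt K"
    using ex_has_least_nat[of "\<lambda>N. f N \<noteq> \<zero>" M wt] assms by auto
  then show ?thesis
    using that[of N] assms by (auto simp: lead_def not_le[symmetric])
qed

lemma lead_lm: "f \<noteq> (\<lambda>_. \<zero>) \<Longrightarrow> lead f (lm f)"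
  by (metis lead_exists lm_eq ext)

lemma lead_nonzero: "lead f M \<Longrightarrow> f \<noteq> (\<lambda>_. \<zero>)"
  by (auto simp: lead_def)

text \<open>In any other factorization of \<open>N\<close> the second factor is lighter than
  \<open>G\<close>, where \<open>g\<close> vanishes, or heavier, and then the first factor is so
  light that \<open>f\<close> vanishes.\<close>

lemma conv_lead:
  fixes f g :: "'v::countable multiset \<Rightarrow> 'a"
  assumes f: "\<And>M. f M \<in> carrier R" and g: "\<And>M. g M \<in> carrier R"
    and f0: "\<And>A. wt A * wt G < wt N \<Longrightarrow> f A = \<zero>"
    and g0: "\<And>B. wt B < wt G \<Longrightarrow> g B = \<zero>"
  shows "(f \<star> g) N = (if G \<subseteq># N then f (N - G) \<otimes> g G else \<zero>)"
proof -
  have z: "f (fst p) \<otimes> g (snd p) = \<zero>" if p: "p \<in> splits N" and ne: "snd p \<noteq> G" for p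
  proof (cases "wt (snd p) < wt G")
    case False
    then have "wt G < wt (snd p)"
      using ne by (metis linorder_neqE_nat wt_inj)
    moreover have "wt N = wt (fst p) * wt (snd p)"
      using p by (auto simp: mem_splits)
    ultimately show ?thesis
      using f0[of "fst p"] g by simp
  qed (use g0 f in simp)
  show ?thesis
  proof (cases "G \<subseteq># N")
    case True
    then have "(N - G, G) \<in> splits N"
      by (simp add: mem_splits)
    then have "(f \<star> g) N = f (fst (N - G, G)) \<otimes> g (snd (N - G, G))"
      unfolding conv_def
    proof (intro finsum_single[where f = "\<lambda>p. f (fst p) \<otimes> g (snd p)"] z)
      fix p assume "p \<in> splits N" "p \<noteq> (N - G, G)"
      then show "snd p \<noteq> G"
        by (cases p) (auto simp: mem_splits)
    qed (use f g in auto)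
    then show ?thesis using True by simp
  next
    case False
    have "(f \<star> g) N = \<zero>"
      unfolding conv_def
    proof (intro add.finprod_one_eqI z)
      fix p assume "p \<in> splits N"
      then show "snd p \<noteq> G"
        using False by (auto simp: mem_splits)
    qed
    then show ?thesis using False by simp
  qed
qed

lemma conv_vanish:
  fixes f g :: "'v::countable multiset \<Rightarrow> 'a"
  assumes f: "\<And>M. f M \<in> carrier R" and g: "\<And>M. g M \<in> carrier R"
    and f0: "\<And>A. wt A < m \<Longrightarrow> f A = \<zero>"
    and g0: "\<And>B. wt B < n \<Longrightarrow> g B = \<zero>"
    and N: "wt N < m * n"
  shows "(f \<star> g) N = \<zero>"
  unfolding conv_def
proof (intro add.finprod_one_eqI)
  fix p assume "p \<in> splits N"
  then have "wt (fst p) * wt (snd p) < m * n"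
    using N by (auto simp: mem_splits)
  then have "wt (fst p) < m \<or> wt (snd p) < n"
    by (meson mult_le_mono not_less)
  then show "f (fst p) \<otimes> g (snd p) = \<zero>"
    using f0 g0 f g by auto
qed

end

context domain
begin

lemma lead_conv:
  fixes f g :: "'v::countable multiset \<Rightarrow> 'a"
  assumes f: "\<And>M. f M \<in> carrier R" and g: "\<And>M. g M \<in> carrier R"
    and A: "lead f A" and B: "lead g B"
  shows "lead (f \<star> g) (A + B)"
  unfolding lead_def
proof (intro conjI allI impI)
  have "(f \<star> g) (A + B) = f A \<otimes> g B"
    by (subst conv_lead[where G = B]) (use f g A B in \<open>auto simp: lead_def\<close>)
  then show "(f \<star> g) (A + B) \<noteq> \<zero>"
    using A B f g integral by (auto simp: lead_def)
  fix N :: "'v multiset" assume "wt N < wt (A + B)"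
  then show "(f \<star> g) N = \<zero>"
    by (intro conv_vanish[of f g "wt A" "wt B"]) (use f g A B in \<open>auto simp: lead_def\<close>)
qed

lemma PS_domain: "domain (PS (V :: 'v::countable set))"
proof (intro domain.intro domain_axioms.intro PS_cring)
  show "\<one>\<^bsub>PS V\<^esub> \<noteq> \<zero>\<^bsub>PS V\<^esub>"
    by (auto simp: indexed_const_def fun_eq_iff)
  fix f g assume fg: "f \<otimes>\<^bsub>PS V\<^esub> g = \<zero>\<^bsub>PS V\<^esub>" "f \<in> carrier (PS V)" "g \<in> carrier (PS V)"
  show "f = \<zero>\<^bsub>PS V\<^esub> \<or> g = \<zero>\<^bsub>PS V\<^esub>"
  proof (rule ccontr)
    assume "\<not> ?thesis"
    then have "lead f (lm f)" "lead g (lm g)"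
      using lead_lm by auto
    then have "lead (f \<star> g) (lm f + lm g)"
      using fg by (intro lead_conv) (auto simp: PS_mem)
    then show False
      using fg lead_nonzero by fastforce
  qed
qed

end

lemma (in cring) PS_finsum_coeff:
  assumes "\<And>i. i \<in> I \<Longrightarrow> u i \<in> carrier (PS V)"
  shows "finsum (PS V) u I M = (\<Oplus>i\<in>I. u i M)"
proof -
  interpret P: cring "PS V" by (rule PS_cring)
  show ?thesis
    using assms
  proof (induction I rule: infinite_finite_induct)
    case (insert i I)
    then have "finsum (PS V) u (insert i I) = u i \<oplus>\<^bsub>PS V\<^esub> finsum (PS V) u I"
      by (intro P.finsum_insert) auto
    with insert show ?case
      by (subst finsum_insert) (force intro: PS_coeff)+
  qed auto
qed

context field
begin

text \<open>
  The quotients \<open>h g\<close> are read off one series \<open>c\<close>, whose coefficient at \<open>N\<close> is assigned to a divisor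
  \<open>sel N\<close> with leading monomial below \<open>N\<close>. The sum \<open>L c\<close> of the products agrees with \<open>c\<close> up to
  coefficients of smaller weight, so \<open>c\<close> is found by recursion on the weight.
\<close>

theorem division:
  fixes F :: "('v::countable multiset \<Rightarrow> 'a) set"
  assumes F: "finite F" "F \<subseteq> carrier (PS V)" "(\<lambda>_. \<zero>) \<notin> F"
    and f: "f \<in> carrier (PS V)"
  obtains h where "\<And>g. g \<in> F \<Longrightarrow> h g \<in> carrier (PS V)"
    and "\<And>g N. g \<in> F \<Longrightarrow> lm g \<subseteq># N \<Longrightarrow> f N = (\<Oplus>g\<in>F. (h g \<star> g) N)"
    and "\<And>n g A. (\<And>M. wt M < n \<Longrightarrow> f M = \<zero>) \<Longrightarrow> g \<in> F \<Longrightarrow> wt A * wt (lm g) < n \<Longrightarrow> h g A = \<zero>"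
proof -
  have lead: "lead g (lm g)" if "g \<in> F" for g
    using that F(3) lead_lm[of g] by auto
  have Fc: "g M \<in> carrier R" if "g \<in> F" for g M
    using that F(2) PS_coeff by blast
  define E where "E = {N. \<exists>g\<in>F. lm g \<subseteq># N}"
  define sel where "sel = (\<lambda>N. SOME g. g \<in> F \<and> lm g \<subseteq># N)"
  have sel: "sel N \<in> F" "lm (sel N) \<subseteq># N" if "N \<in> E" for N
    using someI_ex[of "\<lambda>g. g \<in> F \<and> lm g \<subseteq># N"] that unfolding sel_def E_def by blast+
  define h where "h = (\<lambda>c g A. if A + lm g \<in> E \<and> sel (A + lm g) = g
    then c (A + lm g) \<otimes> inv (g (lm g)) else \<zero>)"
  have inv: "inv (g (lm g)) \<in> carrier R" "inv (g (lm g)) \<otimes> g (lm g) = \<one>" if "g \<in> F" for g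
    using lead[OF that] Fc[OF that] field_Units by (auto simp: lead_def)
  have hc: "h c g A \<in> carrier R" if "g \<in> F" "\<And>M. c M \<in> carrier R" for c g A
    using that inv by (auto simp: h_def)
  have hgc: "(h c g \<star> g) N \<in> carrier R" if "g \<in> F" "\<And>M. c M \<in> carrier R" for c g N
    by (rule conv_closed[OF hc[OF that] Fc[OF that(1)]])
  define L where "L = (\<lambda>c N. \<Oplus>g\<in>F. (h c g \<star> g) N)"
  have L_closed: "L c N \<in> carrier R" if "\<And>M. c M \<in> carrier R" for c N
    unfolding L_def by (intro finsum_closed Pi_I hgc that)
  have L_add: "L (\<lambda>M. c M \<oplus> d M) N = L c N \<oplus> L d N"
    if c: "\<And>M. c M \<in> carrier R" and d: "\<And>M. d M \<in> carrier R" for c d N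
  proof -
    have "(h (\<lambda>M. c M \<oplus> d M) g \<star> g) N = (h c g \<star> g) N \<oplus> (h d g \<star> g) N" if g: "g \<in> F" for g
    proof -
      have "h (\<lambda>M. c M \<oplus> d M) g = (\<lambda>A. h c g A \<oplus> h d g A)"
        using c d inv[OF g] by (auto simp: h_def l_distr)
      then show ?thesis
        by (simp add: conv_add_left hc[OF g] c d Fc[OF g])
    qed
    then have "L (\<lambda>M. c M \<oplus> d M) N = (\<Oplus>g\<in>F. (h c g \<star> g) N \<oplus> (h d g \<star> g) N)"
      unfolding L_def by (intro finsum_cong') (auto simp: hgc c d)
    also have "\<dots> = L c N \<oplus> L d N"
      unfolding L_def by (intro finsum_addf) (auto simp: hgc c d)
    finally show ?thesis .
  qed
  \<comment> \<open>The selector assigns each monomial to one divisor, so a series \<open>e\<close>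
    that starts at \<open>N\<close> contributes at \<open>N\<close> through \<open>sel N\<close>
    alone. This is the unit diagonal of the triangular system.\<close>
  have L_top: "L e N = e N" if N: "N \<in> E" and e: "\<And>M. e M \<in> carrier R" and e0: "\<And>M. wt M < wt N \<Longrightarrow> e M = \<zero>" for e N
  proof -
    have *: "(h e g \<star> g) N = (if g = sel N then e N else \<zero>)" if g: "g \<in> F" for g
    proof -
      have "(h e g \<star> g) N = (if lm g \<subseteq># N then h e g (N - lm g) \<otimes> g (lm g) else \<zero>)"
        using lead[OF g] by (intro conv_lead hc[OF g] e Fc[OF g]) (auto simp: h_def e0 lead_def inv g)
      also have "\<dots> = (if g = sel N then e N else \<zero>)"
        using sel[OF N] N inv[OF g] e Fc[OF g] by (auto simp: h_def m_assoc)
      finally show ?thesis .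
    qed
    have "L e N = (\<Oplus>g\<in>F. if g = sel N then e N else \<zero>)"
      unfolding L_def by (intro finsum_cong') (auto simp: * e)
    also have "\<dots> = (if sel N = sel N then e N else \<zero>)"
      by (rule finsum_single[where f = "\<lambda>g. if g = sel N then e N else \<zero>"]) (use F(1) sel[OF N] e in auto)
    finally show ?thesis by simp
  qed
  define below where "below = (\<lambda>(c :: 'v multiset \<Rightarrow> 'a) (N :: 'v multiset) M. if wt M < wt N then c M else \<zero>)"
  \<comment> \<open>The coefficient at \<open>N\<close> is what remains of \<open>f N\<close> after
    the contribution of the lighter coefficients. Since \<open>step\<close> inspects
    \<open>c\<close> only through \<open>below\<close>, the recursion unfolds without its
    cut.\<close>
  define step where "step = (\<lambda>c N. if N \<in> E then f N \<ominus> L (below c N) N else \<zero>)"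
  define c where "c = wfrec (measure wt) step"
  have c_rec: "c N = step c N" for N
  proof -
    have "c N = step (cut c (measure wt) N) N"
      unfolding c_def by (rule wfrec) simp
    also have "below (cut c (measure wt) N) N = below c N"
      by (auto simp: below_def cut_def)
    then have "step (cut c (measure wt) N) N = step c N"
      by (simp add: step_def)
    finally show ?thesis .
  qed
  \<comment> \<open>The vanishing clause is proved along with the recursion: as long as
    \<open>f\<close> has no terms below \<open>n\<close>, neither has \<open>c\<close>. It becomes
    the weight bound on the quotients.\<close>
  have c_prop: "c N \<in> carrier R \<and> (\<not> set_mset N \<subseteq> V \<longrightarrow> c N = \<zero>) \<and>
      (\<forall>n. (\<forall>M. wt M < n \<longrightarrow> f M = \<zero>) \<longrightarrow> wt N < n \<longrightarrow> c N = \<zero>)" for N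
  proof (induction N rule: measure_induct_rule[of wt])
    case (less N)
    have bc: "below c N M \<in> carrier R" "\<not> set_mset M \<subseteq> V \<Longrightarrow> below c N M = \<zero>" for M
      using less by (auto simp: below_def)
    have h: "h (below c N) g \<in> carrier (PS V)" if "g \<in> F" for g
      using bc inv[OF that] by (auto simp: PS_mem h_def)
    interpret P: cring "PS V" by (rule PS_cring)
    have Lp: "L (below c N) = finsum (PS V) (\<lambda>g. h (below c N) g \<otimes>\<^bsub>PS V\<^esub> g) F"
      unfolding L_def fun_eq_iff using h F(2) by (subst PS_finsum_coeff) auto
    have "L (below c N) \<in> carrier (PS V)"
      unfolding Lp using h F(2) by (auto intro!: P.finsum_closed simp del: PS_ops)
    then have 1: "L (below c N) N \<in> carrier R" "\<not> set_mset N \<subseteq> V \<Longrightarrow> L (below c N) N = \<zero>"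
      by (auto simp: PS_mem)
    have "c N = \<zero>" if n: "\<forall>M. wt M < n \<longrightarrow> f M = \<zero>" "wt N < n" for n
    proof -
      have b0: "below c N = (\<lambda>_. \<zero>)"
        using less n by (auto simp: below_def fun_eq_iff) 
      have "L (\<lambda>M. \<zero> \<oplus> \<zero>) N = L (\<lambda>M. \<zero>) N \<oplus> L (\<lambda>M. \<zero>) N"
        by (rule L_add) auto
      then have "L (below c N) N = \<zero>"
        using L_closed[of "\<lambda>_. \<zero>" N] unfolding b0 by simp
      then show ?thesis
        using n by (subst c_rec) (simp add: step_def minus_eq)
    qed
    moreover have "c N \<in> carrier R" "\<not> set_mset N \<subseteq> V \<Longrightarrow> c N = \<zero>"
      using 1 f c_rec[of N] by (auto simp: step_def PS_mem minus_eq)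
    ultimately show ?case by blast
  qed
  have Lc: "L c N = f N" if N: "N \<in> E" for N
  proof -
    have bL: "L (below c N) N \<in> carrier R"
      using L_closed[of "below c N" N] c_prop by (simp add: below_def)
    define e where "e = (\<lambda>M. if wt M < wt N then \<zero> else c M)"
    have "c = (\<lambda>M. below c N M \<oplus> e M)"
      using c_prop by (auto simp: below_def e_def)
    then have "L c N = L (below c N) N \<oplus> L e N"
      using L_add[of "below c N" e N] c_prop by (auto simp: below_def e_def)
    also have "L e N = c N"
      using L_top[OF N, of e] c_prop by (auto simp: e_def)
    also have "c N = f N \<ominus> L (below c N) N"
      by (subst c_rec) (simp add: step_def N)
    also have "L (below c N) N \<oplus> (f N \<ominus> L (below c N) N) = f N"
      using bL PS_coeff[OF f, of N] by (simp add: a_lcomm minus_eq r_neg)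
    finally show ?thesis .
  qed
  show ?thesis
  proof (rule that[of "h c"])
    show "h c g \<in> carrier (PS V)" if "g \<in> F" for g
      using inv[OF that] c_prop by (auto simp: PS_mem h_def)
    show "f N = (\<Oplus>g\<in>F. (h c g \<star> g) N)" if "g \<in> F" "lm g \<subseteq># N" for g N
      using Lc[of N, symmetric] that by (auto simp: L_def E_def)
    show "h c g A = \<zero>" if "\<And>M. wt M < n \<Longrightarrow> f M = \<zero>" "g \<in> F" "wt A * wt (lm g) < n" for n g A
    proof -
      have "c (A + lm g) = \<zero>"
        using c_prop[of "A + lm g"] that(1,3) by (metis wt_union)
      then show ?thesis
        using inv[OF that(2)] by (simp add: h_def)
    qed
  qed
qed

end

lemma (in cring) PS_a_inv_coeff:
  assumes "f \<in> carrier (PS V)"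
  shows "(\<ominus>\<^bsub>PS V\<^esub> f) M = \<ominus> f M"
proof -
  interpret P: cring "PS V" by (rule PS_cring)
  have "(\<ominus>\<^bsub>PS V\<^esub> f \<oplus>\<^bsub>PS V\<^esub> f) M = \<zero>"
    using assms P.l_neg by simp
  moreover have "\<ominus>\<^bsub>PS V\<^esub> f \<in> carrier (PS V)"
    using assms by simp
  ultimately show ?thesis
    using assms by (intro minus_equality[symmetric] PS_coeff[of _ V]) simp_all
qed

lemma (in cring) PS_minus_coeff:
  assumes "f \<in> carrier (PS V)" "g \<in> carrier (PS V)"
  shows "(f \<ominus>\<^bsub>PS V\<^esub> g) M = f M \<ominus> g M"
  using PS_a_inv_coeff[OF assms(2)] by (simp add: a_minus_def)

declare (in cring) PS_ops [simp del]


section \<open>Standard bases and the Noetherian property\<close>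

lemma strict_mono_mono_subsequence:
  fixes s :: "nat \<Rightarrow> nat"
  obtains r :: "nat \<Rightarrow> nat" where "strict_mono r" "mono (\<lambda>i. s (r i))"
proof -
  obtain f where f: "strict_mono f" "monoseq (\<lambda>n. s (f n))"
    using seq_monosub[of s] by blast
  show ?thesis
  proof (cases "\<forall>m n. m \<le> n \<longrightarrow> s (f m) \<le> s (f n)")
    case True
    then show ?thesis using that[of f] f by (auto simp: mono_def)
  next
    case False
    then have dec: "s (f n) \<le> s (f m)" if "m \<le> n" for m n
      using f(2) that by (auto simp: monoseq_def)
    have "\<exists>n0. True \<and> (\<forall>n. True \<longrightarrow> s (f n0) \<le> s (f n))"
      by (rule ex_has_least_nat) simp
    then obtain n0 where n0: "\<And>n. s (f n0) \<le> s (f n)"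
      by blast
    \<comment> \<open>A nonincreasing sequence of natural numbers is constant once it has reached
      its minimum.\<close>
    have "s (f (n0 + i)) = s (f n0)" for i
      using n0[of "n0 + i"] dec[of n0 "n0 + i"] by simp
    then show ?thesis
      using that[of "\<lambda>i. f (n0 + i)"] f(1) by (auto simp: mono_def strict_mono_def)
  qed
qed

text \<open>The sequence is thinned out for one variable at a time; monotonicity already achieved
  passes to subsequences.\<close>

lemma mono_count_subsequence:
  assumes "finite V"
  shows "\<exists>r :: nat \<Rightarrow> nat. strict_mono r \<and> (\<forall>v\<in>V. mono (\<lambda>i. count (s (r i)) v))"
  using assms
proof (induction V)
  case empty
  show ?case by (intro exI[of _ id]) (simp add: strict_mono_def)
next
  case (insert x V)
  then obtain r :: "nat \<Rightarrow> nat" where r: "strict_mono r" "\<And>v. v \<in> V \<Longrightarrow> mono (\<lambda>i. count (s (r i)) v)"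
    by auto
  obtain r' :: "nat \<Rightarrow> nat" where r': "strict_mono r'" "mono (\<lambda>i. count (s (r (r' i))) x)"
    using strict_mono_mono_subsequence[of "\<lambda>i. count (s (r i)) x"] by blast
  have "mono (\<lambda>i. count (s (r (r' i))) v)" if "v \<in> V" for v
    using r(2)[OF that] strict_mono_mono[OF r'(1)] by (auto simp: mono_def)
  then show ?case
    using r(1) r'(1,2) by (intro exI[of _ "\<lambda>i. r (r' i)"]) (auto simp: strict_mono_def)
qed

text \<open>The members of \<open>S\<close> that are minimal for inclusion form an antichain. If
  infinite, it would contain a sequence along which no exponent decreases, hence two comparable
  members.\<close>

lemma dickson:
  fixes S :: "'v multiset set"
  assumes V: "finite V" and S: "\<forall>M\<in>S. set_mset M \<subseteq> V"
  shows "\<exists>F. finite F \<and> F \<subseteq> S \<and> (\<forall>M\<in>S. \<exists>N\<in>F. N \<subseteq># M)"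
proof -
  define F where "F = {M \<in> S. \<forall>N\<in>S. N \<subseteq># M \<longrightarrow> N = M}"
  have "finite F"
  proof (rule ccontr)
    assume "infinite F"
    then obtain s :: "nat \<Rightarrow> 'v multiset" where s: "inj s" "range s \<subseteq> F"
      using infinite_countable_subset by blast
    obtain r :: "nat \<Rightarrow> nat" where r: "strict_mono r \<and> (\<forall>v\<in>V. mono (\<lambda>i. count (s (r i)) v))"
      using mono_count_subsequence[OF V, of s] ..
    have sub: "set_mset (s i) \<subseteq> V" for i
      using s(2) S by (auto simp: F_def)
    have "count (s (r 0)) v \<le> count (s (r 1)) v" for v
    proof (cases "v \<in> V")
      case False
      then have "v \<notin># s (r 0)"
        using sub[of "r 0"] by blast
      then show ?thesis
        by (simp add: not_in_iff)
    qed (use r in \<open>auto simp: mono_def\<close>)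
    then have "s (r 0) \<subseteq># s (r 1)"
      by (simp add: subseteq_mset_def)
    moreover have "s (r 0) \<in> F" "s (r 1) \<in> F"
      using s(2) by auto
    ultimately have "s (r 0) = s (r 1)"
      by (auto simp: F_def)
    then show False
      using s(1) r by (auto dest!: injD strict_mono_eq)
  qed
  moreover have "\<exists>N\<in>F. N \<subseteq># M" if "M \<in> S" for M
    using that
  proof (induction M rule: measure_induct_rule[of size])
    case (less M)
    show ?case
    proof (cases "M \<in> F")
      case False
      then obtain N where N: "N \<in> S" "N \<subseteq># M" "N \<noteq> M"
        using less.prems by (auto simp: F_def)
      then have "size N < size M"
        by (meson mset_subset_size subset_mset.le_neq_trans)
      then show ?thesis
        using less.IH[of N] N subset_mset.trans by blast
    qed auto
  qed
  ultimately show ?thesis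
    by (intro exI[of _ F]) (auto simp: F_def)
qed

context field
begin

text \<open>Divide \<open>1\<close> by \<open>f\<close>: the leading monomial of \<open>f\<close> is
  empty and divides every monomial, so no remainder can occur.\<close>

lemma PS_unit:
  fixes f :: "'v::countable multiset \<Rightarrow> 'a"
  assumes f: "f \<in> carrier (PS V)" and f0: "f {#} \<noteq> \<zero>"
  shows "f \<in> Units (PS V)"
proof -
  interpret P: cring "PS V" by (rule PS_cring)
  have "lead f {#}"
    using f0 by (auto simp: lead_def)
  then have lm: "lm f = {#}"
    by (rule lm_eq)
  have ne: "f \<noteq> (\<lambda>_. \<zero>)" using f0 by auto
  have F: "finite {f}" "{f} \<subseteq> carrier (PS V)" "(\<lambda>_. \<zero>) \<notin> {f}"
    using f ne by auto
  obtain h where h: "\<And>g. g \<in> {f} \<Longrightarrow> h g \<in> carrier (PS V)"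
    "\<And>g N. g \<in> {f} \<Longrightarrow> lm g \<subseteq># N \<Longrightarrow> \<one>\<^bsub>PS V\<^esub> N = (\<Oplus>g\<in>{f}. (h g \<star> g) N)"
    "\<And>n g A. (\<And>M. wt M < n \<Longrightarrow> \<one>\<^bsub>PS V\<^esub> M = \<zero>) \<Longrightarrow> g \<in> {f} \<Longrightarrow> wt A * wt (lm g) < n \<Longrightarrow> h g A = \<zero>"
    by (erule division[OF F P.one_closed])
  have "\<one>\<^bsub>PS V\<^esub> N = (h f \<star> f) N" for N
    using h(2)[of f N] h(1) f by (simp add: lm PS_coeff)
  then have "h f \<otimes>\<^bsub>PS V\<^esub> f = \<one>\<^bsub>PS V\<^esub>"
    by (simp add: PS_ops fun_eq_iff)
  then show ?thesis
    using h(1) f P.m_comm by (auto simp: Units_def intro!: bexI[of _ "h f"])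
qed

lemma standard_basis:
  fixes V :: "'v::countable set"
  assumes V: "finite V" and I: "ideal I (PS V)"
  shows "\<exists>F. finite F \<and> F \<subseteq> I \<and> (\<lambda>_. \<zero>) \<notin> F \<and>
    (\<forall>f\<in>I. f \<noteq> (\<lambda>_. \<zero>) \<longrightarrow> (\<exists>g\<in>F. lm g \<subseteq># lm f))"
proof -
  interpret I: ideal I "PS V" by fact
  define S where "S = lm ` (I - {\<lambda>_. \<zero>})"
  have SV: "\<forall>M\<in>S. set_mset M \<subseteq> V"
  proof
    fix M assume M: "M \<in> S"
    obtain f where f: "f \<in> I" "f \<noteq> (\<lambda>_. \<zero>)" "M = lm f"
      using M by (auto simp: S_def)
    show "set_mset M \<subseteq> V"
      using lead_lm[OF f(2)] I.a_Hcarr[OF f(1)] f(3) by (auto simp: PS_mem lead_def)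
  qed
  obtain E where E: "finite E" "E \<subseteq> S" "\<And>M. M \<in> S \<Longrightarrow> \<exists>N\<in>E. N \<subseteq># M"
    using dickson[OF V SV] by blast
  obtain F where F: "finite F" "F \<subseteq> I - {\<lambda>_. \<zero>}" "E = lm ` F"
    using finite_subset_image[OF E(1) E(2)[unfolded S_def]] by metis
  have "\<exists>g\<in>F. lm g \<subseteq># lm f" if "f \<in> I" "f \<noteq> (\<lambda>_. \<zero>)" for f
  proof -
    have "lm f \<in> S"
      using that by (simp add: S_def)
    then show ?thesis
      using E(3) F(3) by blast
  qed
  then show ?thesis
    using F by blast
qed

text \<open>The remainder of the division lies in \<open>I\<close> and has no monomial divisible by
  a leading monomial of \<open>F\<close>, so it is zero. The last clause carries the weight bound of
  the division along; the Artin-Rees estimate rests on it.\<close>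

lemma standard_basis_combination:
  fixes V :: "'v::countable set"
  assumes I: "ideal I (PS V)" and F: "finite F" "F \<subseteq> I" "(\<lambda>_. \<zero>) \<notin> F"
    and lm: "\<forall>f\<in>I. f \<noteq> (\<lambda>_. \<zero>) \<longrightarrow> (\<exists>g\<in>F. lm g \<subseteq># lm f)"
    and f: "f \<in> I"
  shows "\<exists>h. (\<forall>g\<in>F. h g \<in> carrier (PS V)) \<and> f = (\<Oplus>\<^bsub>PS V\<^esub>g\<in>F. h g \<otimes>\<^bsub>PS V\<^esub> g) \<and>
    (\<forall>n. (\<forall>M. wt M < n \<longrightarrow> f M = \<zero>) \<longrightarrow> (\<forall>g\<in>F. \<forall>A. wt A * wt (lm g) < n \<longrightarrow> h g A = \<zero>))"
proof -
  interpret P: cring "PS V" by (rule PS_cring)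
  interpret I: ideal I "PS V" by fact
  have Fc: "F \<subseteq> carrier (PS V)"
    using F I.a_subset by blast
  obtain h where h: "\<And>g. g \<in> F \<Longrightarrow> h g \<in> carrier (PS V)"
    "\<And>g N. g \<in> F \<Longrightarrow> lm g \<subseteq># N \<Longrightarrow> f N = (\<Oplus>g\<in>F. (h g \<star> g) N)"
    "\<And>n g A. (\<And>M. wt M < n \<Longrightarrow> f M = \<zero>) \<Longrightarrow> g \<in> F \<Longrightarrow> wt A * wt (lm g) < n \<Longrightarrow> h g A = \<zero>"
    using division[OF F(1) Fc F(3) I.a_Hcarr[OF f]] by blast
  define s where "s = (\<Oplus>\<^bsub>PS V\<^esub>g\<in>F. h g \<otimes>\<^bsub>PS V\<^esub> g)"
  have hI: "h g \<otimes>\<^bsub>PS V\<^esub> g \<in> I" if "g \<in> F" for g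
    using h(1)[OF that] F(2) that I.I_l_closed by auto
  have "s \<in> I"
    unfolding s_def using F(1) hI
  proof (induction F rule: finite_induct)
    case (insert x F)
    then have "(\<lambda>g. h g \<otimes>\<^bsub>PS V\<^esub> g) \<in> insert x F \<rightarrow> carrier (PS V)"
      using I.a_Hcarr by blast
    with insert show ?case
      by (subst P.finsum_insert) (auto intro: I.a_closed)
  qed (simp add: P.finsum_empty)
  define r where "r = f \<ominus>\<^bsub>PS V\<^esub> s"
  have r: "r \<in> I"
    unfolding r_def a_minus_def using f \<open>s \<in> I\<close> by (intro I.a_closed I.a_inv_closed)
  have "r = (\<lambda>_. \<zero>)"
  proof (rule ccontr)
    assume ne: "r \<noteq> (\<lambda>_. \<zero>)"
    then obtain g where g: "g \<in> F" "lm g \<subseteq># lm r"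
      using lm r by blast
    have "f (lm r) = s (lm r)"
      unfolding s_def using h(2)[OF g] by (subst PS_finsum_coeff) (use h(1) Fc in \<open>auto simp: PS_ops\<close>)
    then have "r (lm r) = \<zero>"
      unfolding r_def using PS_coeff[OF I.a_Hcarr[OF \<open>s \<in> I\<close>]] f \<open>s \<in> I\<close> I.a_Hcarr
      by (simp add: PS_minus_coeff minus_eq r_neg del: P.minus_eq)
    then show False
      using lead_lm[OF ne] by (simp add: lead_def)
  qed
  then have "f = s"
    using P.r_right_minus_eq[OF I.a_Hcarr[OF f] I.a_Hcarr[OF \<open>s \<in> I\<close>]] unfolding r_def PS_ops(1) by simp
  show ?thesis
  proof (intro exI[of _ h] conjI)
    show "\<forall>g\<in>F. h g \<in> carrier (PS V)"
      using h(1) by blast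
    show "f = (\<Oplus>\<^bsub>PS V\<^esub>g\<in>F. h g \<otimes>\<^bsub>PS V\<^esub> g)"
      using \<open>f = s\<close> by (simp add: s_def)
    show "\<forall>n. (\<forall>M. wt M < n \<longrightarrow> f M = \<zero>) \<longrightarrow> (\<forall>g\<in>F. \<forall>A. wt A * wt (lm g) < n \<longrightarrow> h g A = \<zero>)"
      using h(3) by blast
  qed
qed

theorem PS_noetherian:
  fixes V :: "'v::countable set"
  assumes V: "finite V"
  shows "noetherian_ring (PS V)"
proof -
  interpret P: cring "PS V" by (rule PS_cring)
  show ?thesis
  proof (rule P.noetherian_ringI)
    fix I assume I: "ideal I (PS V)"
    interpret I: ideal I "PS V" by fact
    obtain F where F: "finite F" "F \<subseteq> I" "(\<lambda>_. \<zero>) \<notin> F"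
      "\<forall>f\<in>I. f \<noteq> (\<lambda>_. \<zero>) \<longrightarrow> (\<exists>g\<in>F. lm g \<subseteq># lm f)"
      using standard_basis[OF V I] by blast
    have Fc: "F \<subseteq> carrier (PS V)"
      using F I.a_subset by blast
    interpret J: ideal "Idl\<^bsub>PS V\<^esub> F" "PS V"
      using P.genideal_ideal[OF Fc] .
    have "f \<in> Idl\<^bsub>PS V\<^esub> F" if f: "f \<in> I" for f
    proof -
      obtain h where h: "\<And>g. g \<in> F \<Longrightarrow> h g \<in> carrier (PS V)"
        "f = (\<Oplus>\<^bsub>PS V\<^esub>g\<in>F. h g \<otimes>\<^bsub>PS V\<^esub> g)"
        using standard_basis_combination[OF I F f] by blast
      have hI: "h g \<otimes>\<^bsub>PS V\<^esub> g \<in> Idl\<^bsub>PS V\<^esub> F" if "g \<in> F" for g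
        using h(1)[OF that] P.genideal_self[OF Fc] that J.I_l_closed by auto
      have "G \<subseteq> F \<Longrightarrow> (\<Oplus>\<^bsub>PS V\<^esub>g\<in>G. h g \<otimes>\<^bsub>PS V\<^esub> g) \<in> Idl\<^bsub>PS V\<^esub> F" if "finite G" for G
        using that
      proof (induction G rule: finite_induct)
        case (insert x G)
        then have "(\<lambda>g. h g \<otimes>\<^bsub>PS V\<^esub> g) \<in> insert x G \<rightarrow> carrier (PS V)"
          using hI J.a_Hcarr by blast
        with insert hI show ?case
          by (subst P.finsum_insert) (auto intro: J.a_closed)
      qed (simp add: P.finsum_empty)
      then show ?thesis
        using F(1) h(2) by blast
    qed
    moreover have "Idl\<^bsub>PS V\<^esub> F \<subseteq> I"
      using F(2) I P.genideal_minimal by blast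
    ultimately show "\<exists>A\<subseteq>carrier (PS V). finite A \<and> I = Idl\<^bsub>PS V\<^esub> A"
      using F(1) Fc by blast
  qed
qed

end


context field
begin

section \<open>Krull dimension\<close>

text \<open>Such a \<open>w\<close> lies in \<open>P + (a)\<close>. Expanding it in a standard basis
  with quotients of high order, and splitting each basis element into its parts in \<open>P\<close>
  and in \<open>(a)\<close>, gives \<open>w = z + y a\<close> with \<open>z\<close> in
  \<open>P\<close> and \<open>y\<close> of high order; then \<open>a\<close> cancels modulo the
  prime \<open>P\<close>. The loss \<open>c\<close> is uniform in \<open>k\<close>, as the counting
  below requires.\<close>

lemma artin_rees_colon:
  fixes V :: "'v::countable set"
  assumes V: "finite V" and P: "primeideal P (PS V)"
    and a: "a \<in> carrier (PS V)" "a \<notin> P"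
  shows "\<exists>c. \<forall>k x w. x \<in> carrier (PS V) \<longrightarrow> w \<in> carrier (PS V) \<longrightarrow> (a \<otimes>\<^bsub>PS V\<^esub> x) \<ominus>\<^bsub>PS V\<^esub> w \<in> P \<longrightarrow>
    (\<forall>M. wt M < 2 ^ k \<longrightarrow> w M = \<zero>) \<longrightarrow>
    (\<exists>y\<in>carrier (PS V). x \<ominus>\<^bsub>PS V\<^esub> y \<in> P \<and> (\<forall>M. wt M < 2 ^ (k - c) \<longrightarrow> y M = \<zero>))"
proof -
  interpret T: domain "PS V" by (rule PS_domain)
  interpret P: primeideal P "PS V" by fact
  define I where "I = P <+>\<^bsub>PS V\<^esub> PIdl\<^bsub>PS V\<^esub> a"
  have I: "ideal I (PS V)"
    unfolding I_def by (intro T.add_ideals P.is_ideal T.cgenideal_ideal a)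
  have I_mem: "f \<in> I \<longleftrightarrow> (\<exists>p\<in>P. \<exists>r\<in>carrier (PS V). f = p \<oplus>\<^bsub>PS V\<^esub> r \<otimes>\<^bsub>PS V\<^esub> a)" for f
    by (auto simp: I_def set_add_def' cgenideal_def)
  obtain F where F: "finite F" "F \<subseteq> I" "(\<lambda>_. \<zero>) \<notin> F"
    "\<forall>f\<in>I. f \<noteq> (\<lambda>_. \<zero>) \<longrightarrow> (\<exists>g\<in>F. lm g \<subseteq># lm f)"
    using standard_basis[OF V I] by blast
  have "\<exists>p r. p \<in> P \<and> r \<in> carrier (PS V) \<and> g = p \<oplus>\<^bsub>PS V\<^esub> r \<otimes>\<^bsub>PS V\<^esub> a" if "g \<in> F" for g
    using that F(2) I_mem by blast
  then obtain p r where pr: "\<And>g. g \<in> F \<Longrightarrow> p g \<in> P" "\<And>g. g \<in> F \<Longrightarrow> r g \<in> carrier (PS V)"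
    "\<And>g. g \<in> F \<Longrightarrow> g = p g \<oplus>\<^bsub>PS V\<^esub> r g \<otimes>\<^bsub>PS V\<^esub> a"
    by metis
  have "finite ((\<lambda>g. wt (lm g)) ` F)"
    using F(1) by simp
  then obtain c where "\<And>g. g \<in> F \<Longrightarrow> wt (lm g) \<le> c"
    unfolding finite_nat_set_iff_bounded_le by blast
  \<comment> \<open>The order of a quotient falls short of that of \<open>w\<close> by at most the
    weight of a leading monomial of \<open>F\<close>; in exponents of two this is the shift
    \<open>c\<close>.\<close>
  then have c: "wt (lm g) \<le> 2 ^ c" if "g \<in> F" for g
    using that less_exp[of c] by (meson le_trans less_imp_le)
  show ?thesis
  proof (intro exI[of _ c] allI impI)
    fix k x w
    assume x: "x \<in> carrier (PS V)" and w: "w \<in> carrier (PS V)"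
      and q: "(a \<otimes>\<^bsub>PS V\<^esub> x) \<ominus>\<^bsub>PS V\<^esub> w \<in> P" and w0: "\<forall>M. wt M < 2 ^ k \<longrightarrow> w M = \<zero>"
    define q where "q = (a \<otimes>\<^bsub>PS V\<^esub> x) \<ominus>\<^bsub>PS V\<^esub> w"
    have qP: "q \<in> P" "q \<in> carrier (PS V)" using q P.a_Hcarr by (auto simp: q_def)
    have "w = \<ominus>\<^bsub>PS V\<^esub> q \<oplus>\<^bsub>PS V\<^esub> x \<otimes>\<^bsub>PS V\<^esub> a"
      unfolding q_def using x w a by algebra
    then have "w \<in> I"
      using I_mem x qP(1) P.a_inv_closed by blast
    then obtain h where h: "\<And>g. g \<in> F \<Longrightarrow> h g \<in> carrier (PS V)"
      "w = (\<Oplus>\<^bsub>PS V\<^esub>g\<in>F. h g \<otimes>\<^bsub>PS V\<^esub> g)"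
      "\<And>g A. g \<in> F \<Longrightarrow> wt A * wt (lm g) < 2 ^ k \<Longrightarrow> h g A = \<zero>"
    proof -
      assume *: "\<And>h. \<lbrakk>\<And>g. g \<in> F \<Longrightarrow> h g \<in> carrier (PS V); w = (\<Oplus>\<^bsub>PS V\<^esub>g\<in>F. h g \<otimes>\<^bsub>PS V\<^esub> g);
        \<And>g A. g \<in> F \<Longrightarrow> wt A * wt (lm g) < 2 ^ k \<Longrightarrow> h g A = \<zero>\<rbrakk> \<Longrightarrow> thesis"
      obtain h where h: "\<forall>g\<in>F. h g \<in> carrier (PS V)" "w = (\<Oplus>\<^bsub>PS V\<^esub>g\<in>F. h g \<otimes>\<^bsub>PS V\<^esub> g)"
        "\<forall>n. (\<forall>M. wt M < n \<longrightarrow> w M = \<zero>) \<longrightarrow> (\<forall>g\<in>F. \<forall>A. wt A * wt (lm g) < n \<longrightarrow> h g A = \<zero>)"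
        using standard_basis_combination[OF I F \<open>w \<in> I\<close>] by blast
      show thesis
        by (rule *[of h]) (use h w0 in blast)+
    qed
    define y where "y = (\<Oplus>\<^bsub>PS V\<^esub>g\<in>F. h g \<otimes>\<^bsub>PS V\<^esub> r g)"
    define z where "z = (\<Oplus>\<^bsub>PS V\<^esub>g\<in>F. h g \<otimes>\<^bsub>PS V\<^esub> p g)"
    have y: "y \<in> carrier (PS V)"
      unfolding y_def using h(1) pr(2) by (intro T.finsum_closed) auto
    have pc: "p g \<in> carrier (PS V)" if "g \<in> F" for g
      using pr(1)[OF that] P.a_Hcarr by blast
    have zP: "z \<in> P"
    proof -
      have hp: "h g \<otimes>\<^bsub>PS V\<^esub> p g \<in> P" if "g \<in> F" for g
        using h(1)[OF that] pr(1)[OF that] P.I_l_closed by blast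
      have "G \<subseteq> F \<Longrightarrow> (\<Oplus>\<^bsub>PS V\<^esub>g\<in>G. h g \<otimes>\<^bsub>PS V\<^esub> p g) \<in> P" if "finite G" for G
        using that
      proof (induction G rule: finite_induct)
        case (insert x G)
        then have "(\<lambda>g. h g \<otimes>\<^bsub>PS V\<^esub> p g) \<in> insert x G \<rightarrow> carrier (PS V)"
          using hp P.a_Hcarr by blast
        with insert hp show ?case
          by (subst T.finsum_insert) (auto intro: P.a_closed)
      qed simp
      then show ?thesis
        unfolding z_def using F(1) by blast
    qed
    have z: "z \<in> carrier (PS V)" using zP P.a_Hcarr by blast
    have "w = (\<Oplus>\<^bsub>PS V\<^esub>g\<in>F. h g \<otimes>\<^bsub>PS V\<^esub> p g \<oplus>\<^bsub>PS V\<^esub> (h g \<otimes>\<^bsub>PS V\<^esub> r g) \<otimes>\<^bsub>PS V\<^esub> a)"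
      unfolding h(2)
    proof (rule T.finsum_cong'[OF refl])
      fix g assume g: "g \<in> F"
      have "h g \<otimes>\<^bsub>PS V\<^esub> (p g \<oplus>\<^bsub>PS V\<^esub> r g \<otimes>\<^bsub>PS V\<^esub> a) = h g \<otimes>\<^bsub>PS V\<^esub> p g \<oplus>\<^bsub>PS V\<^esub> (h g \<otimes>\<^bsub>PS V\<^esub> r g) \<otimes>\<^bsub>PS V\<^esub> a"
        using h(1)[OF g] pc[OF g] pr(2)[OF g] a by algebra
      then show "h g \<otimes>\<^bsub>PS V\<^esub> g = h g \<otimes>\<^bsub>PS V\<^esub> p g \<oplus>\<^bsub>PS V\<^esub> (h g \<otimes>\<^bsub>PS V\<^esub> r g) \<otimes>\<^bsub>PS V\<^esub> a"
        using pr(3)[OF g] by simp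
    qed (use h(1) pc pr(2) a in auto)
    also have "\<dots> = z \<oplus>\<^bsub>PS V\<^esub> (\<Oplus>\<^bsub>PS V\<^esub>g\<in>F. (h g \<otimes>\<^bsub>PS V\<^esub> r g) \<otimes>\<^bsub>PS V\<^esub> a)"
      unfolding z_def using h(1) pc pr(2) a by (intro T.finsum_addf) auto
    also have "(\<Oplus>\<^bsub>PS V\<^esub>g\<in>F. (h g \<otimes>\<^bsub>PS V\<^esub> r g) \<otimes>\<^bsub>PS V\<^esub> a) = y \<otimes>\<^bsub>PS V\<^esub> a"
      unfolding y_def using F(1) h(1) pr(2) a by (intro T.finsum_ldistr[symmetric]) auto
    finally have w_eq: "w = z \<oplus>\<^bsub>PS V\<^esub> y \<otimes>\<^bsub>PS V\<^esub> a" .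
    have "a \<otimes>\<^bsub>PS V\<^esub> x = q \<oplus>\<^bsub>PS V\<^esub> w"
      unfolding q_def using a(1) x w by algebra
    then have "a \<otimes>\<^bsub>PS V\<^esub> (x \<ominus>\<^bsub>PS V\<^esub> y) = (q \<oplus>\<^bsub>PS V\<^esub> (z \<oplus>\<^bsub>PS V\<^esub> y \<otimes>\<^bsub>PS V\<^esub> a)) \<ominus>\<^bsub>PS V\<^esub> a \<otimes>\<^bsub>PS V\<^esub> y"
      unfolding w_eq[symmetric] using a(1) x y by (metis T.minus_eq T.r_distr T.r_minus T.a_inv_closed)
    also have "\<dots> = q \<oplus>\<^bsub>PS V\<^esub> z"
      using qP(2) z y a(1) by algebra
    finally have "a \<otimes>\<^bsub>PS V\<^esub> (x \<ominus>\<^bsub>PS V\<^esub> y) \<in> P"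
      using qP(1) zP P.a_closed by simp
    then have xy: "x \<ominus>\<^bsub>PS V\<^esub> y \<in> P"
      using P.I_prime[of a "x \<ominus>\<^bsub>PS V\<^esub> y"] a x y by auto
    have "y M = \<zero>" if M: "wt M < 2 ^ (k - c)" for M
    proof -
      have h0: "h g A = \<zero>" if g: "g \<in> F" and A: "wt A < 2 ^ (k - c)" for g A
      proof (cases "c \<le> k")
        case True
        have "wt A * wt (lm g) < 2 ^ (k - c) * 2 ^ c"
          using mult_less_le_imp_less[OF A c[OF g]] by simp
        then show ?thesis
          using h(3)[OF g, of A] True by (simp add: power_add[symmetric])
      \<comment> \<open>For \<open>k < c\<close> the truncated exponent is zero, and no monomial has
        weight below one.\<close>
      qed (use A in auto)
      have "y M = (\<Oplus>g\<in>F. (h g \<star> r g) M)"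
        unfolding y_def using h(1) pr(2) by (subst PS_finsum_coeff) (auto simp: PS_ops)
      also have "\<dots> = \<zero>"
      proof (rule add.finprod_one_eqI)
        fix g assume g: "g \<in> F"
        show "(h g \<star> r g) M = \<zero>"
          by (rule conv_vanish[where m = "2 ^ (k - c)" and n = 1])
            (use M h0[OF g] PS_coeff[OF h(1)[OF g]] PS_coeff[OF pr(2)[OF g]] in auto)
      qed
      finally show ?thesis .
    qed
    then show "\<exists>y\<in>carrier (PS V). x \<ominus>\<^bsub>PS V\<^esub> y \<in> P \<and> (\<forall>M. wt M < 2 ^ (k - c) \<longrightarrow> y M = \<zero>)"
      using xy y by blast
  qed
qed

section \<open>Growth of the number of standard monomials\<close>

definition inits :: "('v::countable multiset \<Rightarrow> 'a) set \<Rightarrow> 'v multiset set"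
  where "inits I = {M. \<exists>f\<in>I. lead f M}"

text \<open>For an ideal \<open>I\<close> their number is the dimension of the quotient of
  \<open>PS V\<close> by \<open>I\<close> and all series starting at weight \<open>2 ^ k\<close> or
  later: a Hilbert-Samuel function for the weight filtration.\<close>

definition standards :: "'v::countable set \<Rightarrow> ('v multiset \<Rightarrow> 'a) set \<Rightarrow> nat \<Rightarrow> 'v multiset set"
  where "standards V I k = {M. set_mset M \<subseteq> V \<and> wt M < 2 ^ k \<and> M \<notin> inits I}"

lemma finite_standards [simp]: "finite (standards V I k)"
  by (rule finite_subset[OF _ finite_wt_le[of "2 ^ k"]]) (auto simp: standards_def)

lemma standards_mono: "k \<le> l \<Longrightarrow> standards V I k \<subseteq> standards V I l"
  by (auto simp: standards_def intro: less_le_trans[OF _ power_increasing])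

text \<open>By \<open>two_power_size_le_wt\<close> every exponent of such a monomial is below
  \<open>k\<close>.\<close>

lemma card_standards_le:
  assumes "finite V"
  shows "card (standards V I k) \<le> k ^ card V"
proof -
  have "card (standards V I k) \<le> card (PiE V (\<lambda>_. {..<k}))"
  proof (rule card_inj_on_le[where f = "\<lambda>M. restrict (count M) V"])
    show "inj_on (\<lambda>M. restrict (count M) V) (standards V I k)"
    proof (rule inj_onI)
      fix M N assume MN: "M \<in> standards V I k" "N \<in> standards V I k" "restrict (count M) V = restrict (count N) V"
      have "count M v = count N v" for v
      proof (cases "v \<in> V")
        case True
        then show ?thesis using MN(3) by (metis restrict_apply')
      next
        case False
        then have "v \<notin># M" "v \<notin># N" using MN by (auto simp: standards_def)
        then show ?thesis by (simp add: not_in_iff)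
      qed
      then show "M = N" by (rule multiset_eqI)
    qed
    have "count M v < k" if "M \<in> standards V I k" for M v
    proof -
      have "(2::nat) ^ size M < 2 ^ k"
        using that two_power_size_le_wt[of M] by (metis (no_types, lifting) le_less_trans mem_Collect_eq standards_def)
      then show ?thesis
        using count_le_size[of M v] by simp
    qed
    then show "(\<lambda>M. restrict (count M) V) ` standards V I k \<subseteq> PiE V (\<lambda>_. {..<k})"
      by auto
  qed (use assms in \<open>auto intro: finite_PiE\<close>)
  also have "\<dots> = k ^ card V"
    using assms by (simp add: card_PiE)
  finally show ?thesis .
qed


lemma const_mult_closed:
  assumes "c \<in> carrier R" "f \<in> carrier (PS V)"
  shows "(\<lambda>M. c \<otimes> f M) \<in> carrier (PS V)"
  using assms by (auto simp: PS_mem)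

lemma ideal_const_mult:
  assumes I: "ideal I (PS V)" and c: "c \<in> carrier R" and f: "f \<in> I"
  shows "(\<lambda>M. c \<otimes> f M) \<in> I"
proof -
  interpret I: ideal I "PS V" by fact
  have "indexed_const c \<in> carrier (PS V)"
    using c by (auto simp: PS_mem indexed_const_def)
  then have "indexed_const c \<otimes>\<^bsub>PS V\<^esub> f \<in> I"
    using f by (rule I.I_l_closed[rotated])
  then show ?thesis
    using conv_const[OF c, of f] PS_coeff[OF I.a_Hcarr[OF f]] by (simp add: PS_ops)
qed

lemma conv_const_mult:
  assumes c: "c \<in> carrier R" and f: "\<And>M. f M \<in> carrier R" and g: "\<And>M. g M \<in> carrier R"
  shows "f \<star> (\<lambda>M. c \<otimes> g M) = (\<lambda>M. c \<otimes> (f \<star> g) M)"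
  unfolding conv_def
  by (subst finsum_rdistr) (auto simp: fun_eq_iff c f g m_lcomm intro!: finsum_cong')

text \<open>
  Multiplication by \<open>a\<close> is injective modulo \<open>P\<close> up to a shift \<open>c\<close> of the filtration. It maps the span
  \<open>U\<close> of the standard monomials of \<open>P\<close> into \<open>Q / P\<close>, where only the monomials in \<open>L\<close> can be leading.
  \<open>G j\<close> consists of those elements whose image vanishes modulo \<open>P\<close> below weight \<open>j\<close>; each step
  loses at most one leading monomial, and only if \<open>j\<close> is the weight of an element of \<open>L\<close>.
\<close>

theorem card_standards_drop:
  fixes V :: "'v::countable set"
  assumes V: "finite V" and P: "primeideal P (PS V)" and Q: "ideal Q (PS V)"
    and PQ: "P \<subseteq> Q" and a: "a \<in> Q" "a \<notin> P"
  shows "\<exists>c. \<forall>k. card (standards V Q k) + card (standards V P (k - c)) \<le> card (standards V P k)"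
proof -
  interpret T: domain "PS V" by (rule PS_domain)
  interpret P: primeideal P "PS V" by fact
  interpret Q: ideal Q "PS V" by fact
  have ac: "a \<in> carrier (PS V)" using a(1) Q.a_Hcarr by blast
  obtain c where *: "\<forall>k x w. x \<in> carrier (PS V) \<longrightarrow> w \<in> carrier (PS V) \<longrightarrow> (a \<otimes>\<^bsub>PS V\<^esub> x) \<ominus>\<^bsub>PS V\<^esub> w \<in> P \<longrightarrow>
    (\<forall>M. wt M < 2 ^ k \<longrightarrow> w M = \<zero>) \<longrightarrow>
    (\<exists>y\<in>carrier (PS V). x \<ominus>\<^bsub>PS V\<^esub> y \<in> P \<and> (\<forall>M. wt M < 2 ^ (k - c) \<longrightarrow> y M = \<zero>))"
    using artin_rees_colon[OF V P ac a(2)] ..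
  have c: "\<exists>y\<in>carrier (PS V). x \<ominus>\<^bsub>PS V\<^esub> y \<in> P \<and> (\<forall>M. wt M < 2 ^ (k - c) \<longrightarrow> y M = \<zero>)"
    if "x \<in> carrier (PS V)" "w \<in> carrier (PS V)" "(a \<otimes>\<^bsub>PS V\<^esub> x) \<ominus>\<^bsub>PS V\<^esub> w \<in> P"
      "\<forall>M. wt M < 2 ^ k \<longrightarrow> w M = \<zero>" for k x w
    using * that by blast
  have "card (standards V Q k) + card (standards V P (k - c)) \<le> card (standards V P k)" for k
  proof -
    define S where "S = standards V P (k - c)"
    define L where "L = standards V P k - standards V Q k"
    define U where "U = {f. (\<forall>M. f M \<in> carrier R) \<and> (\<forall>M. M \<notin> S \<longrightarrow> f M = \<zero>)}"
    define G where "G = (\<lambda>j. {f \<in> U. \<exists>p\<in>P. \<forall>N. wt N < j \<longrightarrow> (a \<star> f) N = p N})"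
    have Uc: "f \<in> carrier (PS V)" if "f \<in> U" for f
      using that by (auto simp: U_def PS_mem S_def standards_def)
    have G0: "S \<subseteq> inits (G 0)"
    proof
      fix M assume M: "M \<in> S"
      define f where "f = (\<lambda>N. if N = M then \<one> else \<zero>)"
      obtain p where "p \<in> P"
        using additive_subgroup.zero_closed[OF P.is_additive_subgroup] by blast
      then have "f \<in> G 0"
        using M by (auto simp: G_def U_def f_def)
      moreover have "lead f M"
        by (auto simp: lead_def f_def)
      ultimately show "M \<in> inits (G 0)"
        by (auto simp: inits_def)
    qed
    \<comment> \<open>Here Artin-Rees enters: an \<open>f\<close> in this last stage is congruent
      modulo \<open>P\<close> to a series starting at weight \<open>2 ^ (k - c)\<close>, beyond the
      leading monomial of \<open>f\<close>. The difference would be an element of \<open>P\<close>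
      led by a standard monomial of \<open>P\<close>.\<close>
    have Gend: "inits (G (2 ^ k)) = {}"
    proof (rule ccontr)
      assume "inits (G (2 ^ k)) \<noteq> {}"
      then obtain f M where f: "f \<in> G (2 ^ k)" "lead f M"
        by (auto simp: inits_def)
      obtain p where p: "p \<in> P" "\<And>N. wt N < 2 ^ k \<Longrightarrow> (a \<star> f) N = p N"
        using f(1) by (auto simp: G_def)
      have fc: "f \<in> carrier (PS V)" using f(1) Uc by (auto simp: G_def)
      have pc: "p \<in> carrier (PS V)" using p(1) P.a_Hcarr by blast
      define w where "w = (a \<otimes>\<^bsub>PS V\<^esub> f) \<ominus>\<^bsub>PS V\<^esub> p"
      have w: "w \<in> carrier (PS V)" unfolding w_def using fc pc ac by simp
      have "(a \<otimes>\<^bsub>PS V\<^esub> f) \<ominus>\<^bsub>PS V\<^esub> w = p"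
        unfolding w_def using fc pc ac by algebra
      moreover have "w M = \<zero>" if "wt M < 2 ^ k" for M
        unfolding w_def using p(2)[OF that] fc pc ac PS_coeff[OF pc]
        by (subst PS_minus_coeff) (simp_all add: PS_ops minus_eq r_neg)
      ultimately obtain y where y: "y \<in> carrier (PS V)" "f \<ominus>\<^bsub>PS V\<^esub> y \<in> P" "\<And>M. wt M < 2 ^ (k - c) \<Longrightarrow> y M = \<zero>"
        using c[OF fc w, of k] p(1) by auto
      have MS: "M \<in> S"
        using f by (auto simp: G_def U_def lead_def)
      have "(f \<ominus>\<^bsub>PS V\<^esub> y) N = f N" if "wt N \<le> wt M" for N
        using y(3)[of N] that MS PS_coeff[OF fc] y(1) fc
        by (subst PS_minus_coeff) (auto simp: S_def standards_def minus_eq)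
      then have "lead (f \<ominus>\<^bsub>PS V\<^esub> y) M"
        using f(2) by (auto simp: lead_def)
      then show False
        using y(2) MS by (auto simp: S_def standards_def inits_def)
    qed
    \<comment> \<open>What is lost between two stages is detected by the monomial \<open>M\<close>
      of weight \<open>j\<close>, at which the image of \<open>f\<close> modulo \<open>P\<close>
      starts: it is leading in \<open>Q\<close> but not in \<open>P\<close>.\<close>
    have step: "\<exists>M p. wt M = j \<and> M \<in> L \<and> p \<in> P \<and> (\<forall>N. wt N < j \<longrightarrow> (a \<star> f) N = p N) \<and> (a \<star> f) M \<ominus> p M \<noteq> \<zero>"
      if f: "f \<in> G j" "f \<notin> G (Suc j)" and j: "j < 2 ^ k" for f j
    proof -
      obtain p where p: "p \<in> P" "\<And>N. wt N < j \<Longrightarrow> (a \<star> f) N = p N" and fU: "f \<in> U"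
        using f(1) by (auto simp: G_def)
      have pc: "p \<in> carrier (PS V)" using p(1) P.a_Hcarr by blast
      have fc: "f \<in> carrier (PS V)" using fU Uc by blast
      obtain M where M: "wt M = j" "(a \<star> f) M \<noteq> p M"
        using f(2) p fU by (auto simp: G_def less_Suc_eq)
      define D where "D = (a \<otimes>\<^bsub>PS V\<^esub> f) \<ominus>\<^bsub>PS V\<^esub> p"
      have D_coeff: "D N = (a \<star> f) N \<ominus> p N" for N
        unfolding D_def using fc pc ac by (subst PS_minus_coeff) (auto simp: PS_ops)
      have afc: "(a \<star> f) N \<in> carrier R" for N
        using PS_coeff[OF PS_conv_closed[OF ac fc]] .
      have DM: "D M \<noteq> \<zero>"
        using M(2) afc[of M] PS_coeff[OF pc, of M] by (simp add: D_coeff)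
      have D0: "D N = \<zero>" if "wt N < j" for N
        using p(2)[OF that] PS_coeff[OF pc, of N] by (simp add: D_coeff minus_eq r_neg)
      have "D \<in> Q"
        unfolding D_def a_minus_def using a(1) fc p(1) PQ
        by (intro Q.a_closed Q.a_inv_closed Q.I_r_closed) auto
      have leadD: "lead D M"
        using DM D0 M(1) by (auto simp: lead_def)
      then have "M \<in> inits Q"
        using \<open>D \<in> Q\<close> by (auto simp: inits_def)
      have "set_mset M \<subseteq> V"
        using Q.a_Hcarr[OF \<open>D \<in> Q\<close>] DM by (auto simp: PS_mem)
      \<comment> \<open>Otherwise a scalar multiple of an element of \<open>P\<close> led by
        \<open>M\<close> corrects \<open>p\<close> at \<open>M\<close>, and \<open>f\<close>
        survives to the next stage.\<close>
      have "M \<notin> inits P"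
      proof
        assume "M \<in> inits P"
        then obtain q where q: "q \<in> P" "lead q M"
          by (auto simp: inits_def)
        have qc: "q \<in> carrier (PS V)" using q(1) P.a_Hcarr by blast
        define d where "d = D M \<otimes> inv (q M)"
        have qM: "q M \<in> Units R"
          using q(2) PS_coeff[OF qc] field_Units by (auto simp: lead_def)
        have DMc: "D M \<in> carrier R"
          using D_coeff afc PS_coeff[OF pc] by simp
        have d: "d \<in> carrier R"
          unfolding d_def using DMc qM by simp
        define q' where "q' = (\<lambda>N. d \<otimes> q N)"
        have q': "q' \<in> P" "q' \<in> carrier (PS V)"
          unfolding q'_def using ideal_const_mult[OF P.is_ideal d q(1)] P.a_Hcarr by auto
        have "q' M = D M"
          unfolding q'_def d_def using qM DMc Units_closed[OF qM] by (simp add: m_assoc)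
        have "p \<oplus>\<^bsub>PS V\<^esub> q' \<in> P"
          using p(1) q'(1) P.a_closed by blast
        moreover have "(a \<star> f) N = (p \<oplus>\<^bsub>PS V\<^esub> q') N" if N: "wt N < Suc j" for N
        proof (cases "wt N < j")
          case True
          then have "q' N = \<zero>"
            using q(2) M(1) d by (auto simp: q'_def lead_def)
          then show ?thesis
            using p(2)[OF True] PS_coeff[OF pc] by (simp add: PS_ops)
        next
          case False
          then have N': "N = M"
            using N M(1) by (metis less_antisym wt_inj)
          have "p M \<oplus> ((a \<star> f) M \<ominus> p M) = (a \<star> f) M"
            using afc[of M] PS_coeff[OF pc, of M] by algebra
          then show ?thesis
            using N' \<open>q' M = D M\<close> D_coeff[of M] by (simp add: PS_ops)
        qed
        ultimately have "f \<in> G (Suc j)"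
          using fU by (auto simp: G_def)
        then show False using f(2) by blast
      qed
      then have "M \<in> L"
        using \<open>set_mset M \<subseteq> V\<close> \<open>M \<in> inits Q\<close> M(1) j by (auto simp: L_def standards_def)
      then show ?thesis
        using M(1) p DM D_coeff by auto
    qed
    \<comment> \<open>Two elements lost at the same stage have their obstruction at the same
      monomial \<open>M\<close>. The combination \<open>mix\<close> cancels it and keeps the lighter
      leading monomial \<open>\<mu>\<close>, so \<open>\<mu>\<close> is not lost after all.\<close>
    have unique: False
      if f: "f \<in> G j" "lead f \<mu>" and g: "g \<in> G j" "lead g \<nu>" and less: "wt \<mu> < wt \<nu>"
        and n: "\<mu> \<notin> inits (G (Suc j))" "\<nu> \<notin> inits (G (Suc j))" and j: "j < 2 ^ k" for f g j \<mu> \<nu>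
    proof -
      have fn: "f \<notin> G (Suc j)" and gn: "g \<notin> G (Suc j)"
        using f(2) g(2) n by (auto simp: inits_def)
      obtain M p where p: "wt M = j" "p \<in> P" "\<And>N. wt N < j \<Longrightarrow> (a \<star> f) N = p N" "(a \<star> f) M \<ominus> p M \<noteq> \<zero>"
        using step[OF f(1) fn j] by blast
      obtain M' q where q: "wt M' = j" "q \<in> P" "\<And>N. wt N < j \<Longrightarrow> (a \<star> g) N = q N" "(a \<star> g) M' \<ominus> q M' \<noteq> \<zero>"
        using step[OF g(1) gn j] by blast
      have M': "M' = M" using p(1) q(1) by (simp add: wt_inj[symmetric])
      have fU: "f \<in> U" and gU: "g \<in> U" using f g by (auto simp: G_def)
      note fc = Uc[OF fU] and gc = Uc[OF gU]
      have pc: "p \<in> carrier (PS V)" and qc: "q \<in> carrier (PS V)"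
        using p q P.a_Hcarr by auto
      note cl [simp] = PS_coeff[OF fc] PS_coeff[OF gc] PS_coeff[OF pc] PS_coeff[OF qc]
        PS_coeff[OF PS_conv_closed[OF ac fc]] PS_coeff[OF PS_conv_closed[OF ac gc]] PS_coeff[OF ac]
      define \<alpha> where "\<alpha> = (a \<star> f) M \<ominus> p M"
      define \<beta> where "\<beta> = (a \<star> g) M \<ominus> q M"
      have ab: "\<alpha> \<in> carrier R" "\<beta> \<in> carrier R" "\<beta> \<noteq> \<zero>"
        using q(4) by (auto simp: \<alpha>_def \<beta>_def M')
      define mix where "mix = (\<lambda>(u :: 'v multiset \<Rightarrow> 'a) v N. \<beta> \<otimes> u N \<oplus> (\<ominus> \<alpha>) \<otimes> v N)"
      have mix_sum: "mix u v = (\<lambda>N. \<beta> \<otimes> u N) \<oplus>\<^bsub>PS V\<^esub> (\<lambda>N. (\<ominus> \<alpha>) \<otimes> v N)" for u v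
        by (simp add: mix_def PS_ops)
      have "mix f g \<in> U"
        using fU gU ab by (auto simp: U_def mix_def)
      moreover have mixP: "mix p q \<in> P"
        unfolding mix_sum using ideal_const_mult[OF P.is_ideal] ab p(2) q(2) by (intro P.a_closed) auto
      have conv_mix: "a \<star> mix f g = mix (a \<star> f) (a \<star> g)"
      proof -
        have "a \<star> mix f g = a \<otimes>\<^bsub>PS V\<^esub> ((\<lambda>N. \<beta> \<otimes> f N) \<oplus>\<^bsub>PS V\<^esub> (\<lambda>N. (\<ominus> \<alpha>) \<otimes> g N))"
          unfolding mix_sum by (simp only: PS_ops)
        also have "\<dots> = a \<otimes>\<^bsub>PS V\<^esub> (\<lambda>N. \<beta> \<otimes> f N) \<oplus>\<^bsub>PS V\<^esub> a \<otimes>\<^bsub>PS V\<^esub> (\<lambda>N. (\<ominus> \<alpha>) \<otimes> g N)"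
          by (intro T.r_distr ac const_mult_closed fc gc ab a_inv_closed)
        also have "\<dots> = (\<lambda>N. \<beta> \<otimes> (a \<star> f) N) \<oplus>\<^bsub>PS V\<^esub> (\<lambda>N. (\<ominus> \<alpha>) \<otimes> (a \<star> g) N)"
          using conv_const_mult[of \<beta> a f] conv_const_mult[of "\<ominus> \<alpha>" a g] ab by (simp add: PS_ops)
        finally show ?thesis unfolding mix_sum .
      qed
      have "(a \<star> mix f g) N = mix p q N" if N: "wt N < Suc j" for N
      proof (cases "wt N < j")
        case True
        then show ?thesis
          using p(3) q(3) by (simp add: conv_mix) (simp add: mix_def)
      next
        case False
        then have N: "N = M"
          using N p(1) by (metis less_antisym wt_inj)
        have "mix (a \<star> f) (a \<star> g) M = mix p q M \<oplus> (\<beta> \<otimes> \<alpha> \<ominus> \<alpha> \<otimes> \<beta>)"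
          unfolding mix_def \<alpha>_def \<beta>_def using cl by algebra
        also have "\<beta> \<otimes> \<alpha> \<ominus> \<alpha> \<otimes> \<beta> = \<zero>"
          using ab(1,2) by algebra
        finally show ?thesis
          unfolding N conv_mix using ab by (simp add: mix_def)
      qed
      ultimately have "mix f g \<in> G (Suc j)"
        using mixP by (auto simp: G_def)
      moreover have "lead (mix f g) \<mu>"
      proof -
        have "mix f g N = \<zero>" if "wt N < wt \<mu>" for N
          using f(2) g(2) that less ab by (simp add: lead_def mix_def)
        moreover have "mix f g \<mu> = \<beta> \<otimes> f \<mu>"
          using g(2) less ab by (simp add: lead_def mix_def)
        ultimately show ?thesis
          using f(2) ab integral[of \<beta> "f \<mu>"] by (auto simp: lead_def)
      qed
      ultimately show False
        using n(1) by (auto simp: inits_def)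
    qed
    \<comment> \<open>\<open>J \<mu>\<close> is the stage after which \<open>\<mu>\<close> first
      stops being a leading monomial; it is also the weight of the monomial of \<open>L\<close>
      charged for \<open>\<mu>\<close>.\<close>
    define J where "J = (\<lambda>\<mu>. LEAST j. \<mu> \<notin> inits (G (Suc j)))"
    have J: "J \<mu> < 2 ^ k" "\<mu> \<in> inits (G (J \<mu>))" "\<mu> \<notin> inits (G (Suc (J \<mu>)))" if "\<mu> \<in> S" for \<mu>
    proof -
      have ex: "\<mu> \<notin> inits (G (Suc (2 ^ k - 1)))"
        using Gend by simp
      show "J \<mu> < 2 ^ k"
        using Least_le[of "\<lambda>j. \<mu> \<notin> inits (G (Suc j))", OF ex] unfolding J_def
        by (simp add: le_less_trans)
      show "\<mu> \<notin> inits (G (Suc (J \<mu>)))"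
        unfolding J_def by (rule LeastI[of "\<lambda>j. \<mu> \<notin> inits (G (Suc j))", OF ex])
      show "\<mu> \<in> inits (G (J \<mu>))"
      proof (cases "J \<mu>")
        case 0
        then show ?thesis using G0 that by auto
      next
        case (Suc i)
        then have "\<not> \<mu> \<notin> inits (G (Suc i))"
          unfolding J_def by (intro not_less_Least) simp
        then show ?thesis using Suc by simp
      qed
    qed
    have "\<exists>M. M \<in> L \<and> wt M = J \<mu>" if \<mu>: "\<mu> \<in> S" for \<mu>
    proof -
      obtain f where "f \<in> G (J \<mu>)" "lead f \<mu>"
        using J(2)[OF \<mu>] by (auto simp: inits_def)
      moreover then have "f \<notin> G (Suc (J \<mu>))"
        using J(3)[OF \<mu>] by (auto simp: inits_def)
      ultimately show ?thesis
        using step[OF _ _ J(1)[OF \<mu>]] by blast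
    qed
    then obtain \<Phi> where \<Phi>: "\<And>\<mu>. \<mu> \<in> S \<Longrightarrow> \<Phi> \<mu> \<in> L" "\<And>\<mu>. \<mu> \<in> S \<Longrightarrow> wt (\<Phi> \<mu>) = J \<mu>"
      by metis
    have "inj_on \<Phi> S"
    proof (rule inj_onI, rule ccontr)
      fix \<mu> \<nu> assume \<mu>\<nu>: "\<mu> \<in> S" "\<nu> \<in> S" "\<Phi> \<mu> = \<Phi> \<nu>" "\<mu> \<noteq> \<nu>"
      then have Jeq: "J \<mu> = J \<nu>"
        using \<Phi>(2) by metis
      obtain f where f: "f \<in> G (J \<mu>)" "lead f \<mu>"
        using J(2)[OF \<mu>\<nu>(1)] by (auto simp: inits_def)
      obtain g where g: "g \<in> G (J \<mu>)" "lead g \<nu>"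
        using J(2)[OF \<mu>\<nu>(2)] Jeq by (auto simp: inits_def)
      have "wt \<mu> < wt \<nu> \<or> wt \<nu> < wt \<mu>"
        using \<mu>\<nu>(4) by (metis linorder_neqE_nat wt_inj)
      then show False
        using unique[OF f g] unique[OF g f] J(1,3)[OF \<mu>\<nu>(1)] J(3)[OF \<mu>\<nu>(2)] Jeq by auto
    qed
    then have "card S \<le> card L"
      by (rule card_inj_on_le) (use \<Phi>(1) in \<open>auto simp: L_def\<close>)
    moreover have sub: "standards V Q k \<subseteq> standards V P k"
      using PQ by (auto simp: standards_def inits_def)
    then have "card L = card (standards V P k) - card (standards V Q k)"
      unfolding L_def by (intro card_Diff_subset) auto
    moreover have "card (standards V Q k) \<le> card (standards V P k)"
      using sub by (intro card_mono) auto
    ultimately show ?thesis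
      unfolding S_def by linarith
  qed
  then show ?thesis by blast
qed

end


lemma binomial_bounded_by_power:
  assumes C: "C \<ge> 1" and le: "\<And>k. k choose d \<le> (C * (k + 1)) ^ n"
  shows "d \<le> (n::nat)"
proof (rule ccontr)
  assume "\<not> d \<le> n"
  then have d: "n + 1 \<le> d" by simp
  \<comment> \<open>At \<open>k = d * m\<close> the binomial coefficient is at least
    \<open>m ^ d\<close>, while the bound is at most \<open>(2 * C * d * m) ^ n = B * m ^ n\<close>.
    With \<open>d > n\<close> any \<open>m\<close> above \<open>B\<close> contradicts this.\<close>
  define B where "B = (2 * C * d) ^ n"
  define m where "m = B + 1"
  have m: "m \<ge> 1" by (simp add: m_def)
  have "real m ^ d = (real (d * m) / real d) ^ d"
    using d by simp
  also have "\<dots> \<le> real ((d * m) choose d)"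
    using m by (intro binomial_ge_n_over_k_pow_k) simp
  also have "\<dots> \<le> real ((C * (d * m + 1)) ^ n)"
    using le[of "d * m"] by (simp only: of_nat_le_iff)
  also have "(C * (d * m + 1)) ^ n \<le> (2 * C * d * m) ^ n"
  proof (rule power_mono)
    have "1 \<le> d * m" using d m by simp
    then have "C * (d * m + 1) \<le> C * (d * m + d * m)"
      by (intro mult_le_mono) simp_all
    then show "C * (d * m + 1) \<le> 2 * C * d * m"
      by (simp add: algebra_simps)
  qed simp
  then have "real ((C * (d * m + 1)) ^ n) \<le> real ((2 * C * d * m) ^ n)"
    by (simp only: of_nat_le_iff)
  finally have "m ^ d \<le> B * m ^ n"
    by (simp only: of_nat_le_iff of_nat_power[symmetric] power_mult_distrib B_def)
  moreover have "m ^ (n + 1) \<le> m ^ d"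
    using m d by (intro power_increasing)
  ultimately have "m ^ (n + 1) \<le> B * m ^ n" by (meson order_trans)
  then have "m * m ^ n \<le> B * m ^ n" by (simp only: Suc_eq_plus1[symmetric] power_Suc)
  moreover have "0 < m ^ n" using m by simp
  ultimately have "m \<le> B" using mult_le_cancel2 by blast
  then show False by (simp add: m_def)
qed

context field
begin

text \<open>Going down from the top of the chain, each drop acts as a discrete summation: if the
  counts for \<open>Q\<close> grow at least like \<open>k choose i\<close>, iterating
  \<open>card_standards_drop\<close> makes those for the next smaller prime grow like
  \<open>k choose Suc i\<close>, by Pascal's rule. The polynomial upper bound of degree
  \<open>card V\<close> then limits the length.\<close>

theorem PS_prime_chain_length:
  fixes V :: "'v::countable set"
  assumes V: "finite V" and c: "prime_chain (PS V) c d"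
  shows "d \<le> card V"
proof -
  have prime: "primeideal (c i) (PS V)" if "i \<le> d" for i
    using c that by (simp add: prime_chain_def)
  have sub: "c i \<subset> c (Suc i)" if "i < d" for i
    using c that by (simp add: prime_chain_def)
  have claim: "i \<le> d \<Longrightarrow> \<exists>C\<ge>1. \<forall>k. (k choose i) \<le> card (standards V (c (d - i)) (C * (k + 1)))" for i
  proof (induction i)
    case 0
    interpret P: primeideal "c d" "PS V" using prime by simp
    \<comment> \<open>A proper ideal contains no unit, so the empty monomial is standard. The
      argument \<open>k + 1\<close> keeps its weight below the cutoff also at
      \<open>k = 0\<close>.\<close>
    have "{#} \<notin> inits (c d)"
    proof
      assume "{#} \<in> inits (c d)"
      then obtain f where f: "f \<in> c d" "f {#} \<noteq> \<zero>"
        by (auto simp: inits_def lead_def)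
      have fc: "f \<in> carrier (PS V)" using f(1) P.a_Hcarr by blast
      then have "f \<in> Units (PS V)"
        using f(2) by (rule PS_unit)
      then obtain g where "g \<in> carrier (PS V)" "g \<otimes>\<^bsub>PS V\<^esub> f = \<one>\<^bsub>PS V\<^esub>"
        by (auto simp: Units_def)
      then have "\<one>\<^bsub>PS V\<^esub> \<in> c d"
        using P.I_l_closed[OF f(1)] by metis
      then show False
        using P.one_imp_carrier P.I_notcarr by blast
    qed
    moreover have "Suc 0 < 2 * 2 ^ k" for k :: nat
      using one_le_power[of "2::nat" k] by linarith
    ultimately have "{#} \<in> standards V (c d) (1 * (k + 1))" for k
      by (simp add: standards_def)
    then have "0 < card (standards V (c d) (1 * (k + 1)))" for k
      by (auto simp: card_gt_0_iff)
    then have "card (standards V (c d) (1 * (k + 1))) \<ge> 1" for k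
      by (simp add: Suc_le_eq)
    then show ?case by auto
  next
    case (Suc i)
    define P where "P = c (d - Suc i)"
    define Q where "Q = c (d - i)"
    have i: "d - i = Suc (d - Suc i)" using Suc.prems by simp
    have P: "primeideal P (PS V)" and Q: "primeideal Q (PS V)"
      using prime by (simp_all add: P_def Q_def)
    have PQ: "P \<subset> Q"
      using sub[of "d - Suc i"] Suc.prems unfolding P_def Q_def i by simp
    then obtain a where a: "a \<in> Q" "a \<notin> P" by blast
    obtain e where e: "\<And>k. card (standards V Q k) + card (standards V P (k - e)) \<le> card (standards V P k)"
      using card_standards_drop[OF V P primeideal.axioms(1)[OF Q] _ a] PQ by blast
    obtain C where C: "C \<ge> 1" "\<And>k. (k choose i) \<le> card (standards V Q (C * (k + 1)))"
      using Suc unfolding Q_def by auto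
    have mono: "card (standards V I k) \<le> card (standards V I l)" if "k \<le> l" for I k l
      using standards_mono[OF that] by (intro card_mono) auto
    \<comment> \<open>One step of \<open>k\<close> enlarges the argument by \<open>D\<close>. This
      covers the shift \<open>e\<close> of the drop, and \<open>D \<ge> C\<close> keeps the bound
      for \<open>Q\<close> available.\<close>
    define D where "D = C + e"
    have "(k choose Suc i) \<le> card (standards V P (D * (k + 1)))" for k
    proof (induction k)
      case (Suc k)
      have "Suc k choose Suc i = (k choose i) + (k choose Suc i)"
        by simp
      also have "\<dots> \<le> card (standards V Q (C * (k + 1))) + card (standards V P (D * (k + 1)))"
        using C(2) Suc by (rule add_mono)
      also have "\<dots> \<le> card (standards V Q (D * (Suc k + 1))) + card (standards V P (D * (Suc k + 1) - e))"
        by (intro add_mono mono) (auto simp: D_def algebra_simps)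
      also have "\<dots> \<le> card (standards V P (D * (Suc k + 1)))"
        by (rule e)
      finally show ?case .
    qed simp
    moreover have "D \<ge> 1" using C(1) by (simp add: D_def)
    ultimately show ?case
      unfolding P_def by blast
  qed
  obtain C where C: "C \<ge> 1" "\<And>k. (k choose d) \<le> card (standards V (c 0) (C * (k + 1)))"
    using claim[of d] by auto
  have "(k choose d) \<le> (C * (k + 1)) ^ card V" for k
    using C(2)[of k] card_standards_le[OF V, of "c 0" "C * (k + 1)"] by linarith
  then show ?thesis
    using C(1) binomial_bounded_by_power by blast
qed

section \<open>Complete integral closedness\<close>

lemma lead_pow:
  fixes f :: "'v::countable multiset \<Rightarrow> 'a"
  assumes f: "f \<in> carrier (PS V)" and M: "lead f M"
  shows "lead (f [^]\<^bsub>PS V\<^esub> (k::nat)) (repeat_mset k M)"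
proof (induction k)
  case 0
  show ?case by (auto simp: lead_def PS_ops indexed_const_def)
next
  case (Suc k)
  interpret T: cring "PS V" by (rule PS_cring)
  have fk: "f [^]\<^bsub>PS V\<^esub> k \<in> carrier (PS V)" using f by simp
  have "lead (f [^]\<^bsub>PS V\<^esub> k \<star> f) (repeat_mset k M + M)"
    using Suc M by (intro lead_conv PS_coeff[OF fk] PS_coeff[OF f])
  then show ?case by (simp add: PS_ops add.commute)
qed

text \<open>
  For an almost integral fraction \<open>p / q\<close> replace \<open>p\<close> by its remainder \<open>r\<close> modulo \<open>q\<close>: comparing
  leading monomials in \<open>q\<^sup>k dvd d r\<^sup>k\<close> for all \<open>k\<close> shows that the leading monomial of \<open>r\<close> would be
  divisible by that of \<open>q\<close>.
\<close>

theorem PS_completely_integrally_closed: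
  fixes V :: "'v::countable set"
  assumes d: "d \<in> carrier (PS V)" "d \<noteq> \<zero>\<^bsub>PS V\<^esub>"
    and p: "p \<in> carrier (PS V)" and q: "q \<in> carrier (PS V)" "q \<noteq> \<zero>\<^bsub>PS V\<^esub>"
    and int: "\<And>k::nat. q [^]\<^bsub>PS V\<^esub> k divides\<^bsub>PS V\<^esub> (d \<otimes>\<^bsub>PS V\<^esub> p [^]\<^bsub>PS V\<^esub> k)"
  shows "q divides\<^bsub>PS V\<^esub> p"
proof -
  interpret T: domain "PS V" by (rule PS_domain)
  have q0: "q \<noteq> (\<lambda>_. \<zero>)" and d0: "d \<noteq> (\<lambda>_. \<zero>)" using q(2) d(2) by (simp_all add: PS_ops)
  have F: "finite {q}" "{q} \<subseteq> carrier (PS V)" "(\<lambda>_. \<zero>) \<notin> {q}"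
    using q q0 by auto
  obtain h' where h': "\<And>g. g \<in> {q} \<Longrightarrow> h' g \<in> carrier (PS V)"
    "\<And>g N. g \<in> {q} \<Longrightarrow> lm g \<subseteq># N \<Longrightarrow> p N = (\<Oplus>g\<in>{q}. (h' g \<star> g) N)"
    "\<And>n g A. (\<And>M. wt M < n \<Longrightarrow> p M = \<zero>) \<Longrightarrow> g \<in> {q} \<Longrightarrow> wt A * wt (lm g) < n \<Longrightarrow> h' g A = \<zero>"
    by (erule division[OF F p])
  define h where "h = h' q"
  have h: "h \<in> carrier (PS V)" using h'(1) by (simp add: h_def)
  have hq: "h \<star> q \<in> carrier (PS V)" using h q(1) by simp
  define r where "r = p \<ominus>\<^bsub>PS V\<^esub> (q \<otimes>\<^bsub>PS V\<^esub> h)"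
  have r: "r \<in> carrier (PS V)" unfolding r_def using p q(1) h by simp
  have r_alt: "r = p \<ominus>\<^bsub>PS V\<^esub> (h \<star> q)"
    unfolding r_def using T.m_comm[OF q(1) h] by (simp add: PS_ops)
  have r0: "r N = \<zero>" if "lm q \<subseteq># N" for N
  proof -
    have "p N = (h \<star> q) N"
      using h'(2)[of q N] that PS_coeff[OF hq, of N] by (simp add: h_def)
    then show ?thesis
      unfolding r_alt using p hq PS_coeff[OF hq, of N] by (subst PS_minus_coeff) (simp_all add: minus_eq r_neg)
  qed
  \<comment> \<open>Factors \<open>p\<close> are exchanged for \<open>r\<close> one by one. As
    \<open>r = p - q h\<close>, the case \<open>(i, j + 1)\<close> follows from the cases
    \<open>(i + 1, j)\<close> and \<open>(i, j)\<close>; hence the mixed statement for all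
    \<open>i\<close>.\<close>
  have "q [^]\<^bsub>PS V\<^esub> (i + j) divides\<^bsub>PS V\<^esub> (d \<otimes>\<^bsub>PS V\<^esub> p [^]\<^bsub>PS V\<^esub> i \<otimes>\<^bsub>PS V\<^esub> r [^]\<^bsub>PS V\<^esub> j)" for i j :: nat
  proof (induction j arbitrary: i)
    case 0
    then show ?case using int[of i] d p by simp
  next
    case (Suc j)
    obtain u where u: "u \<in> carrier (PS V)" "d \<otimes>\<^bsub>PS V\<^esub> p [^]\<^bsub>PS V\<^esub> i \<otimes>\<^bsub>PS V\<^esub> r [^]\<^bsub>PS V\<^esub> j = q [^]\<^bsub>PS V\<^esub> (i + j) \<otimes>\<^bsub>PS V\<^esub> u"
      using Suc[of i] by (auto simp: factor_def)
    obtain v where v: "v \<in> carrier (PS V)" "d \<otimes>\<^bsub>PS V\<^esub> p [^]\<^bsub>PS V\<^esub> (Suc i) \<otimes>\<^bsub>PS V\<^esub> r [^]\<^bsub>PS V\<^esub> j = q [^]\<^bsub>PS V\<^esub> (Suc i + j) \<otimes>\<^bsub>PS V\<^esub> v"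
      using Suc[of "Suc i"] by (auto simp: factor_def)
    define P where "P = p [^]\<^bsub>PS V\<^esub> i"
    define S where "S = r [^]\<^bsub>PS V\<^esub> j"
    define Y where "Y = q [^]\<^bsub>PS V\<^esub> (i + j)"
    have cl: "P \<in> carrier (PS V)" "S \<in> carrier (PS V)" "Y \<in> carrier (PS V)"
      using p r q by (simp_all add: P_def S_def Y_def)
    have u': "d \<otimes>\<^bsub>PS V\<^esub> P \<otimes>\<^bsub>PS V\<^esub> S = Y \<otimes>\<^bsub>PS V\<^esub> u"
      using u(2) by (simp add: P_def S_def Y_def)
    have v': "d \<otimes>\<^bsub>PS V\<^esub> (P \<otimes>\<^bsub>PS V\<^esub> p) \<otimes>\<^bsub>PS V\<^esub> S = (Y \<otimes>\<^bsub>PS V\<^esub> q) \<otimes>\<^bsub>PS V\<^esub> v"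
      using v(2) by (simp add: P_def S_def Y_def)
    have "d \<otimes>\<^bsub>PS V\<^esub> P \<otimes>\<^bsub>PS V\<^esub> (S \<otimes>\<^bsub>PS V\<^esub> r)
      = d \<otimes>\<^bsub>PS V\<^esub> (P \<otimes>\<^bsub>PS V\<^esub> p) \<otimes>\<^bsub>PS V\<^esub> S \<ominus>\<^bsub>PS V\<^esub> (d \<otimes>\<^bsub>PS V\<^esub> P \<otimes>\<^bsub>PS V\<^esub> S) \<otimes>\<^bsub>PS V\<^esub> (q \<otimes>\<^bsub>PS V\<^esub> h)"
      unfolding r_def using d(1) cl p q(1) h by algebra
    also have "\<dots> = (Y \<otimes>\<^bsub>PS V\<^esub> q) \<otimes>\<^bsub>PS V\<^esub> (v \<ominus>\<^bsub>PS V\<^esub> u \<otimes>\<^bsub>PS V\<^esub> h)"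
      unfolding u' v' using cl u(1) v(1) q(1) h by algebra
    finally have "d \<otimes>\<^bsub>PS V\<^esub> P \<otimes>\<^bsub>PS V\<^esub> (S \<otimes>\<^bsub>PS V\<^esub> r) = (Y \<otimes>\<^bsub>PS V\<^esub> q) \<otimes>\<^bsub>PS V\<^esub> (v \<ominus>\<^bsub>PS V\<^esub> u \<otimes>\<^bsub>PS V\<^esub> h)" .
    then show ?case
      using u(1) v(1) h by (auto simp: factor_def P_def S_def Y_def intro!: bexI[of _ "v \<ominus>\<^bsub>PS V\<^esub> u \<otimes>\<^bsub>PS V\<^esub> h"])
  qed
  from this[of 0] have div: "q [^]\<^bsub>PS V\<^esub> j divides\<^bsub>PS V\<^esub> (d \<otimes>\<^bsub>PS V\<^esub> r [^]\<^bsub>PS V\<^esub> j)" for j :: nat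
    using d(1) by simp
  have "r = (\<lambda>_. \<zero>)"
  proof (rule ccontr)
    assume "r \<noteq> (\<lambda>_. \<zero>)"
    then have lr: "lead r (lm r)" by (rule lead_lm)
    have lq: "lead q (lm q)" using q0 by (rule lead_lm)
    have ld: "lead d (lm d)" using d0 by (rule lead_lm)
    have "count (lm q) v \<le> count (lm r) v" for v
    proof (rule ccontr)
      assume "\<not> ?thesis"
      then have less: "count (lm r) v + 1 \<le> count (lm q) v" by simp
      \<comment> \<open>If \<open>v\<close> occurs more often in \<open>lm q\<close> than in
        \<open>lm r\<close>, every further power widens the gap by at least one, and this
        \<open>k\<close> outgrows the exponent of \<open>v\<close> in \<open>lm d\<close>.\<close>
      define k where "k = count (lm d) v + 1"
      obtain u where u: "u \<in> carrier (PS V)" "d \<otimes>\<^bsub>PS V\<^esub> r [^]\<^bsub>PS V\<^esub> k = q [^]\<^bsub>PS V\<^esub> k \<otimes>\<^bsub>PS V\<^esub> u"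
        using div[of k] by (auto simp: factor_def)
      have rk: "r [^]\<^bsub>PS V\<^esub> k \<in> carrier (PS V)" and qk: "q [^]\<^bsub>PS V\<^esub> k \<in> carrier (PS V)"
        using r q by simp_all
      have 1: "lead (d \<star> r [^]\<^bsub>PS V\<^esub> k) (lm d + repeat_mset k (lm r))"
        by (intro lead_conv ld lead_pow[OF r lr] PS_coeff[OF rk] PS_coeff[OF d(1)])
      have "u \<noteq> (\<lambda>_. \<zero>)"
      proof
        assume "u = (\<lambda>_. \<zero>)"
        then have "d \<star> r [^]\<^bsub>PS V\<^esub> k = \<zero>\<^bsub>PS V\<^esub>"
          using u(2) T.r_null[OF qk] by (simp add: PS_ops)
        then show False using 1 lead_nonzero by (fastforce simp: PS_ops)
      qed
      then have "lead (q [^]\<^bsub>PS V\<^esub> k \<star> u) (repeat_mset k (lm q) + lm u)"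
        by (intro lead_conv lead_lm lead_pow[OF q(1) lq] PS_coeff[OF qk] PS_coeff[OF u(1)])
      then have "lm d + repeat_mset k (lm r) = repeat_mset k (lm q) + lm u"
        using 1 u(2) lead_unique by (simp add: PS_ops)
      then have "count (lm d) v + k * count (lm r) v = k * count (lm q) v + count (lm u) v"
        by (metis count_union count_repeat_mset)
      moreover have "k * (count (lm r) v + 1) \<le> k * count (lm q) v"
        using less by (rule mult_le_mono2)
      ultimately show False
        by (simp add: k_def)
    qed
    then have "lm q \<subseteq># lm r"
      by (simp add: subseteq_mset_def)
    then show False
      using r0 lr by (auto simp: lead_def)
  qed
  then have "r = \<zero>\<^bsub>PS V\<^esub>" by (simp add: PS_ops)
  then have "p = q \<otimes>\<^bsub>PS V\<^esub> h"
    unfolding r_def using p q(1) h by simp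
  then show ?thesis
    using h by (auto simp: factor_def)
qed

end

text \<open>
  \<open>P\<close> is maximal among the colon ideals \<open>(q : r)\<close> containing \<open>J\<close>. By complete integral closedness
  \<open>P\<close> is not stable under multiplication by \<open>r / q\<close>, so \<open>x r = q u\<close> with \<open>x \<in> P\<close>, \<open>u \<notin> P\<close>, and \<open>u P \<subseteq> (x)\<close>.
  A nonzero prime properly below \<open>P\<close> would be stable under \<open>u / x\<close>, so \<open>x\<close> would divide \<open>u\<close>.
\<close>

theorem (in noetherian_domain) completely_integrally_closed_S2:
  assumes cic: "\<And>d p q. \<lbrakk>d \<in> carrier R; d \<noteq> \<zero>; p \<in> carrier R; q \<in> carrier R; q \<noteq> \<zero>;
      \<And>k::nat. q [^] k divides (d \<otimes> p [^] k)\<rbrakk> \<Longrightarrow> q divides p"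
    and J: "J \<subseteq> carrier R" and p: "p \<in> carrier R" and q: "q \<in> carrier R" "q \<noteq> \<zero>"
    and Jp: "\<And>x. x \<in> J \<Longrightarrow> q divides (x \<otimes> p)" and np: "\<not> q divides p"
  obtains P where "primeideal P R" "J \<subseteq> P"
    and "\<And>c. primeideal c R \<Longrightarrow> c \<subset> P \<Longrightarrow> c = {\<zero>}"
proof -
  define colon where "colon = (\<lambda>r. {x \<in> carrier R. q divides (x \<otimes> r)})"
  have colon_ideal: "ideal (colon r) R" if r: "r \<in> carrier R" for r
  proof (rule idealI)
    show "ring R" by (rule ring_axioms)
    show "subgroup (colon r) (add_monoid R)"
    proof (rule add.subgroupI)
      show "colon r \<subseteq> carrier R" by (auto simp: colon_def)
      have "\<zero> \<in> colon r" using q r by (auto simp: colon_def factor_def intro!: bexI[of _ \<zero>])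
      then show "colon r \<noteq> {}" by blast
    next
      fix a assume "a \<in> colon r"
      then obtain u where u: "a \<in> carrier R" "u \<in> carrier R" "a \<otimes> r = q \<otimes> u"
        by (auto simp: colon_def factor_def)
      then have "\<ominus> a \<otimes> r = q \<otimes> \<ominus> u"
        using r q(1) by (simp add: l_minus r_minus)
      then show "\<ominus> a \<in> colon r"
        using u by (auto simp: colon_def factor_def)
    next
      fix a b assume "a \<in> colon r" "b \<in> colon r"
      then obtain u v where u: "a \<in> carrier R" "u \<in> carrier R" "a \<otimes> r = q \<otimes> u"
        and v: "b \<in> carrier R" "v \<in> carrier R" "b \<otimes> r = q \<otimes> v"
        by (auto simp: colon_def factor_def)
      then have "(a \<oplus> b) \<otimes> r = q \<otimes> (u \<oplus> v)"
        using r q(1) by (simp add: l_distr r_distr)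
      then show "a \<oplus> b \<in> colon r"
        using u v by (auto simp: colon_def factor_def)
    qed
  next
    fix a x assume ax: "a \<in> colon r" "x \<in> carrier R"
    then obtain u where u: "u \<in> carrier R" "a \<otimes> r = q \<otimes> u" "a \<in> carrier R"
      by (auto simp: colon_def factor_def)
    have "x \<otimes> a \<otimes> r = x \<otimes> (a \<otimes> r)"
      using ax(2) u r by (simp add: m_assoc)
    also have "\<dots> = q \<otimes> (x \<otimes> u)"
      unfolding u(2) using ax(2) u q(1) by (simp add: m_lcomm)
    finally have eq: "x \<otimes> a \<otimes> r = q \<otimes> (x \<otimes> u)" .
    then show "x \<otimes> a \<in> colon r"
      using u ax(2) by (auto simp: colon_def factor_def)
    then show "a \<otimes> x \<in> colon r"
      using u ax(2) m_comm by simp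
  qed
  define S where "S = {colon r | r. r \<in> carrier R \<and> \<not> q divides r \<and> J \<subseteq> colon r}"
  have "colon p \<in> S"
    using p np J Jp by (auto simp: S_def colon_def)
  have "\<Union>C \<in> S" if C: "C \<noteq> {}" "subset.chain S C" for C
  proof -
    \<comment> \<open>The Noetherian property: a chain of colon ideals contains its own union, as
      Zorn's lemma requires.\<close>
    have "subset.chain {I. ideal I R} C"
      using C(2) colon_ideal by (auto simp: pred_on.chain_def S_def)
    then have "\<Union>C \<in> C"
      using ideal_chain_is_trivial C(1) by blast
    then show ?thesis
      using C(2) by (auto simp: pred_on.chain_def)
  qed
  then have "\<exists>P\<in>S. \<forall>W\<in>S. P \<subseteq> W \<longrightarrow> W = P"
    using \<open>colon p \<in> S\<close> by (intro subset_Zorn_nonempty) auto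
  then obtain P where P: "P \<in> S" and max: "\<forall>W\<in>S. P \<subseteq> W \<longrightarrow> W = P" ..
  have P_max: "W = P" if "W \<in> S" "P \<subseteq> W" for W
    using mp[OF bspec[OF max that(1)] that(2)] .
  obtain r where r: "r \<in> carrier R" "\<not> q divides r" "J \<subseteq> P" "P = colon r"
  proof -
    assume *: "\<And>r. \<lbrakk>r \<in> carrier R; \<not> q divides r; J \<subseteq> P; P = colon r\<rbrakk> \<Longrightarrow> thesis"
    have "\<exists>r. P = colon r \<and> r \<in> carrier R \<and> \<not> q divides r \<and> J \<subseteq> colon r"
      using P unfolding S_def by (rule CollectD)
    then show thesis
      by (elim exE conjE) (rule *, simp_all)
  qed
  interpret P: ideal P R using colon_ideal r by simp
  have mem: "x \<in> P \<longleftrightarrow> x \<in> carrier R \<and> q divides (x \<otimes> r)" for x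
    unfolding r(4) colon_def by (rule mem_Collect_eq)
  have memI: "x \<in> P" if "x \<in> carrier R" "u \<in> carrier R" "x \<otimes> r = q \<otimes> u" for x u
    unfolding mem factor_def using that by blast
  have memE: "\<exists>u\<in>carrier R. x \<otimes> r = q \<otimes> u" if "x \<in> P" for x
    using that unfolding mem factor_def by blast
  have prime: "primeideal P R"
  proof (rule primeidealI[OF P.is_ideal is_cring])
    show "carrier R \<noteq> P"
      using mem[of \<one>] r(1,2) by (metis l_one one_closed)
    fix a b assume ab: "a \<in> carrier R" "b \<in> carrier R" "a \<otimes> b \<in> P"
    show "a \<in> P \<or> b \<in> P"
    proof (rule disjCI)
      assume "b \<notin> P"
      then have "\<not> q divides (b \<otimes> r)"
        using mem ab by blast
      \<comment> \<open>\<open>colon (b \<otimes> r)\<close> is again a member of \<open>S\<close>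
        and contains \<open>P\<close>, so by maximality it is \<open>P\<close>; it also contains
        \<open>a\<close>.\<close>
      moreover have sub: "P \<subseteq> colon (b \<otimes> r)"
      proof
        fix x assume x: "x \<in> P"
        have "b \<otimes> x \<in> P"
          using x ab P.I_l_closed by blast
        have xc: "x \<in> carrier R" using x P.a_Hcarr by blast
        have "x \<otimes> (b \<otimes> r) = b \<otimes> x \<otimes> r"
          using xc ab(2) r(1) by (simp add: m_ac)
        moreover have "q divides (b \<otimes> x \<otimes> r)"
          using mem \<open>b \<otimes> x \<in> P\<close> by blast
        ultimately show "x \<in> colon (b \<otimes> r)"
          using xc by (simp add: colon_def)
      qed
      moreover have "b \<otimes> r \<in> carrier R"
        using ab r by simp
      ultimately have "colon (b \<otimes> r) \<in> S"
        using r(3) unfolding S_def by blast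
      then have "colon (b \<otimes> r) = P"
        using sub by (rule P_max)
      moreover have "a \<in> colon (b \<otimes> r)"
        using ab(3) ab(1,2) r(1) unfolding mem by (simp add: colon_def m_assoc)
      ultimately show "a \<in> P" by simp
    qed
  qed
  interpret P: primeideal P R by fact
  have qP: "q \<in> P"
    by (rule memI[OF q(1) r(1) refl])
  have "\<exists>x u. x \<in> P \<and> u \<in> carrier R \<and> u \<notin> P \<and> x \<otimes> r = q \<otimes> u"
  proof (rule ccontr)
    assume neg: "\<not> ?thesis"
    \<comment> \<open>Stability of \<open>P\<close> under \<open>r / q\<close> keeps
      \<open>q (r / q) ^ k\<close> in \<open>P\<close> for all \<open>k\<close>, starting from
      \<open>q\<close> itself; so \<open>q\<close> is a common denominator of all powers of
      \<open>r / q\<close>.\<close>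
    have stay: "\<exists>y\<in>P. q \<otimes> r [^] k = q [^] k \<otimes> y" for k :: nat
    proof (induction k)
      case 0
      show ?case using qP q by (auto intro!: bexI[of _ q])
    next
      case (Suc k)
      then obtain y where y: "y \<in> P" "q \<otimes> r [^] k = q [^] k \<otimes> y" by blast
      have yc: "y \<in> carrier R" using y(1) P.a_Hcarr by blast
      obtain z where z: "z \<in> carrier R" "y \<otimes> r = q \<otimes> z"
        using memE[OF y(1)] by blast
      then have "z \<in> P" using neg y(1) by blast
      have "q \<otimes> r [^] Suc k = (q \<otimes> r [^] k) \<otimes> r"
        using q r by (simp add: m_assoc)
      also have "\<dots> = q [^] k \<otimes> (y \<otimes> r)"
        unfolding y(2) using q r yc by (simp add: m_assoc)
      also have "\<dots> = q [^] Suc k \<otimes> z"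
        unfolding z(2) using q z by (simp add: m_assoc)
      finally show ?case using \<open>z \<in> P\<close> by blast
    qed
    have "q [^] k divides (q \<otimes> r [^] k)" for k :: nat
      using stay[of k] P.a_Hcarr by (auto simp: factor_def)
    then have "q divides r"
      using cic[of q r q] q r by blast
    then show False using r by blast
  qed
  then obtain x u where x: "x \<in> P" "u \<in> carrier R" "u \<notin> P" "x \<otimes> r = q \<otimes> u"
    by blast
  have xc: "x \<in> carrier R" using x(1) P.a_Hcarr by blast
  have ux: "\<exists>w\<in>carrier R. u \<otimes> y = x \<otimes> w" if y: "y \<in> P" for y
  proof -
    have yc: "y \<in> carrier R" using y P.a_Hcarr by blast
    obtain w where w: "w \<in> carrier R" "y \<otimes> r = q \<otimes> w"
      using memE[OF y] by blast
    have "q \<otimes> (u \<otimes> y) = (x \<otimes> r) \<otimes> y"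
      unfolding x(4) using q x yc by (simp add: m_assoc)
    also have "\<dots> = x \<otimes> (y \<otimes> r)"
      using xc r(1) yc by (simp add: m_ac)
    also have "\<dots> = q \<otimes> (x \<otimes> w)"
      unfolding w(2) using xc q w by (simp add: m_lcomm)
    finally have "u \<otimes> y = x \<otimes> w"
      using q x(2) yc xc w(1) by (metis m_closed m_lcancel)
    then show ?thesis using w(1) by blast
  qed
  have "c = {\<zero>}" if c: "primeideal c R" "c \<subset> P" for c
  proof (rule ccontr)
    assume ne: "c \<noteq> {\<zero>}"
    interpret c: primeideal c R by fact
    have z: "\<zero> \<in> c" using additive_subgroup.zero_closed[OF c.is_additive_subgroup] .
    then obtain d where d: "d \<in> c" "d \<noteq> \<zero>" using ne by blast
    have dc: "d \<in> carrier R" using d c.a_Hcarr by blast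
    \<comment> \<open>If \<open>x\<close> were in \<open>c\<close>, then \<open>u P\<close>,
      contained in \<open>(x)\<close>, would lie in \<open>c\<close> as well; since the prime
      \<open>c\<close> avoids \<open>u\<close>, all of \<open>P\<close> would lie in
      \<open>c\<close>.\<close>
    have xnc: "x \<notin> c"
    proof
      assume xc': "x \<in> c"
      have "P \<subseteq> c"
      proof
        fix y assume y: "y \<in> P"
        then obtain w where w: "w \<in> carrier R" "u \<otimes> y = x \<otimes> w" using ux by blast
        then have "u \<otimes> y \<in> c" using xc' c.I_r_closed by metis
        moreover have "u \<notin> c" using x(3) c(2) by blast
        ultimately show "y \<in> c"
          using c.I_prime[OF x(2) P.a_Hcarr[OF y]] by blast
      qed
      then show False using c(2) by blast
    qed
    have stay: "\<exists>w\<in>c. d \<otimes> u [^] k = x [^] k \<otimes> w" for k :: nat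
    proof (induction k)
      case 0
      show ?case using d dc by (auto intro!: bexI[of _ d])
    next
      case (Suc k)
      then obtain w where w: "w \<in> c" "d \<otimes> u [^] k = x [^] k \<otimes> w" by blast
      have wc: "w \<in> carrier R" using w(1) c.a_Hcarr by blast
      obtain v where v: "v \<in> carrier R" "u \<otimes> w = x \<otimes> v"
        using ux[of w] w(1) c(2) by blast
      have "x \<otimes> v \<in> c"
        using c.I_l_closed[OF w(1) x(2)] v(2) by simp
      then have "v \<in> c"
        using c.I_prime[OF xc v(1)] xnc by blast
      have "d \<otimes> u [^] Suc k = (d \<otimes> u [^] k) \<otimes> u"
        using dc x by (simp add: m_assoc)
      also have "\<dots> = x [^] k \<otimes> (u \<otimes> w)"
        unfolding w(2) using xc wc x by (simp add: m_ac)
      also have "\<dots> = x [^] Suc k \<otimes> v"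
        unfolding v(2) using xc v by (simp add: m_assoc)
      finally show ?case using \<open>v \<in> c\<close> by blast
    qed
    have "x [^] k divides (d \<otimes> u [^] k)" for k :: nat
      using stay[of k] c.a_Hcarr by (auto simp: factor_def)
    moreover have "x \<noteq> \<zero>" using xnc z by blast
    ultimately have "x divides u"
      using cic[of d u x] d dc x xc by blast
    then have "u \<in> P"
      using P.I_r_closed[OF x(1)] by (auto simp: factor_def)
    then show False using x(3) by blast
  qed
  then show ?thesis
    using that[of P] prime r(3) by blast
qed


section \<open>Surjective ring homomorphisms\<close>

text \<open>One setting serves the quotient maps, the restrictions to fewer variables, the
  projections from a product and the isomorphism onto a localization. Primes and chains are moved
  along it in both directions.\<close>

locale surj_ring_hom = ring_hom_cring +
  assumes surj: "h ` carrier R = carrier S"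
begin

definition preim :: "'c set \<Rightarrow> 'a set"
  where "preim I = {r \<in> carrier R. h r \<in> I}"

abbreviation Ker :: "'a set"
  where "Ker \<equiv> a_kernel R S h"

lemma Ker_iff: "r \<in> Ker \<longleftrightarrow> r \<in> carrier R \<and> h r = \<zero>\<^bsub>S\<^esub>"
  unfolding a_kernel_def' by (rule mem_Collect_eq)

lemma surjE:
  assumes "y \<in> carrier S"
  obtains x where "x \<in> carrier R" "y = h x"
  using assms surj by blast

lemma preim_ideal: "ideal I S \<Longrightarrow> ideal (preim I) R"
  unfolding preim_def
  by (rule ring_hom_ring.ideal_vimage[OF ring_hom_ringI2[OF R.ring_axioms S.ring_axioms homh]])

lemma Ker_subset_preim: "ideal I S \<Longrightarrow> Ker \<subseteq> preim I"
  using additive_subgroup.zero_closed[OF ideal.axioms(1)] by (auto simp: Ker_iff preim_def)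

lemma image_preim: "I \<subseteq> carrier S \<Longrightarrow> h ` preim I = I"
  using surj by (auto simp: preim_def)

lemma image_ideal:
  assumes "ideal I R"
  shows "ideal (h ` I) S"
proof -
  interpret I: ideal I R by fact
  show ?thesis
  proof (rule idealI[OF S.ring_axioms])
    show "subgroup (h ` I) (add_monoid S)"
    proof (rule S.add.subgroupI)
      show "h ` I \<subseteq> carrier S" using I.a_Hcarr hom_closed by blast
      show "h ` I \<noteq> {}" using additive_subgroup.zero_closed[OF I.is_additive_subgroup] by blast
      show "\<ominus>\<^bsub>S\<^esub> y \<in> h ` I" if y: "y \<in> h ` I" for y
      proof -
        obtain i where i: "y = h i" "i \<in> I" using y by (rule imageE)
        have "\<ominus>\<^bsub>S\<^esub> y = h (\<ominus> i)" using i I.a_Hcarr by simp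
        then show ?thesis using I.a_inv_closed[OF i(2)] by (simp add: image_eqI)
      qed
      show "x \<oplus>\<^bsub>S\<^esub> y \<in> h ` I" if "x \<in> h ` I" "y \<in> h ` I" for x y
      proof -
        obtain i where i: "x = h i" "i \<in> I" using \<open>x \<in> h ` I\<close> by (rule imageE)
        obtain j where j: "y = h j" "j \<in> I" using \<open>y \<in> h ` I\<close> by (rule imageE)
        have "x \<oplus>\<^bsub>S\<^esub> y = h (i \<oplus> j)" using i j I.a_Hcarr by simp
        then show ?thesis using I.a_closed[OF i(2) j(2)] by (simp add: image_eqI)
      qed
    qed
    fix a x assume a: "a \<in> h ` I" and x: "x \<in> carrier S"
    obtain b where b: "a = h b" "b \<in> I" using a by (rule imageE)
    obtain y where y: "y \<in> carrier R" "x = h y" using x by (rule surjE)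
    have "x \<otimes>\<^bsub>S\<^esub> a = h (y \<otimes> b)" "a \<otimes>\<^bsub>S\<^esub> x = h (b \<otimes> y)"
      using b y I.a_Hcarr by simp_all
    then show "x \<otimes>\<^bsub>S\<^esub> a \<in> h ` I" "a \<otimes>\<^bsub>S\<^esub> x \<in> h ` I"
      using I.I_l_closed[OF b(2) y(1)] I.I_r_closed[OF b(2) y(1)] by (simp_all only: image_eqI)
  qed
qed

lemma image_mem_iff:
  assumes I: "ideal I R" and K: "Ker \<subseteq> I" and r: "r \<in> carrier R"
  shows "h r \<in> h ` I \<longleftrightarrow> r \<in> I"
proof
  interpret I: ideal I R by fact
  assume "h r \<in> h ` I"
  then obtain i where i: "i \<in> I" "h r = h i" by blast
  have ic: "i \<in> carrier R" using i I.a_Hcarr by blast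
  have "h (r \<ominus> i) = \<zero>\<^bsub>S\<^esub>"
    using i r ic by (simp add: a_minus_def S.r_neg)
  then have "r \<ominus> i \<in> I"
    using K r ic by (auto simp: Ker_iff)
  then have "(r \<ominus> i) \<oplus> i \<in> I"
    using i I.a_closed by blast
  also have "(r \<ominus> i) \<oplus> i = r"
    using r ic by algebra
  finally show "r \<in> I" .
qed auto

lemma preim_image:
  assumes "ideal I R" "Ker \<subseteq> I"
  shows "preim (h ` I) = I"
  using image_mem_iff[OF assms] ideal.Icarr[OF assms(1)] by (auto simp: preim_def)

lemma preim_prime: "primeideal Q S \<Longrightarrow> primeideal (preim Q) R"
proof -
  assume Q: "primeideal Q S"
  interpret Q: primeideal Q S by fact
  show ?thesis
  proof (rule primeidealI[OF preim_ideal[OF Q.is_ideal] R.is_cring])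
    have "\<one>\<^bsub>S\<^esub> \<notin> Q" using Q.one_imp_carrier Q.I_notcarr by blast
    then have "\<one> \<notin> preim Q" by (simp add: preim_def)
    then show "carrier R \<noteq> preim Q" using R.one_closed by blast
    show "a \<in> preim Q \<or> b \<in> preim Q" if "a \<in> carrier R" "b \<in> carrier R" "a \<otimes> b \<in> preim Q" for a b
      using that Q.I_prime[of "h a" "h b"] by (auto simp: preim_def)
  qed
qed

lemma image_prime:
  assumes P: "primeideal P R" and K: "Ker \<subseteq> P"
  shows "primeideal (h ` P) S"
proof -
  interpret P: primeideal P R by fact
  note iff = image_mem_iff[OF P.is_ideal K]
  show ?thesis
  proof (rule primeidealI[OF image_ideal[OF P.is_ideal] S.is_cring])
    have "\<one> \<notin> P" using P.one_imp_carrier P.I_notcarr by blast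
    then show "carrier S \<noteq> h ` P"
      using iff[OF R.one_closed] S.one_closed hom_one by metis
    fix a b assume ab: "a \<in> carrier S" "b \<in> carrier S" "a \<otimes>\<^bsub>S\<^esub> b \<in> h ` P"
    obtain x where x: "x \<in> carrier R" "a = h x" using ab(1) by (rule surjE)
    obtain y where y: "y \<in> carrier R" "b = h y" using ab(2) by (rule surjE)
    have "x \<otimes> y \<in> P"
      using ab(3) x y iff[of "x \<otimes> y"] by simp
    then show "a \<in> h ` P \<or> b \<in> h ` P"
      using P.I_prime[OF x(1) y(1)] x y by blast
  qed
qed

lemma preim_mono_strict:
  assumes "I \<subset> J" "J \<subseteq> carrier S"
  shows "preim I \<subset> preim J"
proof -
  obtain y where y: "y \<in> J" "y \<notin> I" using assms by blast
  then obtain x where "x \<in> carrier R" "y = h x" using surjE assms by blast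
  then have "x \<in> preim J" "x \<notin> preim I" using y by (auto simp: preim_def)
  moreover have "preim I \<subseteq> preim J" using assms by (auto simp: preim_def)
  ultimately show ?thesis by blast
qed

lemma image_mono_strict:
  assumes "ideal I R" "Ker \<subseteq> I" "I \<subset> J" "J \<subseteq> carrier R"
  shows "h ` I \<subset> h ` J"
proof -
  obtain x where x: "x \<in> J" "x \<notin> I" using assms by blast
  then have "h x \<in> h ` J" "h x \<notin> h ` I" using image_mem_iff[OF assms(1,2), of x] assms(4) by auto
  moreover have "h ` I \<subseteq> h ` J" using assms by auto
  ultimately show ?thesis by blast
qed

lemma preim_chain:
  assumes "prime_chain S c n"
  shows "prime_chain R (\<lambda>i. preim (c i)) n"
  unfolding prime_chain_def
proof (intro conjI allI impI)
  have pr: "primeideal (c i) S" if "i \<le> n" for i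
    using assms that by (simp add: prime_chain_def)
  show "primeideal (preim (c i)) R" if "i \<le> n" for i
    using pr[OF that] by (rule preim_prime)
  show "preim (c i) \<subset> preim (c (Suc i))" if "i < n" for i
  proof (rule preim_mono_strict)
    show "c i \<subset> c (Suc i)" using assms that by (simp add: prime_chain_def)
    show "c (Suc i) \<subseteq> carrier S"
      using ideal.Icarr[OF primeideal.axioms(1)[OF pr[of "Suc i"]]] that by auto
  qed
qed

lemma prime_chain_mono:
  assumes "prime_chain R' c n" "i \<le> j" "j \<le> n"
  shows "c i \<subseteq> c j"
  using assms(2,3)
proof (induction j)
  case (Suc j)
  then show ?case
    using assms(1) by (cases "i = Suc j") (auto simp: prime_chain_def Suc_le_eq less_Suc_eq_le)
qed simp

lemma image_chain:
  assumes c: "prime_chain R c n" and K: "Ker \<subseteq> c 0"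
  shows "prime_chain S (\<lambda>i. h ` c i) n"
proof -
  have Ki: "Ker \<subseteq> c i" if "i \<le> n" for i
    using prime_chain_mono[OF c _ that, of 0] K by blast
  have pr: "primeideal (c i) R" if "i \<le> n" for i
    using c that by (simp add: prime_chain_def)
  show ?thesis
    unfolding prime_chain_def
  proof (intro conjI allI impI)
    show "primeideal (h ` c i) S" if "i \<le> n" for i
      using image_prime pr Ki that by blast
    show "h ` c i \<subset> h ` c (Suc i)" if "i < n" for i
    proof (rule image_mono_strict)
      show "ideal (c i) R" using pr[of i] that by (simp add: primeideal.axioms(1))
      show "Ker \<subseteq> c i" using Ki that by simp
      show "c i \<subset> c (Suc i)" using c that by (simp add: prime_chain_def)
      show "c (Suc i) \<subseteq> carrier R"
        using pr[of "Suc i"] that ideal.Icarr[OF primeideal.axioms(1)] by (metis Suc_leI subsetI)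
    qed
  qed
qed

lemma krull_dim_image:
  "krull_dim S = Sup {enat n | n. \<exists>c. prime_chain R c n \<and> Ker \<subseteq> c 0}"
proof -
  have "(\<exists>c. prime_chain S c n) \<longleftrightarrow> (\<exists>c. prime_chain R c n \<and> Ker \<subseteq> c 0)" for n
  proof
    assume "\<exists>c. prime_chain S c n"
    then obtain c where c: "prime_chain S c n" by blast
    then have "primeideal (c 0) S" by (simp add: prime_chain_def)
    then show "\<exists>c. prime_chain R c n \<and> Ker \<subseteq> c 0"
      using preim_chain[OF c] Ker_subset_preim[of "c 0"] primeideal.axioms(1) by blast
  qed (use image_chain in blast)
  then show ?thesis by (simp add: krull_dim_def)
qed

lemma image_Idl:
  assumes G: "G \<subseteq> carrier R"
  shows "h ` (Idl\<^bsub>R\<^esub> G) = Idl\<^bsub>S\<^esub> (h ` G)"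
proof
  have hG: "h ` G \<subseteq> carrier S" using G by auto
  have "Idl\<^bsub>R\<^esub> G \<subseteq> preim (Idl\<^bsub>S\<^esub> (h ` G))"
    using G S.genideal_self[OF hG] by (intro R.genideal_minimal preim_ideal S.genideal_ideal hG) (auto simp: preim_def)
  then show "h ` (Idl\<^bsub>R\<^esub> G) \<subseteq> Idl\<^bsub>S\<^esub> (h ` G)"
    by (auto simp: preim_def)
  show "Idl\<^bsub>S\<^esub> (h ` G) \<subseteq> h ` (Idl\<^bsub>R\<^esub> G)"
    using R.genideal_self[OF G] by (intro S.genideal_minimal image_ideal R.genideal_ideal G) auto
qed

lemma image_noetherian:
  assumes "noetherian_ring R"
  shows "noetherian_ring S"
proof (rule S.noetherian_ringI)
  fix I assume I: "ideal I S"
  obtain A where A: "A \<subseteq> carrier R" "finite A" "preim I = Idl\<^bsub>R\<^esub> A"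
    using noetherian_ring.finetely_gen[OF assms preim_ideal[OF I]] by blast
  have "I = Idl\<^bsub>S\<^esub> (h ` A)"
    using image_Idl[OF A(1)] image_preim[of I] A(3) ideal.Icarr[OF I] by auto
  then show "\<exists>A\<subseteq>carrier S. finite A \<and> I = Idl\<^bsub>S\<^esub> A"
    using A by (intro exI[of _ "h ` A"]) auto
qed

end

text \<open>Unlike uniqueness of the maximal ideal, this form can be checked by inverting elements,
  and it descends to quotients at once.\<close>

definition local_with :: "('a, 'b) ring_scheme \<Rightarrow> 'a set \<Rightarrow> bool"
  where "local_with R M \<longleftrightarrow> ideal M R \<and> \<one>\<^bsub>R\<^esub> \<notin> M \<and> carrier R - M \<subseteq> Units R"

lemma (in cring) local_with_unique_maximal:
  assumes "local_with R M"
  shows "maximalideal N R \<longleftrightarrow> N = M"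
proof -
  have M: "ideal M R" "\<one> \<notin> M" "carrier R - M \<subseteq> Units R"
    using assms by (auto simp: local_with_def)
  have top: "I \<subseteq> M" if I: "ideal I R" "I \<noteq> carrier R" for I
  proof
    fix x assume x: "x \<in> I"
    interpret I: ideal I R by fact
    show "x \<in> M"
    proof (rule ccontr)
      assume "x \<notin> M"
      then have "x \<in> Units R" using M(3) x I.a_Hcarr by blast
      then have "inv x \<otimes> x = \<one>" "inv x \<in> carrier R"
        by simp_all
      then have "\<one> \<in> I"
        using I.I_l_closed[OF x] by metis
      then show False using I.one_imp_carrier I(2) by simp
    qed
  qed
  have Mc: "M \<noteq> carrier R" "M \<subseteq> carrier R"
    using M(2) ideal.Icarr[OF M(1)] by auto
  have "maximalideal M R"
  proof (rule maximalidealI[OF M(1)])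
    show "J = M \<or> J = carrier R" if "ideal J R" "M \<subseteq> J" for J
      using top[OF that(1)] that(2) by blast
  qed (use Mc in auto)
  moreover have "N = M" if "maximalideal N R"
  proof -
    interpret N: maximalideal N R by fact
    show ?thesis
      using top[OF N.is_ideal] N.I_notcarr N.I_maximal[OF M(1)] Mc by auto
  qed
  ultimately show ?thesis by blast
qed

lemma (in cring) local_with_local:
  assumes "local_with R M"
  shows "local_ring R" "maximal_ideal_of R = M"
  using local_with_unique_maximal[OF assms] is_cring by (auto simp: local_ring_def maximal_ideal_of_def)

lemma (in surj_ring_hom) image_local:
  assumes M: "local_with R M" and K: "Ker \<subseteq> M"
  shows "local_with S (h ` M)"
  unfolding local_with_def
proof (intro conjI subsetI)
  have M: "ideal M R" "\<one> \<notin> M" "carrier R - M \<subseteq> Units R"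
    using M by (auto simp: local_with_def)
  show "ideal (h ` M) S" using M(1) by (rule image_ideal)
  show "\<one>\<^bsub>S\<^esub> \<notin> h ` M"
    using image_mem_iff[OF M(1) K R.one_closed] M(2) by simp
  fix y assume y: "y \<in> carrier S - h ` M"
  then obtain x where x: "x \<in> carrier R" "y = h x" using surjE by blast
  then have "x \<in> Units R" using y M(3) by blast
  then obtain z where "z \<in> carrier R" "z \<otimes> x = \<one>" "x \<otimes> z = \<one>"
    by (auto simp: Units_def)
  then have "h z \<in> carrier S" "h z \<otimes>\<^bsub>S\<^esub> y = \<one>\<^bsub>S\<^esub>" "y \<otimes>\<^bsub>S\<^esub> h z = \<one>\<^bsub>S\<^esub>"
    using x by (simp_all add: hom_mult[symmetric])
  then show "y \<in> Units S"
    using y by (auto simp: Units_def)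
qed

lemma (in cring) regular_local_ringI:
  assumes "noetherian_ring R" "local_with R (Idl\<^bsub>R\<^esub> G)" "finite G" "G \<subseteq> carrier R"
    and "enat (card G) = krull_dim R"
  shows "regular_local_ring R"
  using assms local_with_local[OF assms(2)] by (auto simp: regular_local_ring_def)

text \<open>This transports regularity along an isomorphism, since localizations live on classes of
  pairs. Injectivity preserves both the number of generators and the dimension.\<close>

lemma (in surj_ring_hom) image_regular_local:
  assumes inj: "inj_on h (carrier R)"
    and "noetherian_ring R" "local_with R (Idl\<^bsub>R\<^esub> G)" "finite G" "G \<subseteq> carrier R"
    and "enat (card G) = krull_dim R"
  shows "regular_local_ring S"
proof (rule S.regular_local_ringI[where G = "h ` G"])
  have K: "Ker \<subseteq> I" if "ideal I R" for I
  proof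
    fix r assume "r \<in> Ker"
    then have "r = \<zero>"
      using inj_onD[OF inj, of r \<zero>] by (simp add: Ker_iff)
    then show "r \<in> I"
      using additive_subgroup.zero_closed[OF ideal.axioms(1)[OF that]] by simp
  qed
  show "noetherian_ring S" using assms(2) by (rule image_noetherian)
  have "ideal (Idl\<^bsub>R\<^esub> G) R" using R.genideal_ideal assms(5) by blast
  then show "local_with S (Idl\<^bsub>S\<^esub> (h ` G))"
    using image_local[OF assms(3) K] image_Idl[OF assms(5)] by simp
  show "finite (h ` G)" "h ` G \<subseteq> carrier S" using assms by auto
  have "krull_dim S = krull_dim R"
  proof -
    have "(\<exists>c. prime_chain R c n \<and> Ker \<subseteq> c 0) \<longleftrightarrow> (\<exists>c. prime_chain R c n)" for n
      using K primeideal.axioms(1) by (metis (no_types) prime_chain_def zero_le)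
    then show ?thesis
      unfolding krull_dim_image by (simp add: krull_dim_def)
  qed
  moreover have "card (h ` G) = card G"
    using inj assms(5) by (intro card_image inj_on_subset[OF inj])
  ultimately show "enat (card (h ` G)) = krull_dim S"
    using assms(6) by simp
qed

lemma (in ideal) quot_surj_hom:
  assumes "cring R"
  shows "surj_ring_hom R (R Quot I) ((+>) I)"
proof (intro surj_ring_hom.intro surj_ring_hom_axioms.intro)
  show "ring_hom_cring R (R Quot I) ((+>) I)" using assms by (rule rcos_ring_hom_cring)
  show "(+>) I ` carrier R = carrier (R Quot I)"
    unfolding FactRing_def A_RCOSETS_def' by (simp add: UNION_singleton_eq_range)
qed

lemma zero_FactRing: "\<zero>\<^bsub>R Quot I\<^esub> = I"
  by (simp add: FactRing_def)

lemma (in ideal) quot_Ker: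
  assumes "cring R"
  shows "a_kernel R (R Quot I) ((+>) I) = I"
proof -
  interpret h: surj_ring_hom R "R Quot I" "(+>) I" using assms by (rule quot_surj_hom)
  show ?thesis
  proof (rule subset_antisym; rule subsetI)
    fix r assume "r \<in> a_kernel R (R Quot I) ((+>) I)"
    then show "r \<in> I" unfolding h.Ker_iff zero_FactRing using rcos_const_imp_mem by blast
  next
    fix r assume "r \<in> I"
    then show "r \<in> a_kernel R (R Quot I) ((+>) I)"
      unfolding h.Ker_iff zero_FactRing using a_rcos_zero[OF is_ideal] a_Hcarr by blast
  qed
qed


section \<open>Localizations and direct products\<close>

text \<open>The operations on fractions are unions over representatives; this reduces their
  computation to independence of the representatives.\<close>

lemma UN_UN_const:
  assumes "p0 \<in> F" "q0 \<in> G" "\<And>p q. p \<in> F \<Longrightarrow> q \<in> G \<Longrightarrow> f p q = K"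
  shows "(\<Union>p\<in>F. \<Union>q\<in>G. f p q) = K"
  using assms by blast

locale mult_subset = cring R for R (structure) +
  fixes S
  assumes S_subset: "S \<subseteq> carrier R" and S_one: "\<one> \<in> S"
    and S_mult: "\<And>s t. s \<in> S \<Longrightarrow> t \<in> S \<Longrightarrow> s \<otimes> t \<in> S"
begin

lemma S_carrier: "s \<in> S \<Longrightarrow> s \<in> carrier R"
  using S_subset by blast

lemma fraction_rel_iff:
  "((a, s), (b, t)) \<in> fraction_rel R S \<longleftrightarrow> a \<in> carrier R \<and> s \<in> S \<and> b \<in> carrier R \<and> t \<in> S \<and>
    (\<exists>u\<in>S. u \<otimes> (t \<otimes> a) = u \<otimes> (s \<otimes> b))"
  by (simp add: fraction_rel_def)

lemma equiv_fraction_rel: "equiv (carrier R \<times> S) (fraction_rel R S)"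
proof (rule equivI)
  show "fraction_rel R S \<subseteq> (carrier R \<times> S) \<times> (carrier R \<times> S)"
    by (auto simp: fraction_rel_def)
  show "refl_on (carrier R \<times> S) (fraction_rel R S)"
    using S_one by (auto simp: refl_on_def fraction_rel_def)
  show "sym (fraction_rel R S)"
    by (rule symI) (force simp: fraction_rel_def)
  show "trans (fraction_rel R S)"
  proof (rule transI)
    fix x y z assume xy: "(x, y) \<in> fraction_rel R S" and yz: "(y, z) \<in> fraction_rel R S"
    obtain a s b t c w where xyz: "x = (a, s)" "y = (b, t)" "z = (c, w)"
      by (metis surj_pair)
    note 1 = xy[unfolded xyz fraction_rel_iff] and 2 = yz[unfolded xyz fraction_rel_iff]
    obtain u where u: "u \<in> S" "u \<otimes> (t \<otimes> a) = u \<otimes> (s \<otimes> b)" using 1 by blast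
    obtain v where v: "v \<in> S" "v \<otimes> (w \<otimes> b) = v \<otimes> (t \<otimes> c)" using 2 by blast
    have cl: "a \<in> carrier R" "b \<in> carrier R" "c \<in> carrier R" "s \<in> carrier R" "t \<in> carrier R" "w \<in> carrier R"
      "u \<in> carrier R" "v \<in> carrier R"
      using 1 2 u(1) v(1) S_carrier by auto
    \<comment> \<open>The middle denominator \<open>t\<close> cannot be cancelled when it is a
      zerodivisor, so it becomes part of the multiplier.\<close>
    have "(u \<otimes> v \<otimes> t) \<otimes> (w \<otimes> a) = v \<otimes> w \<otimes> (u \<otimes> (t \<otimes> a))"
      using cl by (simp add: m_ac)
    also have "\<dots> = u \<otimes> s \<otimes> (v \<otimes> (w \<otimes> b))"
      unfolding u(2) using cl by (simp add: m_ac)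
    also have "\<dots> = (u \<otimes> v \<otimes> t) \<otimes> (s \<otimes> c)"
      unfolding v(2) using cl by (simp add: m_ac)
    finally have "(u \<otimes> v \<otimes> t) \<otimes> (w \<otimes> a) = (u \<otimes> v \<otimes> t) \<otimes> (s \<otimes> c)" .
    moreover have "u \<otimes> v \<otimes> t \<in> S"
      using u(1) v(1) 1 S_mult by blast
    ultimately show "(x, z) \<in> fraction_rel R S"
      unfolding xyz fraction_rel_iff using 1 2 by blast
  qed
qed

lemma fraction_eq_iff:
  assumes "a \<in> carrier R" "s \<in> S" "b \<in> carrier R" "t \<in> S"
  shows "fraction R S a s = fraction R S b t \<longleftrightarrow> (\<exists>u\<in>S. u \<otimes> (t \<otimes> a) = u \<otimes> (s \<otimes> b))"
  unfolding fraction_def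
  using eq_equiv_class_iff[OF equiv_fraction_rel, of "(a, s)" "(b, t)"] assms
  by (simp add: fraction_rel_iff)

lemma mem_fraction:
  assumes "a \<in> carrier R" "s \<in> S"
  shows "(b, t) \<in> fraction R S a s \<longleftrightarrow> b \<in> carrier R \<and> t \<in> S \<and> fraction R S b t = fraction R S a s"
proof
  assume "(b, t) \<in> fraction R S a s"
  then have *: "((a, s), (b, t)) \<in> fraction_rel R S"
    by (simp add: fraction_def)
  then show "b \<in> carrier R \<and> t \<in> S \<and> fraction R S b t = fraction R S a s"
    using equiv_class_eq[OF equiv_fraction_rel *] by (simp add: fraction_def fraction_rel_iff)
next
  assume *: "b \<in> carrier R \<and> t \<in> S \<and> fraction R S b t = fraction R S a s"
  then have "((b, t), (b, t)) \<in> fraction_rel R S"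
    unfolding fraction_rel_iff using S_one by blast
  then have "(b, t) \<in> fraction R S b t"
    by (simp add: fraction_def)
  then show "(b, t) \<in> fraction R S a s" using * by simp
qed

lemma carrier_localization:
  "F \<in> carrier (localization R S) \<longleftrightarrow> (\<exists>a\<in>carrier R. \<exists>s\<in>S. F = fraction R S a s)"
  by (auto simp: localization_def quotient_def fraction_def)

lemma fraction_mult_cong:
  assumes "a \<in> carrier R" "s \<in> S" "b \<in> carrier R" "t \<in> S"
    and "a' \<in> carrier R" "s' \<in> S" "b' \<in> carrier R" "t' \<in> S"
    and eq: "fraction R S a' s' = fraction R S a s" "fraction R S b' t' = fraction R S b t"
  shows "fraction R S (a' \<otimes> b') (s' \<otimes> t') = fraction R S (a \<otimes> b) (s \<otimes> t)"
proof -
  obtain u where u: "u \<in> S" "u \<otimes> (s \<otimes> a') = u \<otimes> (s' \<otimes> a)"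
    using eq(1) assms by (auto simp: fraction_eq_iff)
  obtain v where v: "v \<in> S" "v \<otimes> (t \<otimes> b') = v \<otimes> (t' \<otimes> b)"
    using eq(2) assms by (auto simp: fraction_eq_iff)
  have cl: "s \<in> carrier R" "t \<in> carrier R" "s' \<in> carrier R" "t' \<in> carrier R" "u \<in> carrier R" "v \<in> carrier R"
    using assms u v S_carrier by auto
  have "u \<otimes> v \<otimes> (s \<otimes> t \<otimes> (a' \<otimes> b')) = (u \<otimes> (s \<otimes> a')) \<otimes> (v \<otimes> (t \<otimes> b'))"
    using cl assms by (simp add: m_ac)
  also have "\<dots> = u \<otimes> v \<otimes> (s' \<otimes> t' \<otimes> (a \<otimes> b))"
    unfolding u(2) v(2) using cl assms by (simp add: m_ac)
  finally show ?thesis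
    using assms u v S_mult by (subst fraction_eq_iff) auto
qed

lemma fraction_add_cong:
  assumes "a \<in> carrier R" "s \<in> S" "b \<in> carrier R" "t \<in> S"
    and "a' \<in> carrier R" "s' \<in> S" "b' \<in> carrier R" "t' \<in> S"
    and eq: "fraction R S a' s' = fraction R S a s" "fraction R S b' t' = fraction R S b t"
  shows "fraction R S (t' \<otimes> a' \<oplus> s' \<otimes> b') (s' \<otimes> t') = fraction R S (t \<otimes> a \<oplus> s \<otimes> b) (s \<otimes> t)"
proof -
  obtain u where u: "u \<in> S" "u \<otimes> (s \<otimes> a') = u \<otimes> (s' \<otimes> a)"
    using eq(1) assms by (auto simp: fraction_eq_iff)
  obtain v where v: "v \<in> S" "v \<otimes> (t \<otimes> b') = v \<otimes> (t' \<otimes> b)"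
    using eq(2) assms by (auto simp: fraction_eq_iff)
  have cl: "s \<in> carrier R" "t \<in> carrier R" "s' \<in> carrier R" "t' \<in> carrier R" "u \<in> carrier R" "v \<in> carrier R"
    using assms u v S_carrier by auto
  have "u \<otimes> v \<otimes> (s \<otimes> t \<otimes> (t' \<otimes> a' \<oplus> s' \<otimes> b'))
      = (v \<otimes> t \<otimes> t') \<otimes> (u \<otimes> (s \<otimes> a')) \<oplus> (u \<otimes> s \<otimes> s') \<otimes> (v \<otimes> (t \<otimes> b'))"
    using cl assms by (simp add: m_ac r_distr l_distr)
  also have "\<dots> = u \<otimes> v \<otimes> (s' \<otimes> t' \<otimes> (t \<otimes> a \<oplus> s \<otimes> b))"
    unfolding u(2) v(2) using cl assms by (simp add: m_ac r_distr l_distr)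
  finally show ?thesis
    using assms u v cl S_mult by (subst fraction_eq_iff) auto
qed

lemma localization_mult:
  assumes "a \<in> carrier R" "s \<in> S" "b \<in> carrier R" "t \<in> S"
  shows "fraction R S a s \<otimes>\<^bsub>localization R S\<^esub> fraction R S b t = fraction R S (a \<otimes> b) (s \<otimes> t)"
proof -
  have "(\<Union>p\<in>fraction R S a s. \<Union>q\<in>fraction R S b t. fraction R S (fst p \<otimes> fst q) (snd p \<otimes> snd q))
    = fraction R S (a \<otimes> b) (s \<otimes> t)"
  proof (rule UN_UN_const)
    show "(a, s) \<in> fraction R S a s" "(b, t) \<in> fraction R S b t"
      using mem_fraction assms by blast+
    fix p q assume pq: "p \<in> fraction R S a s" "q \<in> fraction R S b t"
    have p: "fst p \<in> carrier R" "snd p \<in> S" "fraction R S (fst p) (snd p) = fraction R S a s"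
      using pq(1) mem_fraction[OF assms(1,2), of "fst p" "snd p"] by simp_all
    have q: "fst q \<in> carrier R" "snd q \<in> S" "fraction R S (fst q) (snd q) = fraction R S b t"
      using pq(2) mem_fraction[OF assms(3,4), of "fst q" "snd q"] by simp_all
    show "fraction R S (fst p \<otimes> fst q) (snd p \<otimes> snd q) = fraction R S (a \<otimes> b) (s \<otimes> t)"
      by (rule fraction_mult_cong[OF assms p(1,2) q(1,2) p(3) q(3)])
  qed
  then show ?thesis
    by (simp add: localization_def case_prod_beta)
qed

lemma localization_add:
  assumes "a \<in> carrier R" "s \<in> S" "b \<in> carrier R" "t \<in> S"
  shows "fraction R S a s \<oplus>\<^bsub>localization R S\<^esub> fraction R S b t = fraction R S (t \<otimes> a \<oplus> s \<otimes> b) (s \<otimes> t)"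
proof -
  have "(\<Union>p\<in>fraction R S a s. \<Union>q\<in>fraction R S b t. fraction R S (snd q \<otimes> fst p \<oplus> snd p \<otimes> fst q) (snd p \<otimes> snd q))
    = fraction R S (t \<otimes> a \<oplus> s \<otimes> b) (s \<otimes> t)"
  proof (rule UN_UN_const)
    show "(a, s) \<in> fraction R S a s" "(b, t) \<in> fraction R S b t"
      using mem_fraction assms by blast+
    fix p q assume pq: "p \<in> fraction R S a s" "q \<in> fraction R S b t"
    have p: "fst p \<in> carrier R" "snd p \<in> S" "fraction R S (fst p) (snd p) = fraction R S a s"
      using pq(1) mem_fraction[OF assms(1,2), of "fst p" "snd p"] by simp_all
    have q: "fst q \<in> carrier R" "snd q \<in> S" "fraction R S (fst q) (snd q) = fraction R S b t"
      using pq(2) mem_fraction[OF assms(3,4), of "fst q" "snd q"] by simp_all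
    show "fraction R S (snd q \<otimes> fst p \<oplus> snd p \<otimes> fst q) (snd p \<otimes> snd q) = fraction R S (t \<otimes> a \<oplus> s \<otimes> b) (s \<otimes> t)"
      by (rule fraction_add_cong[OF assms p(1,2) q(1,2) p(3) q(3)])
  qed
  then show ?thesis
    by (simp add: localization_def case_prod_beta)
qed

lemma localization_one_zero:
  "\<one>\<^bsub>localization R S\<^esub> = fraction R S \<one> \<one>" "\<zero>\<^bsub>localization R S\<^esub> = fraction R S \<zero> \<one>"
  by (simp_all add: localization_def)

end

lemma (in cring) mult_subset_nonzerodivisors: "mult_subset R (nonzerodivisors R)"
proof
  fix s t assume s: "s \<in> nonzerodivisors R" and t: "t \<in> nonzerodivisors R"
  have st: "s \<in> carrier R" "t \<in> carrier R"
    using s t by (simp_all add: nonzerodivisors_def)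
  have "x = \<zero>" if x: "x \<in> carrier R" "s \<otimes> t \<otimes> x = \<zero>" for x
  proof -
    have "t \<otimes> x = \<zero>"
    proof -
      have "s \<otimes> (t \<otimes> x) = \<zero>" "t \<otimes> x \<in> carrier R"
        using x st by (simp_all add: m_assoc[symmetric])
      then show ?thesis
        using s unfolding nonzerodivisors_def by blast
    qed
    then show ?thesis
      using t x by (simp add: nonzerodivisors_def)
  qed
  then show "s \<otimes> t \<in> nonzerodivisors R"
    using st by (simp add: nonzerodivisors_def)
qed (auto simp: nonzerodivisors_def)

lemma (in cring) mult_subset_Compl_maximal:
  assumes "maximalideal M R"
  shows "mult_subset R (carrier R - M)"
proof -
  interpret M: primeideal M R using assms by (rule maximalideal_prime)
  have "\<one> \<notin> M" using M.one_imp_carrier M.I_notcarr by blast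
  then show ?thesis
    by unfold_locales (use M.I_prime in auto)
qed

text \<open>
  The element \<open>e\<close> is an idempotent cutting out the factor \<open>S\<close> of a product: inverting the complement
  of a maximal ideal that avoids \<open>e\<close> kills the other factors.
\<close>

lemma (in surj_ring_hom) localization_regular_local:
  assumes m: "local_with S m" and M: "maximalideal M R" and e: "e \<in> carrier R" "e \<notin> M"
    and ann: "\<And>b. b \<in> carrier R \<Longrightarrow> h b = \<zero>\<^bsub>S\<^esub> \<Longrightarrow> e \<otimes> b = \<zero>"
    and noeth: "noetherian_ring S" and G: "m = Idl\<^bsub>S\<^esub> G" "finite G" "G \<subseteq> carrier S" "enat (card G) = krull_dim S"
  shows "regular_local_ring (localization R (carrier R - M))"
proof -
  define C where "C = carrier R - M"
  define L where "L = localization R C"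
  interpret M: maximalideal M R by fact
  interpret mult_subset R C
    unfolding C_def using M by (rule R.mult_subset_Compl_maximal)
  have eC: "e \<in> C" using e by (simp add: C_def)
  have m': "ideal m S" "\<one>\<^bsub>S\<^esub> \<notin> m" "carrier S - m \<subseteq> Units S"
    using m by (auto simp: local_with_def)
  \<comment> \<open>Elements with the same image in \<open>S\<close> agree after multiplication by
    \<open>e\<close>; as \<open>e\<close> lies outside \<open>M\<close>, they define the same
    fraction.\<close>
  have kill: "e \<otimes> b = e \<otimes> c" if bc: "b \<in> carrier R" "c \<in> carrier R" "h b = h c" for b c
  proof -
    have "h (b \<ominus> c) = \<zero>\<^bsub>S\<^esub>" using bc by (simp add: a_minus_def S.r_neg)
    then have "e \<otimes> (b \<ominus> c) = \<zero>" using ann[of "b \<ominus> c"] bc by simp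
    then have "e \<otimes> b \<ominus> e \<otimes> c = \<zero>" using bc e by (simp add: a_minus_def R.r_distr R.r_minus)
    then show ?thesis using bc e by simp
  qed
  \<comment> \<open>The ideals \<open>M\<close> and \<open>(s)\<close> are comaximal,
    \<open>1 = \<mu> + t s\<close>. If \<open>h s\<close> were a nonunit it would lie in
    \<open>m\<close>, so \<open>h \<mu>\<close> would be a unit, and lifting its inverse to
    \<open>v\<close> gives \<open>e = \<mu> e v\<close> in \<open>M\<close>.\<close>
  have units: "h s \<in> Units S" if s: "s \<in> C" for s
  proof (rule ccontr)
    assume nu: "h s \<notin> Units S"
    have sc: "s \<in> carrier R" "s \<notin> M" using s by (auto simp: C_def)
    have Ms: "ideal (M <+> PIdl s) R"
      by (intro R.add_ideals M.is_ideal R.cgenideal_ideal sc)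
    have sub: "M \<subseteq> M <+> PIdl s"
    proof
      fix x assume x: "x \<in> M"
      then have "x = x \<oplus> \<zero> \<otimes> s" using sc M.a_Hcarr by simp
      then show "x \<in> M <+> PIdl s" using x by (auto simp: set_add_def' cgenideal_def)
    qed
    have Msc: "M <+> PIdl s \<subseteq> carrier R"
      using ideal.Icarr[OF Ms] by blast
    have "M <+> PIdl s \<noteq> M"
    proof
      assume eq: "M <+> PIdl s = M"
      have "s = \<zero> \<oplus> \<one> \<otimes> s" using sc by simp
      then have "s \<in> M <+> PIdl s"
        unfolding set_add_def' cgenideal_def
        using additive_subgroup.zero_closed[OF M.is_additive_subgroup] R.one_closed by blast
      then show False using eq sc by simp
    qed
    then have "M <+> PIdl s = carrier R"
      using M.I_maximal[OF Ms sub Msc] by simp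
    then have "\<one> \<in> M <+> PIdl s" by simp
    then obtain \<mu> t where \<mu>: "\<mu> \<in> M" "t \<in> carrier R" "\<one> = \<mu> \<oplus> t \<otimes> s"
      by (auto simp: set_add_def' cgenideal_def)
    have \<mu>c: "\<mu> \<in> carrier R" using \<mu>(1) M.a_Hcarr by blast
    have "h s \<in> m" using nu m'(3) sc by auto
    then have "h t \<otimes>\<^bsub>S\<^esub> h s \<in> m" using ideal.I_l_closed[OF m'(1)] \<mu>(2) by simp
    moreover have one: "\<one>\<^bsub>S\<^esub> = h \<mu> \<oplus>\<^bsub>S\<^esub> h t \<otimes>\<^bsub>S\<^esub> h s"
      using arg_cong[OF \<mu>(3), of h] \<mu>c \<mu>(2) sc by simp
    ultimately have "h \<mu> \<notin> m"
      using m'(1,2) additive_subgroup.a_closed[OF ideal.axioms(1)[OF m'(1)]] by metis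
    then have "h \<mu> \<in> Units S" using m'(3) \<mu>c by auto
    then obtain w where w: "w \<in> carrier S" "h \<mu> \<otimes>\<^bsub>S\<^esub> w = \<one>\<^bsub>S\<^esub>" by (auto simp: Units_def)
    obtain v where v: "v \<in> carrier R" "w = h v" using w(1) by (rule surjE)
    have "e \<otimes> (\<mu> \<otimes> v) = e \<otimes> \<one>"
      using w(2) v \<mu>c by (intro kill) auto
    then have "e = \<mu> \<otimes> (e \<otimes> v)" using e \<mu>c v by (simp add: R.m_lcomm)
    moreover have "\<mu> \<otimes> (e \<otimes> v) \<in> M" using M.I_r_closed[OF \<mu>(1)] e v by simp
    ultimately show False using e by simp
  qed
  define g where "g = (\<lambda>r. SOME b. b \<in> carrier R \<and> h b = r)"
  have g: "g r \<in> carrier R" "h (g r) = r" if r: "r \<in> carrier S" for r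
  proof -
    have "\<exists>b. b \<in> carrier R \<and> h b = r" using surjE[OF r] by metis
    from someI_ex[OF this] show "g r \<in> carrier R" "h (g r) = r" unfolding g_def by blast+
  qed
  \<comment> \<open>By \<open>kill\<close> the fraction is the same for every preimage of
    \<open>r\<close>, so choosing one still yields a homomorphism.\<close>
  define \<phi> where "\<phi> = (\<lambda>r. fraction R C (g r) \<one>)"
  have frac_eq: "fraction R C b \<one> = fraction R C c \<one>" if bc: "b \<in> carrier R" "c \<in> carrier R" "h b = h c" for b c
    using kill[OF bc] bc eC S_one by (subst fraction_eq_iff) auto
  have \<phi>_eq: "\<phi> r = fraction R C b \<one>" if "b \<in> carrier R" "h b = r" for r b
    unfolding \<phi>_def using that g[of r] by (intro frac_eq) auto
  have iso: "\<phi> \<in> ring_iso S L"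
  proof (rule ring_iso_memI)
    show "\<phi> r \<in> carrier L" if "r \<in> carrier S" for r
      unfolding L_def carrier_localization \<phi>_def using g(1)[OF that] S_one by blast
    show "\<phi> (x \<otimes>\<^bsub>S\<^esub> y) = \<phi> x \<otimes>\<^bsub>L\<^esub> \<phi> y" if xy: "x \<in> carrier S" "y \<in> carrier S" for x y
    proof -
      have "\<phi> x \<otimes>\<^bsub>L\<^esub> \<phi> y = fraction R C (g x \<otimes> g y) (\<one> \<otimes> \<one>)"
        unfolding L_def \<phi>_def using g xy S_one by (intro localization_mult) auto
      also have "\<dots> = \<phi> (x \<otimes>\<^bsub>S\<^esub> y)"
        using g xy by (subst \<phi>_eq[of "g x \<otimes> g y"]) auto
      finally show ?thesis ..
    qed
    show "\<phi> (x \<oplus>\<^bsub>S\<^esub> y) = \<phi> x \<oplus>\<^bsub>L\<^esub> \<phi> y" if xy: "x \<in> carrier S" "y \<in> carrier S" for x y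
    proof -
      have "\<phi> x \<oplus>\<^bsub>L\<^esub> \<phi> y = fraction R C (\<one> \<otimes> g x \<oplus> \<one> \<otimes> g y) (\<one> \<otimes> \<one>)"
        unfolding L_def \<phi>_def using g xy S_one by (intro localization_add) auto
      also have "\<dots> = \<phi> (x \<oplus>\<^bsub>S\<^esub> y)"
        using g xy by (subst \<phi>_eq[of "g x \<oplus> g y"]) auto
      finally show ?thesis ..
    qed
    show "\<phi> \<one>\<^bsub>S\<^esub> = \<one>\<^bsub>L\<^esub>"
      unfolding L_def localization_one_zero by (rule \<phi>_eq) simp_all
    show "bij_betw \<phi> (carrier S) (carrier L)"
    proof (rule bij_betw_imageI)
      show "inj_on \<phi> (carrier S)"
      proof (rule inj_onI)
        fix x y assume xy: "x \<in> carrier S" "y \<in> carrier S" "\<phi> x = \<phi> y"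
        then obtain u where u: "u \<in> C" "u \<otimes> (\<one> \<otimes> g x) = u \<otimes> (\<one> \<otimes> g y)"
          using g S_one by (auto simp: \<phi>_def fraction_eq_iff)
        have uc: "u \<in> carrier R" using u(1) S_carrier by blast
        have "h u \<otimes>\<^bsub>S\<^esub> x = h u \<otimes>\<^bsub>S\<^esub> y"
          using arg_cong[OF u(2), of h] g xy uc by simp
        then show "x = y"
          using units[OF u(1)] xy by (simp add: S.Units_l_cancel)
      qed
      show "\<phi> ` carrier S = carrier L"
      proof
        show "\<phi> ` carrier S \<subseteq> carrier L"
          unfolding L_def \<phi>_def using g(1) S_one carrier_localization by blast
        show "carrier L \<subseteq> \<phi> ` carrier S"
        proof
          fix F assume "F \<in> carrier L"
          then obtain a s where F: "a \<in> carrier R" "s \<in> C" "F = fraction R C a s"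
            unfolding L_def carrier_localization by blast
          have sc: "s \<in> carrier R" using F(2) S_carrier by blast
          obtain w where w: "w \<in> carrier S" "h s \<otimes>\<^bsub>S\<^esub> w = \<one>\<^bsub>S\<^esub>"
            using units[OF F(2)] by (auto simp: Units_def)
          obtain v where v: "v \<in> carrier R" "w = h v" using w(1) by (rule surjE)
          have "h (s \<otimes> (a \<otimes> v)) = h a \<otimes>\<^bsub>S\<^esub> (h s \<otimes>\<^bsub>S\<^esub> w)"
            using sc F(1) v by (simp add: S.m_lcomm)
          then have "e \<otimes> (\<one> \<otimes> a) = e \<otimes> (s \<otimes> (a \<otimes> v))"
            unfolding w(2) using sc F(1) v by (intro kill) auto
          then have "F = fraction R C (a \<otimes> v) \<one>"
            unfolding F(3) using F(1,2) v S_one eC by (subst fraction_eq_iff) auto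
          also have "\<dots> = \<phi> (h (a \<otimes> v))"
            using F(1) v by (subst \<phi>_eq[of "a \<otimes> v"]) auto
          finally show "F \<in> \<phi> ` carrier S"
            using F(1) v by simp
        qed
      qed
    qed
  qed
  have "\<phi> \<zero>\<^bsub>S\<^esub> = \<zero>\<^bsub>L\<^esub>"
    unfolding L_def localization_one_zero by (rule \<phi>_eq) simp_all
  then have "cring L"
    using S.ring_iso_imp_img_cring[OF iso] by simp
  then have "ring_hom_cring S L \<phi>"
    using iso S.is_cring by (intro ring_hom_cringI ring_hom_ringI2) (auto simp: ring_iso_def cring.axioms)
  then interpret \<phi>: surj_ring_hom S L \<phi>
    using iso by (auto simp: surj_ring_hom_def surj_ring_hom_axioms_def ring_iso_def bij_betw_def)
  have "regular_local_ring L"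
    using iso m noeth G by (intro \<phi>.image_regular_local[where G = G]) (auto simp: ring_iso_def bij_betw_def)
  then show ?thesis by (simp add: L_def C_def)
qed

lemma RDirProd_simps:
  "carrier (RDirProd R S) = carrier R \<times> carrier S"
  "p \<otimes>\<^bsub>RDirProd R S\<^esub> q = (fst p \<otimes>\<^bsub>R\<^esub> fst q, snd p \<otimes>\<^bsub>S\<^esub> snd q)"
  "p \<oplus>\<^bsub>RDirProd R S\<^esub> q = (fst p \<oplus>\<^bsub>R\<^esub> fst q, snd p \<oplus>\<^bsub>S\<^esub> snd q)"
  "\<one>\<^bsub>RDirProd R S\<^esub> = (\<one>\<^bsub>R\<^esub>, \<one>\<^bsub>S\<^esub>)"
  "\<zero>\<^bsub>RDirProd R S\<^esub> = (\<zero>\<^bsub>R\<^esub>, \<zero>\<^bsub>S\<^esub>)"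
  by (simp_all add: RDirProd_def DirProd_def monoid.defs split_beta)

lemma RDirProd_cring:
  assumes "cring R" "cring S"
  shows "cring (RDirProd R S)"
proof -
  interpret R: cring R by fact
  interpret S: cring S by fact
  show ?thesis
    using RDirProd_ring[OF R.ring_axioms S.ring_axioms]
    by (intro cring.intro comm_monoid.intro comm_monoid_axioms.intro)
      (auto simp: ring_def RDirProd_simps R.m_comm S.m_comm)
qed

lemma RDirProd_fst:
  assumes "cring R" "cring S"
  shows "surj_ring_hom (RDirProd R S) R fst"
proof -
  interpret R: cring R by fact
  interpret S: cring S by fact
  interpret RS: cring "RDirProd R S" using assms by (rule RDirProd_cring)
  have "ring_hom_cring (RDirProd R S) R fst"
    by unfold_locales (auto simp: ring_hom_def RDirProd_simps)
  then show ?thesis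
    by (auto simp: surj_ring_hom_def surj_ring_hom_axioms_def RDirProd_simps image_iff)
qed

lemma RDirProd_snd:
  assumes "cring R" "cring S"
  shows "surj_ring_hom (RDirProd R S) S snd"
proof -
  interpret R: cring R by fact
  interpret S: cring S by fact
  interpret RS: cring "RDirProd R S" using assms by (rule RDirProd_cring)
  have "ring_hom_cring (RDirProd R S) S snd"
    by unfold_locales (auto simp: ring_hom_def RDirProd_simps)
  then show ?thesis
    by (auto simp: surj_ring_hom_def surj_ring_hom_axioms_def RDirProd_simps image_iff)
qed

text \<open>Multiplication by the idempotents \<open>(1, 0)\<close> and \<open>(0, 1)\<close> shows
  that an ideal is the product of its projections, so their generators, padded with zeros, generate
  it.\<close>

lemma RDirProd_noetherian:
  assumes R: "cring R" "noetherian_ring R" and S: "cring S" "noetherian_ring S"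
  shows "noetherian_ring (RDirProd R S)"
proof -
  let ?P = "RDirProd R S"
  interpret R: cring R by fact
  interpret S: cring S by fact
  interpret P: cring ?P using R(1) S(1) by (rule RDirProd_cring)
  interpret p: surj_ring_hom ?P R fst using R(1) S(1) by (rule RDirProd_fst)
  interpret q: surj_ring_hom ?P S snd using R(1) S(1) by (rule RDirProd_snd)
  show ?thesis
  proof (rule P.noetherian_ringI)
    fix I assume I: "ideal I ?P"
    interpret I: ideal I ?P by fact
    obtain A where A: "A \<subseteq> carrier R" "finite A" "fst ` I = Idl\<^bsub>R\<^esub> A"
      using noetherian_ring.finetely_gen[OF R(2) p.image_ideal[OF I]] by blast
    obtain B where B: "B \<subseteq> carrier S" "finite B" "snd ` I = Idl\<^bsub>S\<^esub> B"
      using noetherian_ring.finetely_gen[OF S(2) q.image_ideal[OF I]] by blast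
    define G where "G = (\<lambda>a. (a, \<zero>\<^bsub>S\<^esub>)) ` A \<union> (\<lambda>b. (\<zero>\<^bsub>R\<^esub>, b)) ` B"
    have G: "G \<subseteq> carrier ?P" "finite G"
      using A B by (auto simp: G_def RDirProd_simps)
    have fst0: "(a, \<zero>\<^bsub>S\<^esub>) \<in> L" if L: "ideal L ?P" "a \<in> fst ` L" for a L
    proof -
      interpret L: ideal L ?P by (rule L(1))
      obtain l where l: "a = fst l" "l \<in> L" using L(2) by (rule imageE)
      have "(\<one>\<^bsub>R\<^esub>, \<zero>\<^bsub>S\<^esub>) \<otimes>\<^bsub>?P\<^esub> l \<in> L"
        by (rule L.I_l_closed[OF l(2)]) (simp add: RDirProd_simps)
      then show ?thesis using l L.a_Hcarr[OF l(2)] by (auto simp: RDirProd_simps)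
    qed
    have snd0: "(\<zero>\<^bsub>R\<^esub>, b) \<in> L" if L: "ideal L ?P" "b \<in> snd ` L" for b L
    proof -
      interpret L: ideal L ?P by (rule L(1))
      obtain l where l: "b = snd l" "l \<in> L" using L(2) by (rule imageE)
      have "(\<zero>\<^bsub>R\<^esub>, \<one>\<^bsub>S\<^esub>) \<otimes>\<^bsub>?P\<^esub> l \<in> L"
        by (rule L.I_l_closed[OF l(2)]) (simp add: RDirProd_simps)
      then show ?thesis using l L.a_Hcarr[OF l(2)] by (auto simp: RDirProd_simps)
    qed
    have "A \<subseteq> fst ` I" "B \<subseteq> snd ` I"
      unfolding A(3) B(3) by (rule R.genideal_self[OF A(1)] S.genideal_self[OF B(1)])+
    then have "G \<subseteq> I"
      unfolding G_def using fst0[OF I] snd0[OF I] by blast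
    define J where "J = Idl\<^bsub>?P\<^esub> G"
    have GJ: "G \<subseteq> J" unfolding J_def using G(1) by (rule P.genideal_self)
    have J: "ideal J ?P" unfolding J_def using G(1) by (rule P.genideal_ideal)
    interpret J: ideal J ?P by fact
    have AB: "A \<subseteq> fst ` J" "B \<subseteq> snd ` J"
      using GJ by (force simp: G_def)+
    have 1: "fst ` I \<subseteq> fst ` J"
      unfolding A(3) by (rule R.genideal_minimal[OF p.image_ideal[OF J] AB(1)])
    have 2: "snd ` I \<subseteq> snd ` J"
      unfolding B(3) by (rule S.genideal_minimal[OF q.image_ideal[OF J] AB(2)])
    have "I \<subseteq> J"
    proof
      fix i assume i: "i \<in> I"
      have "(fst i, \<zero>\<^bsub>S\<^esub>) \<in> J" "(\<zero>\<^bsub>R\<^esub>, snd i) \<in> J"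
        using 1 2 i fst0[OF J] snd0[OF J] by blast+
      then have "(fst i, \<zero>\<^bsub>S\<^esub>) \<oplus>\<^bsub>?P\<^esub> (\<zero>\<^bsub>R\<^esub>, snd i) \<in> J"
        by (rule J.a_closed)
      then show "i \<in> J" using I.a_Hcarr[OF i] by (auto simp: RDirProd_simps)
    qed
    moreover have "J \<subseteq> I"
      unfolding J_def using I \<open>G \<subseteq> I\<close> by (rule P.genideal_minimal)
    ultimately show "\<exists>A\<subseteq>carrier ?P. finite A \<and> I = Idl\<^bsub>?P\<^esub> A"
      using G unfolding J_def by blast
  qed
qed


section \<open>Primes generated by variables\<close>

context cring
begin

definition restr :: "'v set \<Rightarrow> ('v multiset \<Rightarrow> 'a) \<Rightarrow> 'v multiset \<Rightarrow> 'a"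
  where "restr W f = (\<lambda>M. if set_mset M \<subseteq> W then f M else \<zero>)"

definition vanishing :: "'v set \<Rightarrow> 'v set \<Rightarrow> ('v multiset \<Rightarrow> 'a) set"
  where "vanishing V W = {f \<in> carrier (PS V). restr W f = (\<lambda>_. \<zero>)}"

lemma PS_mono: "W \<subseteq> V \<Longrightarrow> f \<in> carrier (PS W) \<Longrightarrow> f \<in> carrier (PS V)"
  unfolding PS_mem by blast

lemma restr_closed: "f \<in> carrier (PS V) \<Longrightarrow> restr W f \<in> carrier (PS (V \<inter> W))"
  by (auto simp: PS_mem restr_def)

lemma restr_closed' [simp]: "f \<in> carrier (PS V) \<Longrightarrow> restr W f \<in> carrier (PS V)"
  using restr_closed PS_mono by blast

lemma restr_id: "f \<in> carrier (PS V) \<Longrightarrow> V \<subseteq> W \<Longrightarrow> restr W f = f"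
  by (auto simp: PS_mem restr_def fun_eq_iff)

lemma restr_restr [simp]: "restr W (restr W' f) = restr (W \<inter> W') f"
  by (auto simp: restr_def fun_eq_iff)

lemma restr_zero [simp]: "restr W (\<lambda>_. \<zero>) = (\<lambda>_. \<zero>)"
  by (auto simp: restr_def)

lemma restr_one [simp]: "restr W (indexed_const \<one>) = indexed_const \<one>"
  by (auto simp: restr_def indexed_const_def)

lemma restr_conv:
  assumes f: "f \<in> carrier (PS V)" and g: "g \<in> carrier (PS V)"
  shows "restr W (f \<star> g) = restr W f \<star> restr W g"
proof
  fix M
  show "restr W (f \<star> g) M = (restr W f \<star> restr W g) M"
  proof (cases "set_mset M \<subseteq> W")
    case True
    then have "set_mset (fst p) \<subseteq> W" "set_mset (snd p) \<subseteq> W" if "p \<in> splits M" for p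
      using that by (auto simp: mem_splits)
    then show ?thesis
      using True PS_coeff[OF f] PS_coeff[OF g] unfolding conv_def
      by (auto simp: restr_def intro!: finsum_cong')
  next
    case False
    have "restr W f \<star> restr W g \<in> carrier (PS (V \<inter> W))"
      using f g by (intro PS_conv_closed restr_closed)
    then show ?thesis
      using False by (auto simp: restr_def PS_mem)
  qed
qed

lemma restr_add [simp]:
  assumes "f \<in> carrier (PS V)" "g \<in> carrier (PS V)"
  shows "restr W (f \<oplus>\<^bsub>PS V\<^esub> g) = restr W f \<oplus>\<^bsub>PS V\<^esub> restr W g"
  using assms by (auto simp: restr_def PS_ops)

lemma restr_hom:
  assumes "W \<subseteq> V"
  shows "surj_ring_hom (PS V) (PS W) (restr W)"
proof (intro surj_ring_hom.intro surj_ring_hom_axioms.intro)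
  have VW: "V \<inter> W = W" using assms by blast
  have "restr W \<in> ring_hom (PS V) (PS W)"
  proof (rule ring_hom_memI)
    show "restr W f \<in> carrier (PS W)" if "f \<in> carrier (PS V)" for f
      using restr_closed[OF that, of W] VW by simp
    show "restr W (f \<otimes>\<^bsub>PS V\<^esub> g) = restr W f \<otimes>\<^bsub>PS W\<^esub> restr W g" if "f \<in> carrier (PS V)" "g \<in> carrier (PS V)" for f g
      using restr_conv[OF that] by (simp add: PS_ops)
    show "restr W (f \<oplus>\<^bsub>PS V\<^esub> g) = restr W f \<oplus>\<^bsub>PS W\<^esub> restr W g" if "f \<in> carrier (PS V)" "g \<in> carrier (PS V)" for f g
      using restr_add[OF that] by (simp add: PS_ops)
  qed (simp add: PS_ops)
  then show "ring_hom_cring (PS V) (PS W) (restr W)"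
    by (rule ring_hom_cringI[OF PS_cring PS_cring])
  show "restr W ` carrier (PS V) = carrier (PS W)"
  proof
    show "restr W ` carrier (PS V) \<subseteq> carrier (PS W)"
      using restr_closed[of _ V W] VW by auto
    show "carrier (PS W) \<subseteq> restr W ` carrier (PS V)"
    proof
      fix f assume f: "f \<in> carrier (PS W)"
      then have "f = restr W f" by (simp add: restr_id)
      then show "f \<in> restr W ` carrier (PS V)" using PS_mono[OF assms f] by (rule image_eqI)
    qed
  qed
qed

lemma vanishing_Ker:
  assumes "W \<subseteq> V"
  shows "vanishing V W = a_kernel (PS V) (PS W) (restr W)"
  by (simp add: vanishing_def a_kernel_def' PS_ops)

lemma vanishing_ideal:
  assumes "W \<subseteq> V"
  shows "ideal (vanishing V W) (PS V)"
proof -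
  interpret h: surj_ring_hom "PS V" "PS W" "restr W" using assms by (rule restr_hom)
  show ?thesis
    unfolding vanishing_Ker[OF assms]
    by (intro ring_hom_ring.kernel_is_ideal ring_hom_ringI2 h.R.ring_axioms h.S.ring_axioms h.homh)
qed

lemma vanishing_minus:
  assumes "W \<subseteq> V" "f \<in> carrier (PS V)" "g \<in> carrier (PS V)"
  shows "f \<ominus>\<^bsub>PS V\<^esub> g \<in> vanishing V W \<longleftrightarrow> restr W f = restr W g"
proof -
  interpret h: surj_ring_hom "PS V" "PS W" "restr W" using assms(1) by (rule restr_hom)
  have "restr W (f \<ominus>\<^bsub>PS V\<^esub> g) = restr W f \<ominus>\<^bsub>PS W\<^esub> restr W g"
    using assms by (simp add: a_minus_def del: restr_add)
  then show ?thesis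
    unfolding vanishing_Ker[OF assms(1)] h.Ker_iff using assms
    by (simp add: h.S.r_right_minus_eq)
qed

lemma indexed_var_alt: "indexed_var v = (\<lambda>M. if M = {#v#} then \<one> else \<zero>)"
proof
  fix M
  show "indexed_var v M = (if M = {#v#} then \<one> else \<zero>)"
    unfolding indexed_var_def indexed_pmult_def indexed_const_def
    by (cases "v \<in># M") (auto dest!: multi_member_split)
qed

lemma indexed_var_closed [simp]: "v \<in> V \<Longrightarrow> indexed_var v \<in> carrier (PS V)"
  by (auto simp: PS_mem indexed_var_alt)

lemma restr_var: "restr W (indexed_var v) = (if v \<in> W then indexed_var v else (\<lambda>_. \<zero>))"
  by (auto simp: restr_def indexed_var_alt fun_eq_iff)

lemma var_conv:
  assumes g: "\<And>M. g M \<in> carrier R"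
  shows "(indexed_var v \<star> g) M = (if v \<in># M then g (M - {#v#}) else \<zero>)"
proof (cases "v \<in># M")
  case True
  have "(indexed_var v \<star> g) M = indexed_var v (fst ({#v#}, M - {#v#})) \<otimes> g (snd ({#v#}, M - {#v#}))"
    unfolding conv_def
  proof (rule finsum_single[where f = "\<lambda>p. indexed_var v (fst p) \<otimes> g (snd p)"])
    fix p assume p: "p \<in> splits M" "p \<noteq> ({#v#}, M - {#v#})"
    then have "fst p \<noteq> {#v#}"
      by (cases p) (auto simp: mem_splits)
    then show "indexed_var v (fst p) \<otimes> g (snd p) = \<zero>"
      using g by (simp add: indexed_var_alt)
  qed (use True g in \<open>auto simp: mem_splits indexed_var_alt\<close>)
  then show ?thesis using True g by (simp add: indexed_var_alt)
next
  case False
  have "(indexed_var v \<star> g) M = \<zero>"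
    unfolding conv_def
  proof (rule add.finprod_one_eqI)
    fix p assume "p \<in> splits M"
    then have "fst p \<noteq> {#v#}" using False by (auto simp: mem_splits)
    then show "indexed_var v (fst p) \<otimes> g (snd p) = \<zero>"
      using g by (simp add: indexed_var_alt)
  qed
  then show ?thesis using False by simp
qed

text \<open>The monomials containing \<open>v\<close> are collected in a multiple of the variable
  \<open>v\<close>; the rest does not involve \<open>v\<close> and is handled by the smaller set
  \<open>D\<close>.\<close>

lemma supported_in_Idl:
  assumes "finite D" "D \<subseteq> V" "f \<in> carrier (PS V)" "\<And>M. set_mset M \<inter> D = {} \<Longrightarrow> f M = \<zero>"
  shows "f \<in> Idl\<^bsub>PS V\<^esub> (indexed_var ` D)"
  using assms
proof (induction D arbitrary: f)
  case empty
  interpret T: cring "PS V" by (rule PS_cring)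
  have "f = \<zero>\<^bsub>PS V\<^esub>" using empty by (auto simp: PS_ops)
  then show ?case
    using additive_subgroup.zero_closed[OF ideal.axioms(1)[OF T.genideal_ideal[of "{}"]]] by simp
next
  case (insert v D)
  interpret T: cring "PS V" by (rule PS_cring)
  define J where "J = Idl\<^bsub>PS V\<^esub> (indexed_var ` insert v D)"
  have vars: "indexed_var ` insert v D \<subseteq> carrier (PS V)" using insert.prems by auto
  interpret J: ideal J "PS V" unfolding J_def using vars by (rule T.genideal_ideal)
  have varsJ: "indexed_var ` insert v D \<subseteq> J" unfolding J_def using vars by (rule T.genideal_self)
  define g where "g = (\<lambda>M. f (add_mset v M))"
  define k where "k = restr (- {v}) f"
  have g: "g \<in> carrier (PS V)" using insert.prems by (auto simp: PS_mem g_def)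
  have k: "k \<in> carrier (PS V)" using insert.prems by (simp add: k_def)
  have "f M = (indexed_var v \<star> g) M \<oplus> k M" for M
    using PS_coeff[OF g] PS_coeff[OF insert.prems(2)]
    by (cases "v \<in># M") (auto simp: var_conv g_def k_def restr_def)
  then have f_eq: "f = indexed_var v \<otimes>\<^bsub>PS V\<^esub> g \<oplus>\<^bsub>PS V\<^esub> k"
    by (simp add: PS_ops fun_eq_iff)
  have "k \<in> Idl\<^bsub>PS V\<^esub> (indexed_var ` D)"
  proof (rule insert.IH[OF _ k])
    show "D \<subseteq> V" using insert.prems by simp
    fix M assume "set_mset M \<inter> D = {}"
    then show "k M = \<zero>"
      using insert.prems(3)[of M] by (auto simp: k_def restr_def)
  qed
  moreover have "Idl\<^bsub>PS V\<^esub> (indexed_var ` D) \<subseteq> J"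
    using J.is_ideal varsJ by (intro T.genideal_minimal) auto
  moreover have "indexed_var v \<otimes>\<^bsub>PS V\<^esub> g \<in> J"
    using varsJ g by (intro J.I_r_closed) auto
  ultimately show ?case
    unfolding J_def[symmetric] f_eq using J.a_closed by blast
qed

theorem Idl_vars_eq_vanishing:
  assumes "finite D" "D \<subseteq> V"
  shows "Idl\<^bsub>PS V\<^esub> (indexed_var ` D) = vanishing V (V - D)"
proof
  interpret T: cring "PS V" by (rule PS_cring)
  show "Idl\<^bsub>PS V\<^esub> (indexed_var ` D) \<subseteq> vanishing V (V - D)"
    using assms by (intro T.genideal_minimal vanishing_ideal) (auto simp: vanishing_def restr_var)
  show "vanishing V (V - D) \<subseteq> Idl\<^bsub>PS V\<^esub> (indexed_var ` D)"
  proof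
    fix f assume f: "f \<in> vanishing V (V - D)"
    then have fc: "f \<in> carrier (PS V)" and f0: "\<And>M. restr (V - D) f M = \<zero>"
      by (simp_all add: vanishing_def)
    show "f \<in> Idl\<^bsub>PS V\<^esub> (indexed_var ` D)"
    proof (rule supported_in_Idl[OF assms fc])
      fix M assume M: "set_mset M \<inter> D = {}"
      show "f M = \<zero>"
      proof (cases "set_mset M \<subseteq> V")
        case True
        then have "set_mset M \<subseteq> V - D" using M by blast
        then show ?thesis using f0[of M] by (simp add: restr_def)
      qed (use fc in \<open>simp add: PS_mem\<close>)
    qed
  qed
qed

lemma vanishing_mono: "W \<subseteq> W' \<Longrightarrow> vanishing V W' \<subseteq> vanishing V W"
  unfolding vanishing_def using restr_restr[of W W'] by (auto simp: Int_absorb2 dest: arg_cong[of _ _ "restr W"])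

end

context domain
begin

lemma vanishing_prime:
  assumes "(W :: 'v::countable set) \<subseteq> V"
  shows "primeideal (vanishing V W) (PS V)"
proof -
  interpret h: surj_ring_hom "PS V" "PS W" "restr W" using assms by (rule restr_hom)
  interpret W: domain "PS W" by (rule PS_domain)
  have "vanishing V W = h.preim {\<zero>\<^bsub>PS W\<^esub>}"
    unfolding vanishing_Ker[OF assms] by (auto simp: h.preim_def h.Ker_iff)
  then show ?thesis using h.preim_prime[OF W.zeroprimeideal] by simp
qed

lemma vanishing_mono_iff:
  assumes "W \<subseteq> V"
  shows "vanishing V W' \<subseteq> vanishing V W \<longleftrightarrow> W \<subseteq> W'"
proof -
  have "W \<subseteq> W'" if sub: "vanishing V W' \<subseteq> vanishing V W"
  proof
    fix v assume v: "v \<in> W"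
    show "v \<in> W'"
    proof (rule ccontr)
      assume "v \<notin> W'"
      then have "indexed_var v \<in> vanishing V W'" using v assms by (auto simp: vanishing_def restr_var)
      then have "indexed_var v \<in> vanishing V W" using sub by blast
      then have "indexed_var v {#v#} = \<zero>" using v by (simp add: vanishing_def restr_var)
      then show False by (simp add: indexed_var_alt)
    qed
  qed
  then show ?thesis using vanishing_mono by blast
qed

lemma vanishing_chain:
  assumes "finite D" "D \<subseteq> W" "(W :: 'v::countable set) \<subseteq> V"
  shows "\<exists>c. prime_chain (PS V) c (card D) \<and> c 0 = vanishing V W \<and> c (card D) = vanishing V (W - D)"
  using assms
proof (induction D)
  case empty
  show ?case
    using vanishing_prime[OF empty(2)] by (intro exI[of _ "\<lambda>_. vanishing V W"]) (simp add: prime_chain_def)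
next
  case (insert v D)
  obtain c where c: "prime_chain (PS V) c (card D)" "c 0 = vanishing V W" "c (card D) = vanishing V (W - D)"
    using insert by auto
  define c' where "c' = (\<lambda>i. if i \<le> card D then c i else vanishing V (W - insert v D))"
  have prime: "primeideal (vanishing V (W - insert v D)) (PS V)"
    using insert.prems by (intro vanishing_prime) auto
  have "\<not> vanishing V (W - insert v D) \<subseteq> vanishing V (W - D)"
    using insert.prems insert.hyps vanishing_mono_iff[of "W - D" V "W - insert v D"] by auto
  moreover have "vanishing V (W - D) \<subseteq> vanishing V (W - insert v D)"
    by (intro vanishing_mono) auto
  ultimately have step: "vanishing V (W - D) \<subset> vanishing V (W - insert v D)" by blast
  have "prime_chain (PS V) c' (card (insert v D))"
    using c prime step insert.hyps
    by (auto simp: prime_chain_def c'_def le_Suc_eq less_Suc_eq)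
  then show ?case
    using c insert.hyps by (intro exI[of _ c']) (auto simp: c'_def)
qed

end

lemma prime_chain_append:
  assumes c: "prime_chain R c n" and d: "prime_chain R d k" and le: "c n \<subseteq> d 0"
  shows "\<exists>e. prime_chain R e (n + k)"
proof -
  define e where "e = (\<lambda>i. if i \<le> n then c i else d (i - n))"
  have "primeideal (e i) R" if "i \<le> n + k" for i
    using c d that by (auto simp: e_def prime_chain_def)
  moreover have "e i \<subset> e (Suc i)" if "i < n + k" for i
  proof (cases i n rule: linorder_cases)
    case less
    then show ?thesis using c by (auto simp: e_def prime_chain_def)
  next
    case equal
    then have "k > 0" using that by simp
    then have "d 0 \<subset> d (Suc 0)" using d by (simp add: prime_chain_def)
    then show ?thesis using le equal by (auto simp: e_def)
  next
    case greater
    then have "d (i - n) \<subset> d (Suc (i - n))" using d that by (simp add: prime_chain_def)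
    then show ?thesis using greater by (simp add: e_def Suc_diff_le)
  qed
  ultimately show ?thesis by (auto simp: prime_chain_def)
qed

context field
begin

text \<open>Up to \<open>vanishing V W\<close> there is a chain of \<open>card (V - W)\<close> steps
  starting from zero. Joined with the given chain it must still obey the bound
  \<open>card V\<close>.\<close>

lemma chain_above_vanishing:
  assumes V: "finite (V :: 'v::countable set)" and W: "W \<subseteq> V"
    and c: "prime_chain (PS V) c n" "vanishing V W \<subseteq> c 0"
  shows "n \<le> card W"
proof -
  obtain d where d: "prime_chain (PS V) d (card (V - W))" "d (card (V - W)) = vanishing V (V - (V - W))"
    using vanishing_chain[of "V - W" V V] V by auto
  have "V - (V - W) = W" using W by blast
  then obtain e where "prime_chain (PS V) e (card (V - W) + n)"
    using prime_chain_append[OF d(1) c(1)] d(2) c(2) by auto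
  then have "card (V - W) + n \<le> card V"
    using PS_prime_chain_length[OF V] by blast
  moreover have "card V = card (V - W) + card W"
    using V W card_Diff_subset[of W V] card_mono[OF V W] finite_subset[OF W V] by simp
  ultimately show ?thesis by simp
qed

text \<open>A chain of primes above \<open>I\<close> starts above some \<open>vanishing V W\<close>,
  so it has at most \<open>d\<close> steps; removing the variables of \<open>W\<close> one at a time
  attains this.\<close>

lemma krull_dim_quotient:
  assumes V: "finite (V :: 'v::countable set)" and I: "ideal I (PS V)"
    and Ws: "Ws \<noteq> {}" "\<And>W. W \<in> Ws \<Longrightarrow> W \<subseteq> V \<and> card W = d \<and> I \<subseteq> vanishing V W"
    and cover: "\<And>P. primeideal P (PS V) \<Longrightarrow> I \<subseteq> P \<Longrightarrow> \<exists>W\<in>Ws. vanishing V W \<subseteq> P"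
  shows "krull_dim (PS V Quot I) = enat d"
proof -
  interpret T: domain "PS V" by (rule PS_domain)
  interpret I: ideal I "PS V" by fact
  interpret h: surj_ring_hom "PS V" "PS V Quot I" "(+>\<^bsub>PS V\<^esub>) I"
    by (rule I.quot_surj_hom[OF T.is_cring])
  have "Sup {enat n | n. \<exists>c. prime_chain (PS V) c n \<and> I \<subseteq> c 0} = enat d"
  proof (rule antisym)
    show "Sup {enat n | n. \<exists>c. prime_chain (PS V) c n \<and> I \<subseteq> c 0} \<le> enat d"
    proof (rule Sup_least)
      fix x assume "x \<in> {enat n | n. \<exists>c. prime_chain (PS V) c n \<and> I \<subseteq> c 0}"
      then obtain n c where c: "x = enat n" "prime_chain (PS V) c n" "I \<subseteq> c 0" by blast
      then have "primeideal (c 0) (PS V)" by (simp add: prime_chain_def)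
      then obtain W where W: "W \<in> Ws" "vanishing V W \<subseteq> c 0" using cover c(3) by blast
      then have "n \<le> card W" using chain_above_vanishing[OF V _ c(2)] Ws(2) by blast
      then show "x \<le> enat d" using c(1) Ws(2)[OF W(1)] by simp
    qed
    obtain W where W: "W \<in> Ws" using Ws(1) by blast
    note W' = Ws(2)[OF W]
    obtain c where c: "prime_chain (PS V) c (card W)" "c 0 = vanishing V W"
      using vanishing_chain[of W W V] W' finite_subset[OF _ V] by blast
    show "enat d \<le> Sup {enat n | n. \<exists>c. prime_chain (PS V) c n \<and> I \<subseteq> c 0}"
      using c W' by (intro Sup_upper) auto
  qed
  then show ?thesis
    unfolding h.krull_dim_image I.quot_Ker[OF T.is_cring] .
qed

text \<open>\<open>vanishing V {}\<close> consists of the series with zero constant term, and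
  \<open>PS_unit\<close> inverts all others.\<close>

lemma PS_local: "local_with (PS V) (vanishing V ({} :: 'v::countable set))"
  unfolding local_with_def
proof (intro conjI subsetI)
  show "ideal (vanishing V {}) (PS V)" by (rule vanishing_ideal) simp
  have coeff: "f \<in> vanishing V {} \<longleftrightarrow> f {#} = \<zero>" if "f \<in> carrier (PS V)" for f
    using that by (auto simp: vanishing_def restr_def fun_eq_iff)
  interpret T: cring "PS V" by (rule PS_cring)
  show "\<one>\<^bsub>PS V\<^esub> \<notin> vanishing V {}"
    using coeff[OF T.one_closed] by (simp add: PS_ops indexed_const_def)
  show "f \<in> Units (PS V)" if "f \<in> carrier (PS V) - vanishing V {}" for f
    using that coeff[of f] PS_unit[of f V] by blast
qed

lemma vanishing_quotient_regular:
  assumes V: "finite (V :: 'v::countable set)" and W: "W \<subseteq> V"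
  shows "\<exists>G. local_with (PS V Quot vanishing V W) (Idl\<^bsub>PS V Quot vanishing V W\<^esub> G) \<and> finite G \<and>
    G \<subseteq> carrier (PS V Quot vanishing V W) \<and> enat (card G) = krull_dim (PS V Quot vanishing V W)"
proof -
  define P where "P = vanishing V W"
  interpret T: domain "PS V" by (rule PS_domain)
  interpret P: primeideal P "PS V" unfolding P_def using W by (rule vanishing_prime)
  interpret h: surj_ring_hom "PS V" "PS V Quot P" "(+>\<^bsub>PS V\<^esub>) P"
    by (rule P.quot_surj_hom[OF T.is_cring])
  let ?h = "(+>\<^bsub>PS V\<^esub>) P"
  have finW: "finite W" using V W finite_subset by blast
  have h_eq: "?h f = ?h g \<longleftrightarrow> restr W f = restr W g" if "f \<in> carrier (PS V)" "g \<in> carrier (PS V)" for f g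
    using T.quotient_eq_iff_same_a_r_cos[OF P.is_ideal that] vanishing_minus[OF W that]
    by (simp add: P_def)
  define G where "G = ?h ` indexed_var ` W"
  have vars: "indexed_var ` W \<subseteq> carrier (PS V)" using W by auto
  \<comment> \<open>Modulo \<open>P\<close> a series may be replaced by its restriction to
    \<open>W\<close>. Thus the variables of \<open>W\<close> alone generate the maximal ideal of the
    quotient, and their number is its dimension.\<close>
  have "?h ` vanishing V {} = ?h ` vanishing V (V - W)"
  proof
    show "?h ` vanishing V (V - W) \<subseteq> ?h ` vanishing V {}"
      by (intro image_mono vanishing_mono) simp
    show "?h ` vanishing V {} \<subseteq> ?h ` vanishing V (V - W)"
    proof
      fix y assume "y \<in> ?h ` vanishing V {}"
      then obtain f where f: "y = ?h f" "f \<in> vanishing V {}" by (rule imageE)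
      have fc: "f \<in> carrier (PS V)" "restr {} f = (\<lambda>_. \<zero>)" using f(2) by (simp_all add: vanishing_def)
      have "(V - W) \<inter> W = {}" by blast
      then have "restr W f \<in> vanishing V (V - W)"
        using fc by (simp add: vanishing_def)
      moreover have "y = ?h (restr W f)"
        unfolding f(1) using fc by (subst h_eq) auto
      ultimately show "y \<in> ?h ` vanishing V (V - W)" by (simp add: image_eqI)
    qed
  qed
  also have "vanishing V (V - W) = Idl\<^bsub>PS V\<^esub> (indexed_var ` W)"
    using Idl_vars_eq_vanishing[OF finW W] by simp
  also have "?h ` \<dots> = Idl\<^bsub>PS V Quot P\<^esub> G"
    unfolding G_def using vars by (rule h.image_Idl)
  finally have G_eq: "?h ` vanishing V {} = Idl\<^bsub>PS V Quot P\<^esub> G" .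
  have "h.Ker \<subseteq> vanishing V {}"
    unfolding P.quot_Ker[OF T.is_cring] unfolding P_def by (rule vanishing_mono) simp
  then have loc: "local_with (PS V Quot P) (Idl\<^bsub>PS V Quot P\<^esub> G)"
    unfolding G_eq[symmetric] by (intro h.image_local PS_local)
  have "inj_on (?h \<circ> indexed_var) W"
  proof (rule inj_onI)
    fix v w assume vw: "v \<in> W" "w \<in> W" "(?h \<circ> indexed_var) v = (?h \<circ> indexed_var) w"
    then have "restr W (indexed_var v) = restr W (indexed_var w)"
      using h_eq[OF indexed_var_closed indexed_var_closed, of v w] W by (metis comp_apply subsetD)
    then have "indexed_var v = indexed_var w" using vw by (simp add: restr_var)
    then have "indexed_var v {#v#} = indexed_var w {#v#}" by simp
    then show "v = w" by (simp add: indexed_var_alt split: if_splits)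
  qed
  then have "card G = card W"
    unfolding G_def image_comp by (rule card_image)
  moreover have "krull_dim (PS V Quot P) = enat (card W)"
    using W by (intro krull_dim_quotient[OF V P.is_ideal, where Ws = "{W}"]) (auto simp: P_def)
  ultimately have "enat (card G) = krull_dim (PS V Quot P)" by simp
  moreover have "finite G" "G \<subseteq> carrier (PS V Quot P)"
    unfolding G_def using finW vars h.hom_closed by auto
  ultimately show ?thesis
    using loc unfolding P_def by blast
qed

end


context cring
begin

lemma restr_mult [simp]:
  "f \<in> carrier (PS V) \<Longrightarrow> g \<in> carrier (PS V) \<Longrightarrow> restr W (f \<otimes>\<^bsub>PS V\<^esub> g) = restr W f \<otimes>\<^bsub>PS V\<^esub> restr W g"
  using restr_conv by (simp add: PS_ops)

lemma restr_minus [simp]: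
  assumes f: "f \<in> carrier (PS V)" and g: "g \<in> carrier (PS V)"
  shows "restr W (f \<ominus>\<^bsub>PS V\<^esub> g) = restr W f \<ominus>\<^bsub>PS V\<^esub> restr W g"
proof
  fix M
  have "restr W f \<in> carrier (PS V)" "restr W g \<in> carrier (PS V)"
    using f g by simp_all
  then show "restr W (f \<ominus>\<^bsub>PS V\<^esub> g) M = (restr W f \<ominus>\<^bsub>PS V\<^esub> restr W g) M"
    using PS_minus_coeff[OF f g, of M] by (subst PS_minus_coeff) (simp_all add: restr_def minus_eq)
qed

lemma restr_one' [simp]: "restr W \<one>\<^bsub>PS V\<^esub> = \<one>\<^bsub>PS V\<^esub>"
  by (simp add: PS_ops)

lemma restr_zero' [simp]: "restr W \<zero>\<^bsub>PS V\<^esub> = \<zero>\<^bsub>PS V\<^esub>"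
  by (simp add: PS_ops)

lemma restr_var_in [simp]: "v \<in> W \<Longrightarrow> restr W (indexed_var v) = indexed_var v"
  by (simp add: restr_var)

lemma restr_var_notin: "v \<notin> W \<Longrightarrow> restr W (indexed_var v) = \<zero>\<^bsub>PS V\<^esub>"
  by (simp add: restr_var PS_ops)

end

context domain
begin

lemma indexed_var_nonzero: "indexed_var v \<noteq> \<zero>\<^bsub>PS V\<^esub>"
proof
  assume "indexed_var v = \<zero>\<^bsub>PS V\<^esub>"
  then have "indexed_var v {#v#} = \<zero>" by (simp add: PS_ops)
  then show False by (simp add: indexed_var_alt)
qed

text \<open>\<open>restr (- {v})\<close> is reduction modulo the variable \<open>v\<close>. Its
  values lie in a domain, and a series that it annihilates is a multiple of
  \<open>v\<close>.\<close>

lemma var_prime: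
  assumes V: "(v :: 'v::countable) \<in> V" and f: "f \<in> carrier (PS V)" and g: "g \<in> carrier (PS V)" and q: "q \<in> carrier (PS V)"
    and eq: "f \<otimes>\<^bsub>PS V\<^esub> g = indexed_var v \<otimes>\<^bsub>PS V\<^esub> q" and nf: "restr (- {v}) f \<noteq> \<zero>\<^bsub>PS V\<^esub>"
  shows "\<exists>b\<in>carrier (PS V). g = indexed_var v \<otimes>\<^bsub>PS V\<^esub> b"
proof -
  interpret T: domain "PS V" by (rule PS_domain)
  have "restr (- {v}) f \<otimes>\<^bsub>PS V\<^esub> restr (- {v}) g = restr (- {v}) (indexed_var v) \<otimes>\<^bsub>PS V\<^esub> restr (- {v}) q"
    using arg_cong[OF eq, of "restr (- {v})"] f g q V by simp
  also have "restr (- {v}) (indexed_var v) = \<zero>\<^bsub>PS V\<^esub>"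
    by (rule restr_var_notin) simp
  finally have "restr (- {v}) f \<otimes>\<^bsub>PS V\<^esub> restr (- {v}) g = \<zero>\<^bsub>PS V\<^esub>"
    using q by simp
  then have "restr (- {v}) g = \<zero>\<^bsub>PS V\<^esub>"
    using nf f g T.integral by (metis restr_closed')
  then have g0: "g M = \<zero>" if "v \<notin># M" for M
    using that by (auto simp: PS_ops restr_def fun_eq_iff subset_Compl_singleton split: if_splits dest: spec[of _ M])
  define b where "b = (\<lambda>M. g (add_mset v M))"
  have b: "b \<in> carrier (PS V)" using g by (auto simp: PS_mem b_def)
  have "g M = (indexed_var v \<star> b) M" for M
    using PS_coeff[OF b] g0 by (auto simp: var_conv b_def)
  then have "g = indexed_var v \<otimes>\<^bsub>PS V\<^esub> b" by (simp add: PS_ops fun_eq_iff)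
  then show ?thesis using b by blast
qed

end

section \<open>Three blocks of variables\<close>

text \<open>The blocks are kept abstract so that the two variables chosen in each can be exchanged
  by a second instance of the locale. \<open>W1\<close> to \<open>W3\<close> are the complements of
  the blocks, hence \<open>vanishing V W1\<close> is the prime generated by the variables in
  \<open>U1\<close>, and so on.\<close>

locale three_blocks = field R for R (structure) +
  fixes U1 U2 U3 :: "'v::countable set" and v1 v2 v3 v1' v2' v3' :: 'v
  assumes fin: "finite U1" "finite U2" "finite U3"
    and disj: "U1 \<inter> U2 = {}" "U1 \<inter> U3 = {}" "U2 \<inter> U3 = {}"
    and v_in: "v1 \<in> U1" "v1' \<in> U1" "v2 \<in> U2" "v2' \<in> U2" "v3 \<in> U3" "v3' \<in> U3"
    and v_neq: "v1 \<noteq> v1'" "v2 \<noteq> v2'" "v3 \<noteq> v3'"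
begin

definition V where "V = U1 \<union> U2 \<union> U3"
definition W1 where "W1 = U2 \<union> U3"
definition W2 where "W2 = U1 \<union> U3"
definition W3 where "W3 = U1 \<union> U2"

lemma Int_simps [simp]:
  "W1 \<inter> W2 = U3" "W2 \<inter> W1 = U3" "W1 \<inter> W3 = U2" "W3 \<inter> W1 = U2" "W2 \<inter> W3 = U1" "W3 \<inter> W2 = U1"
  "W1 \<inter> U1 = {}" "U1 \<inter> W1 = {}" "W1 \<inter> U2 = U2" "U2 \<inter> W1 = U2" "W1 \<inter> U3 = U3" "U3 \<inter> W1 = U3"
  "W2 \<inter> U1 = U1" "U1 \<inter> W2 = U1" "W2 \<inter> U2 = {}" "U2 \<inter> W2 = {}" "W2 \<inter> U3 = U3" "U3 \<inter> W2 = U3"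
  "W3 \<inter> U1 = U1" "U1 \<inter> W3 = U1" "W3 \<inter> U2 = U2" "U2 \<inter> W3 = U2" "W3 \<inter> U3 = {}" "U3 \<inter> W3 = {}"
  "U1 \<inter> U2 = {}" "U2 \<inter> U1 = {}" "U1 \<inter> U3 = {}" "U3 \<inter> U1 = {}" "U2 \<inter> U3 = {}" "U3 \<inter> U2 = {}"
  using disj by (auto simp: W1_def W2_def W3_def)

lemma W_subset [simp]: "W1 \<subseteq> V" "W2 \<subseteq> V" "W3 \<subseteq> V"
  by (auto simp: V_def W1_def W2_def W3_def)

lemma v_mem [simp]:
  "v1 \<in> U1" "v1' \<in> U1" "v2 \<in> U2" "v2' \<in> U2" "v3 \<in> U3" "v3' \<in> U3"
  "v1 \<notin> U2" "v1' \<notin> U2" "v1 \<notin> U3" "v1' \<notin> U3" "v2 \<notin> U1" "v2' \<notin> U1" "v2 \<notin> U3" "v2' \<notin> U3"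
  "v3 \<notin> U1" "v3' \<notin> U1" "v3 \<notin> U2" "v3' \<notin> U2"
  "v1 \<in> V" "v1' \<in> V" "v2 \<in> V" "v2' \<in> V" "v3 \<in> V" "v3' \<in> V"
  "v1 \<notin> W1" "v1' \<notin> W1" "v1 \<in> W2" "v1' \<in> W2" "v1 \<in> W3" "v1' \<in> W3"
  "v2 \<in> W1" "v2' \<in> W1" "v2 \<notin> W2" "v2' \<notin> W2" "v2 \<in> W3" "v2' \<in> W3"
  "v3 \<in> W1" "v3' \<in> W1" "v3 \<in> W2" "v3' \<in> W2" "v3 \<notin> W3" "v3' \<notin> W3"
  using disj[unfolded disjoint_iff] v_in by (auto simp: V_def W1_def W2_def W3_def)

lemma v_distinct: "distinct [v1, v2, v3, v1', v2', v3']"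
  using v_mem v_neq by (auto simp del: v_mem)

abbreviation T :: "('v multiset \<Rightarrow> 'a) ring" where "T \<equiv> PS V"
abbreviation Tmult (infixl \<open>\<bullet>\<close> 70) where "f \<bullet> g \<equiv> f \<otimes>\<^bsub>T\<^esub> g"
abbreviation Tadd (infixl \<open>\<boxplus>\<close> 65) where "f \<boxplus> g \<equiv> f \<oplus>\<^bsub>T\<^esub> g"
abbreviation Tminus (infixl \<open>\<boxminus>\<close> 65) where "f \<boxminus> g \<equiv> f \<ominus>\<^bsub>T\<^esub> g"
abbreviation Tzero (\<open>0\<^sub>T\<close>) where "0\<^sub>T \<equiv> \<zero>\<^bsub>T\<^esub>"
abbreviation Tone (\<open>1\<^sub>T\<close>) where "1\<^sub>T \<equiv> \<one>\<^bsub>T\<^esub>"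
abbreviation \<delta>1 where "\<delta>1 \<equiv> restr W1"
abbreviation \<delta>2 where "\<delta>2 \<equiv> restr W2"
abbreviation \<delta>3 where "\<delta>3 \<equiv> restr W3"
abbreviation x where "x \<equiv> indexed_var v1"
abbreviation y where "y \<equiv> indexed_var v2"
abbreviation z where "z \<equiv> indexed_var v3"

sublocale T: domain "PS V"
  by (rule PS_domain)

lemma var_simps [simp]:
  "v \<in> V \<Longrightarrow> indexed_var v \<noteq> 0\<^sub>T"
  "v \<notin> W \<Longrightarrow> restr W (indexed_var v) = 0\<^sub>T"
  by (simp_all add: indexed_var_nonzero restr_var_notin)

definition I where "I = vanishing V W1 \<inter> vanishing V W2 \<inter> vanishing V W3"

lemma mem_I: "f \<in> I \<longleftrightarrow> f \<in> carrier T \<and> \<delta>1 f = 0\<^sub>T \<and> \<delta>2 f = 0\<^sub>T \<and> \<delta>3 f = 0\<^sub>T"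
  by (auto simp: I_def vanishing_def PS_ops)

lemma minus_mem_I:
  assumes "f \<in> carrier T" "g \<in> carrier T"
  shows "f \<boxminus> g \<in> I \<longleftrightarrow> \<delta>1 f = \<delta>1 g \<and> \<delta>2 f = \<delta>2 g \<and> \<delta>3 f = \<delta>3 g"
  using assms vanishing_minus[of _ V f g] by (simp add: I_def)

lemma I_ideal: "ideal I T"
  unfolding I_def by (intro T.i_intersect vanishing_ideal) simp_all

text \<open>This identifies \<open>A\<close> inside \<open>B\<close>: a monomial lying in two of the
  sets \<open>W1\<close>, \<open>W2\<close>, \<open>W3\<close> involves a single block, and there
  the two components agree, so a coefficient can be read off from any component that sees
  it.\<close>

lemma gluing:
  assumes b: "b1 \<in> carrier T" "b2 \<in> carrier T" "b3 \<in> carrier T"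
    and c: "restr U3 b1 = restr U3 b2" "restr U2 b1 = restr U2 b3" "restr U1 b2 = restr U1 b3"
  shows "\<exists>b\<in>carrier T. \<delta>1 b = \<delta>1 b1 \<and> \<delta>2 b = \<delta>2 b2 \<and> \<delta>3 b = \<delta>3 b3"
proof -
  define b where "b = (\<lambda>M. if set_mset M \<subseteq> W1 then b1 M else if set_mset M \<subseteq> W2 then b2 M
    else if set_mset M \<subseteq> W3 then b3 M else \<zero>)"
  have bT: "b \<in> carrier T" using b by (auto simp: PS_mem b_def)
  have 3: "b1 M = b2 M" if "set_mset M \<subseteq> W1" "set_mset M \<subseteq> W2" for M
  proof -
    have "set_mset M \<subseteq> U3" using that Int_simps(1) by blast
    then show ?thesis using fun_cong[OF c(1), of M] by (simp add: restr_def)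
  qed
  have 2: "b1 M = b3 M" if "set_mset M \<subseteq> W1" "set_mset M \<subseteq> W3" for M
  proof -
    have "set_mset M \<subseteq> U2" using that Int_simps(3) by blast
    then show ?thesis using fun_cong[OF c(2), of M] by (simp add: restr_def)
  qed
  have 1: "b2 M = b3 M" if "set_mset M \<subseteq> W2" "set_mset M \<subseteq> W3" for M
  proof -
    have "set_mset M \<subseteq> U1" using that Int_simps(5) by blast
    then show ?thesis using fun_cong[OF c(3), of M] by (simp add: restr_def)
  qed
  show ?thesis
    using bT 1 2 3 by (intro bexI[of _ b]) (auto simp: restr_def b_def fun_eq_iff)
qed

text \<open>
  \<open>\<Gamma> b1 b2 b3\<close> represents the product of \<open>e2\<close> with the element \<open>(b1, b2, b3)\<close> of the normalization.
\<close>

definition e2 where "e2 = y \<bullet> z \<boxplus> x \<bullet> z \<boxplus> x \<bullet> y"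
definition e1 where "e1 = x \<boxplus> y \<boxplus> z"
definition \<Gamma> where "\<Gamma> b1 b2 b3 = y \<bullet> z \<bullet> b1 \<boxplus> x \<bullet> z \<bullet> b2 \<boxplus> x \<bullet> y \<bullet> b3"

lemma e_closed [simp]: "e2 \<in> carrier T" "e1 \<in> carrier T"
  by (simp_all add: e1_def e2_def)

lemma \<delta>_e2: "\<delta>1 e2 = y \<bullet> z" "\<delta>2 e2 = x \<bullet> z" "\<delta>3 e2 = x \<bullet> y"
  by (simp_all add: e2_def)

lemma \<Gamma>_closed [simp]:
  "b1 \<in> carrier T \<Longrightarrow> b2 \<in> carrier T \<Longrightarrow> b3 \<in> carrier T \<Longrightarrow> \<Gamma> b1 b2 b3 \<in> carrier T"
  by (simp add: \<Gamma>_def)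

lemma \<delta>_\<Gamma>:
  assumes "b1 \<in> carrier T" "b2 \<in> carrier T" "b3 \<in> carrier T"
  shows "\<delta>1 (\<Gamma> b1 b2 b3) = y \<bullet> z \<bullet> \<delta>1 b1" "\<delta>2 (\<Gamma> b1 b2 b3) = x \<bullet> z \<bullet> \<delta>2 b2" "\<delta>3 (\<Gamma> b1 b2 b3) = x \<bullet> y \<bullet> \<delta>3 b3"
  using assms by (simp_all add: \<Gamma>_def)

text \<open>On each component \<open>e2\<close> is a product of two variables, hence nonzero in a
  domain.\<close>

lemma e2_regular:
  assumes g: "g \<in> carrier T" and eg: "e2 \<bullet> g \<in> I"
  shows "g \<in> I"
  using eg g by (simp add: mem_I \<delta>_e2 T.integral_iff)

text \<open>Modulo the variable \<open>u\<close>, which is prime, the sum becomes the nonzero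
  \<open>v\<close>; so \<open>u\<close> divides \<open>f\<close>. After cancelling \<open>u\<close>
  the same argument applies to \<open>v\<close>.\<close>

lemma sum_divides_product:
  assumes uv: "u \<in> V" "v \<in> V" "u \<noteq> v" and fg: "f \<in> carrier T" "g \<in> carrier T"
    and eq: "(indexed_var u \<boxplus> indexed_var v) \<bullet> f = indexed_var u \<bullet> indexed_var v \<bullet> g"
  shows "\<exists>b\<in>carrier T. f = indexed_var u \<bullet> indexed_var v \<bullet> b"
proof -
  let ?u = "indexed_var u" and ?v = "indexed_var v"
  have uvT: "?u \<in> carrier T" "?v \<in> carrier T" using uv by simp_all
  have "?v \<bullet> f = ?u \<bullet> (?v \<bullet> g \<boxminus> f)"
  proof -
    have "?v \<bullet> f = (?u \<boxplus> ?v) \<bullet> f \<boxminus> ?u \<bullet> f" using uvT fg by algebra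
    also have "\<dots> = ?u \<bullet> (?v \<bullet> g \<boxminus> f)" unfolding eq using uvT fg by algebra
    finally show ?thesis .
  qed
  then obtain f1 where f1: "f1 \<in> carrier T" "f = ?u \<bullet> f1"
    using var_prime[OF uv(1) uvT(2) fg(1), of "?v \<bullet> g \<boxminus> f"] uv uvT fg by auto
  have "?u \<bullet> (?u \<bullet> f1) = ?u \<bullet> (?v \<bullet> (g \<boxminus> f1))"
  proof -
    have "?u \<bullet> (?u \<bullet> f1) = (?u \<boxplus> ?v) \<bullet> (?u \<bullet> f1) \<boxminus> ?u \<bullet> (?v \<bullet> f1)" using uvT f1(1) by algebra
    also have "\<dots> = ?u \<bullet> (?v \<bullet> (g \<boxminus> f1))" unfolding f1(2)[symmetric] eq using uvT f1(1) fg by algebra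
    finally show ?thesis .
  qed
  then have "?u \<bullet> f1 = ?v \<bullet> (g \<boxminus> f1)"
    using uv uvT f1 fg by (subst (asm) T.m_lcancel) auto
  then obtain b where b: "b \<in> carrier T" "f1 = ?v \<bullet> b"
    using var_prime[OF uv(2) uvT(1) f1(1), of "g \<boxminus> f1"] uv uvT fg f1(1) by auto
  have "f = ?u \<bullet> ?v \<bullet> b" unfolding f1(2) b(2) using uvT b(1) by (simp add: T.m_assoc)
  then show ?thesis using b(1) by blast
qed

lemma product_divides_product:
  assumes V: "u \<in> V" "v \<in> V" "u' \<in> V" "v' \<in> V" and ne: "u \<noteq> v" "u' \<noteq> u" "v' \<noteq> u" "u' \<noteq> v" "v' \<noteq> v"
    and fg: "f \<in> carrier T" "g \<in> carrier T"
    and eq: "indexed_var u' \<bullet> indexed_var v' \<bullet> f = indexed_var u \<bullet> indexed_var v \<bullet> g"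
  shows "\<exists>b\<in>carrier T. f = indexed_var u \<bullet> indexed_var v \<bullet> b"
proof -
  let ?u = "indexed_var u" and ?v = "indexed_var v" and ?p = "indexed_var u' \<bullet> indexed_var v'"
  have uvT: "?u \<in> carrier T" "?v \<in> carrier T" "?p \<in> carrier T" using V by simp_all
  have "?p \<bullet> f = ?u \<bullet> (?v \<bullet> g)" using eq uvT fg by (simp add: T.m_assoc)
  then obtain f1 where f1: "f1 \<in> carrier T" "f = ?u \<bullet> f1"
    using var_prime[OF V(1) uvT(3) fg(1), of "?v \<bullet> g"] V ne uvT fg by (auto simp: T.integral_iff)
  have "?u \<bullet> (?p \<bullet> f1) = ?u \<bullet> (?v \<bullet> g)"
    using \<open>?p \<bullet> f = ?u \<bullet> (?v \<bullet> g)\<close> uvT f1 by (simp add: T.m_lcomm)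
  then have "?p \<bullet> f1 = ?v \<bullet> g"
    using V uvT f1 fg by (subst (asm) T.m_lcancel) auto
  then obtain b where b: "b \<in> carrier T" "f1 = ?v \<bullet> b"
    using var_prime[OF V(2) uvT(3) f1(1) fg(2)] V ne uvT by (auto simp: T.integral_iff)
  have "f = ?u \<bullet> ?v \<bullet> b" unfolding f1(2) b(2) using uvT b(1) by (simp add: T.m_assoc)
  then show ?thesis using b(1) by blast
qed

text \<open>On each component \<open>e1\<close> and \<open>e2\<close> are the sum and the product of
  two variables, so \<open>e2\<close> divides \<open>g\<close> there. The quotients glue because,
  after cancelling, each overlap determines them by the same restriction of
  \<open>h\<close>.\<close>

lemma e2_e1_regular:
  assumes g: "g \<in> carrier T" and h: "h \<in> carrier T" and eq: "e1 \<bullet> g \<boxminus> e2 \<bullet> h \<in> I"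
  shows "\<exists>b\<in>carrier T. g \<boxminus> e2 \<bullet> b \<in> I"
proof -
  have "\<delta>1 (e1 \<bullet> g) = \<delta>1 (e2 \<bullet> h)" "\<delta>2 (e1 \<bullet> g) = \<delta>2 (e2 \<bullet> h)" "\<delta>3 (e1 \<bullet> g) = \<delta>3 (e2 \<bullet> h)"
    using eq g h by (simp_all add: minus_mem_I del: restr_mult)
  then have eqs: "(y \<boxplus> z) \<bullet> \<delta>1 g = y \<bullet> z \<bullet> \<delta>1 h" "(x \<boxplus> z) \<bullet> \<delta>2 g = x \<bullet> z \<bullet> \<delta>2 h" "(x \<boxplus> y) \<bullet> \<delta>3 g = x \<bullet> y \<bullet> \<delta>3 h"
    using g h by (simp_all add: \<delta>_e2) (simp_all add: e1_def)
  obtain c1 where c1: "c1 \<in> carrier T" "\<delta>1 g = y \<bullet> z \<bullet> c1"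
    using sum_divides_product[OF _ _ _ _ _ eqs(1)] g h v_distinct by auto
  obtain c2 where c2: "c2 \<in> carrier T" "\<delta>2 g = x \<bullet> z \<bullet> c2"
    using sum_divides_product[OF _ _ _ _ _ eqs(2)] g h v_distinct by auto
  obtain c3 where c3: "c3 \<in> carrier T" "\<delta>3 g = x \<bullet> y \<bullet> c3"
    using sum_divides_product[OF _ _ _ _ _ eqs(3)] g h v_distinct by auto
  have cancel: "(u \<boxplus> w) \<bullet> c = k" if "(u \<boxplus> w) \<bullet> (u \<bullet> w \<bullet> c) = u \<bullet> w \<bullet> k" "u \<in> carrier T" "w \<in> carrier T"
    "c \<in> carrier T" "k \<in> carrier T" "u \<noteq> 0\<^sub>T" "w \<noteq> 0\<^sub>T" for u w c k
  proof -
    have "u \<bullet> w \<bullet> ((u \<boxplus> w) \<bullet> c) = (u \<boxplus> w) \<bullet> (u \<bullet> w \<bullet> c)" using that by algebra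
    also have "\<dots> = u \<bullet> w \<bullet> k" by (rule that(1))
    finally show ?thesis using that by (subst (asm) T.m_lcancel) (auto simp: T.integral_iff)
  qed
  have d1: "(y \<boxplus> z) \<bullet> c1 = \<delta>1 h" by (rule cancel[OF eqs(1)[unfolded c1(2)]]) (use c1(1) h in simp_all)
  have d2: "(x \<boxplus> z) \<bullet> c2 = \<delta>2 h" by (rule cancel[OF eqs(2)[unfolded c2(2)]]) (use c2(1) h in simp_all)
  have d3: "(x \<boxplus> y) \<bullet> c3 = \<delta>3 h" by (rule cancel[OF eqs(3)[unfolded c3(2)]]) (use c3(1) h in simp_all)
  have "z \<bullet> restr U3 c1 = z \<bullet> restr U3 c2"
    using arg_cong[OF d1, of "restr U3"] arg_cong[OF d2, of "restr U3"] c1(1) c2(1) by simp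
  then have 3: "restr U3 c1 = restr U3 c2" using c1(1) c2(1) by (subst (asm) T.m_lcancel) auto
  have "y \<bullet> restr U2 c1 = y \<bullet> restr U2 c3"
    using arg_cong[OF d1, of "restr U2"] arg_cong[OF d3, of "restr U2"] c1(1) c3(1) by simp
  then have 2: "restr U2 c1 = restr U2 c3" using c1(1) c3(1) by (subst (asm) T.m_lcancel) auto
  have "x \<bullet> restr U1 c2 = x \<bullet> restr U1 c3"
    using arg_cong[OF d2, of "restr U1"] arg_cong[OF d3, of "restr U1"] c2(1) c3(1) by simp
  then have 1: "restr U1 c2 = restr U1 c3" using c2(1) c3(1) by (subst (asm) T.m_lcancel) auto
  obtain b where b: "b \<in> carrier T" "\<delta>1 b = \<delta>1 c1" "\<delta>2 b = \<delta>2 c2" "\<delta>3 b = \<delta>3 c3"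
    using gluing[OF c1(1) c2(1) c3(1) 3 2 1] by blast
  have "\<delta>1 g = y \<bullet> z \<bullet> \<delta>1 b" "\<delta>2 g = x \<bullet> z \<bullet> \<delta>2 b" "\<delta>3 g = x \<bullet> y \<bullet> \<delta>3 b"
    using arg_cong[OF c1(2), of \<delta>1] arg_cong[OF c2(2), of \<delta>2] arg_cong[OF c3(2), of \<delta>3] b c1(1) c2(1) c3(1) g by simp_all
  then show ?thesis
    using b(1) g by (intro bexI[of _ b]) (simp_all add: minus_mem_I \<delta>_e2)
qed

end


section \<open>Regular pairs of A, their relations on B, and the socle\<close>

context three_blocks
begin

text \<open>A product of variables from two blocks vanishes on two components but not on the third;
  if \<open>p\<close> vanished on the third, it would kill this product.\<close>

lemma regular_nonzero:
  assumes p: "p \<in> carrier T" and N1: "\<And>g. g \<in> carrier T \<Longrightarrow> p \<bullet> g \<in> I \<Longrightarrow> g \<in> I"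
  shows "\<delta>1 p \<noteq> 0\<^sub>T" "\<delta>2 p \<noteq> 0\<^sub>T" "\<delta>3 p \<noteq> 0\<^sub>T"
proof -
  show "\<delta>1 p \<noteq> 0\<^sub>T"
    using N1[of "y \<bullet> z"] p by (auto simp: mem_I T.integral_iff)
  show "\<delta>2 p \<noteq> 0\<^sub>T"
    using N1[of "x \<bullet> z"] p by (auto simp: mem_I T.integral_iff)
  show "\<delta>3 p \<noteq> 0\<^sub>T"
    using N1[of "x \<bullet> y"] p by (auto simp: mem_I T.integral_iff)
qed

text \<open>The fraction \<open>t / p\<close> has the coprime denominators \<open>u v\<close> and
  \<open>u' v'\<close>, hence it is a series \<open>d\<close>.\<close>

lemma component_divisor:
  assumes V: "u \<in> V" "v \<in> V" "u' \<in> V" "v' \<in> V" and ne: "u \<noteq> v" "u' \<noteq> u" "v' \<noteq> u" "u' \<noteq> v" "v' \<noteq> v"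
    and cl: "s \<in> carrier T" "t \<in> carrier T" "p \<in> carrier T" "q \<in> carrier T" "a \<in> carrier T" "a' \<in> carrier T"
    and p0: "p \<noteq> 0\<^sub>T" and st: "p \<bullet> s = q \<bullet> t"
    and a: "indexed_var u \<bullet> indexed_var v \<bullet> t = p \<bullet> a" and a': "indexed_var u' \<bullet> indexed_var v' \<bullet> t = p \<bullet> a'"
  shows "\<exists>d\<in>carrier T. s = q \<bullet> d \<and> t = p \<bullet> d"
proof -
  let ?m = "indexed_var u \<bullet> indexed_var v" and ?m' = "indexed_var u' \<bullet> indexed_var v'"
  have m: "?m \<in> carrier T" "?m' \<in> carrier T" "?m \<noteq> 0\<^sub>T" using V by (simp_all add: T.integral_iff)
  have "p \<bullet> (?m' \<bullet> a) = ?m' \<bullet> (p \<bullet> a)" using m cl by (simp add: T.m_lcomm)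
  also have "\<dots> = ?m \<bullet> (?m' \<bullet> t)" unfolding a[symmetric] using m cl by (simp add: T.m_lcomm)
  also have "\<dots> = p \<bullet> (?m \<bullet> a')" unfolding a' using m cl by (simp add: T.m_lcomm)
  finally have "?m' \<bullet> a = ?m \<bullet> a'"
    using p0 m cl by (subst (asm) T.m_lcancel) auto
  then obtain d where d: "d \<in> carrier T" "a = ?m \<bullet> d"
    using product_divides_product[OF V ne cl(5,6)] by blast
  have "?m \<bullet> t = ?m \<bullet> (p \<bullet> d)"
    unfolding a d(2) using m cl d(1) by (simp add: T.m_lcomm)
  then have t: "t = p \<bullet> d"
    using m cl d(1) by (subst (asm) T.m_lcancel) auto
  have "p \<bullet> s = p \<bullet> (q \<bullet> d)"
    unfolding st t using cl d(1) by (simp add: T.m_lcomm)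
  then have "s = q \<bullet> d"
    using p0 cl d(1) by (subst (asm) T.m_lcancel) auto
  then show ?thesis using t d(1) by blast
qed

text \<open>The data form a relation \<open>p s = q t\<close> on \<open>B\<close>. Multiplying by
  \<open>e2\<close> brings it into \<open>A\<close>, where regularity of the pair makes
  \<open>e2 t\<close> a multiple of \<open>p\<close>.\<close>

lemma clear_denominators:
  assumes pq: "p \<in> carrier T" "q \<in> carrier T"
    and N2: "\<And>g h. g \<in> carrier T \<Longrightarrow> h \<in> carrier T \<Longrightarrow> q \<bullet> g \<boxminus> p \<bullet> h \<in> I \<Longrightarrow> \<exists>a\<in>carrier T. g \<boxminus> p \<bullet> a \<in> I"
    and s: "s1 \<in> carrier T" "s2 \<in> carrier T" "s3 \<in> carrier T" "\<delta>1 s1 = s1" "\<delta>2 s2 = s2" "\<delta>3 s3 = s3"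
    and t: "t1 \<in> carrier T" "t2 \<in> carrier T" "t3 \<in> carrier T" "\<delta>1 t1 = t1" "\<delta>2 t2 = t2" "\<delta>3 t3 = t3"
    and st: "\<delta>1 p \<bullet> s1 = \<delta>1 q \<bullet> t1" "\<delta>2 p \<bullet> s2 = \<delta>2 q \<bullet> t2" "\<delta>3 p \<bullet> s3 = \<delta>3 q \<bullet> t3"
  shows "\<exists>a\<in>carrier T. y \<bullet> z \<bullet> t1 = \<delta>1 p \<bullet> \<delta>1 a \<and> x \<bullet> z \<bullet> t2 = \<delta>2 p \<bullet> \<delta>2 a \<and> x \<bullet> y \<bullet> t3 = \<delta>3 p \<bullet> \<delta>3 a"
proof -
  have mv: "q' \<bullet> (m \<bullet> t') = p' \<bullet> (m \<bullet> s')" if "p' \<bullet> s' = q' \<bullet> t'" "p' \<in> carrier T" "q' \<in> carrier T" "s' \<in> carrier T" "t' \<in> carrier T" "m \<in> carrier T"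
    for p' q' s' t' m
    using that by (metis T.m_lcomm)
  have \<Gamma>: "q \<bullet> \<Gamma> t1 t2 t3 \<boxminus> p \<bullet> \<Gamma> s1 s2 s3 \<in> I"
    using pq s t mv[OF st(1)] mv[OF st(2)] mv[OF st(3)] by (simp add: minus_mem_I \<delta>_\<Gamma>)
  obtain a where a: "a \<in> carrier T" "\<Gamma> t1 t2 t3 \<boxminus> p \<bullet> a \<in> I"
    using N2[OF _ _ \<Gamma>] s t by auto
  have "y \<bullet> z \<bullet> t1 = \<delta>1 p \<bullet> \<delta>1 a" "x \<bullet> z \<bullet> t2 = \<delta>2 p \<bullet> \<delta>2 a" "x \<bullet> y \<bullet> t3 = \<delta>3 p \<bullet> \<delta>3 a"
    using a(2) minus_mem_I[of "\<Gamma> t1 t2 t3" "p \<bullet> a"] a(1) pq(1) t by (simp_all add: \<delta>_\<Gamma>)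
  then show ?thesis using a(1) by blast
qed

text \<open>A regular pair of \<open>A\<close> stays regular on \<open>B\<close>: its relations
  there are multiples of \<open>(q, p)\<close>. The denominator left by
  \<open>clear_denominators\<close> disappears because on each component it can be taken as a
  product of unprimed or of primed variables.\<close>

lemma common_divisor:
  assumes pq: "p \<in> carrier T" "q \<in> carrier T"
    and N1: "\<And>g. g \<in> carrier T \<Longrightarrow> p \<bullet> g \<in> I \<Longrightarrow> g \<in> I"
    and N2: "\<And>g h. g \<in> carrier T \<Longrightarrow> h \<in> carrier T \<Longrightarrow> q \<bullet> g \<boxminus> p \<bullet> h \<in> I \<Longrightarrow> \<exists>a\<in>carrier T. g \<boxminus> p \<bullet> a \<in> I"
    and s: "s1 \<in> carrier T" "s2 \<in> carrier T" "s3 \<in> carrier T" "\<delta>1 s1 = s1" "\<delta>2 s2 = s2" "\<delta>3 s3 = s3"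
    and t: "t1 \<in> carrier T" "t2 \<in> carrier T" "t3 \<in> carrier T" "\<delta>1 t1 = t1" "\<delta>2 t2 = t2" "\<delta>3 t3 = t3"
    and st: "\<delta>1 p \<bullet> s1 = \<delta>1 q \<bullet> t1" "\<delta>2 p \<bullet> s2 = \<delta>2 q \<bullet> t2" "\<delta>3 p \<bullet> s3 = \<delta>3 q \<bullet> t3"
  obtains d1 d2 d3 where "d1 \<in> carrier T" "d2 \<in> carrier T" "d3 \<in> carrier T"
    "s1 = \<delta>1 q \<bullet> d1" "t1 = \<delta>1 p \<bullet> d1" "s2 = \<delta>2 q \<bullet> d2" "t2 = \<delta>2 p \<bullet> d2" "s3 = \<delta>3 q \<bullet> d3" "t3 = \<delta>3 p \<bullet> d3"
proof -
  have nz: "\<delta>1 p \<noteq> 0\<^sub>T" "\<delta>2 p \<noteq> 0\<^sub>T" "\<delta>3 p \<noteq> 0\<^sub>T" using regular_nonzero[OF pq(1) N1] by auto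
  obtain a where a: "a \<in> carrier T"
    and a_eq: "y \<bullet> z \<bullet> t1 = \<delta>1 p \<bullet> \<delta>1 a" "x \<bullet> z \<bullet> t2 = \<delta>2 p \<bullet> \<delta>2 a" "x \<bullet> y \<bullet> t3 = \<delta>3 p \<bullet> \<delta>3 a"
  proof -
    have "\<exists>a\<in>carrier T. y \<bullet> z \<bullet> t1 = \<delta>1 p \<bullet> \<delta>1 a \<and> x \<bullet> z \<bullet> t2 = \<delta>2 p \<bullet> \<delta>2 a \<and> x \<bullet> y \<bullet> t3 = \<delta>3 p \<bullet> \<delta>3 a"
      by (rule clear_denominators[OF pq _ s t st]) (rule N2)
    then show ?thesis using that by blast
  qed
  \<comment> \<open>The name refers to the primed variables: exchanging the two variables in each
    block leaves the blocks, and hence \<open>V\<close> and \<open>I\<close>, unchanged.\<close>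
  have prime: "three_blocks R U1 U2 U3 v1' v2' v3' v1 v2 v3"
    using fin disj[unfolded disjoint_iff] v_in v_neq by unfold_locales auto
  obtain a' where a': "a' \<in> carrier T"
    and a'_eq: "indexed_var v2' \<bullet> indexed_var v3' \<bullet> t1 = \<delta>1 p \<bullet> \<delta>1 a'" "indexed_var v1' \<bullet> indexed_var v3' \<bullet> t2 = \<delta>2 p \<bullet> \<delta>2 a'"
      "indexed_var v1' \<bullet> indexed_var v2' \<bullet> t3 = \<delta>3 p \<bullet> \<delta>3 a'"
  proof -
    have "\<exists>a'\<in>carrier T. indexed_var v2' \<bullet> indexed_var v3' \<bullet> t1 = \<delta>1 p \<bullet> \<delta>1 a' \<and>
      indexed_var v1' \<bullet> indexed_var v3' \<bullet> t2 = \<delta>2 p \<bullet> \<delta>2 a' \<and> indexed_var v1' \<bullet> indexed_var v2' \<bullet> t3 = \<delta>3 p \<bullet> \<delta>3 a'"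
      by (rule three_blocks.clear_denominators[OF prime pq _ s t st]) (rule N2)
    then show ?thesis using that by blast
  qed
  have "\<exists>d\<in>carrier T. s1 = \<delta>1 q \<bullet> d \<and> t1 = \<delta>1 p \<bullet> d"
    by (rule component_divisor[OF _ _ _ _ _ _ _ _ _ s(1) t(1) _ _ _ _ nz(1) st(1) a_eq(1) a'_eq(1)])
      (use v_distinct pq a a' in auto)
  moreover have "\<exists>d\<in>carrier T. s2 = \<delta>2 q \<bullet> d \<and> t2 = \<delta>2 p \<bullet> d"
    by (rule component_divisor[OF _ _ _ _ _ _ _ _ _ s(2) t(2) _ _ _ _ nz(2) st(2) a_eq(2) a'_eq(2)])
      (use v_distinct pq a a' in auto)
  moreover have "\<exists>d\<in>carrier T. s3 = \<delta>3 q \<bullet> d \<and> t3 = \<delta>3 p \<bullet> d"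
    by (rule component_divisor[OF _ _ _ _ _ _ _ _ _ s(3) t(3) _ _ _ _ nz(3) st(3) a_eq(3) a'_eq(3)])
      (use v_distinct pq a a' in auto)
  ultimately show ?thesis
    using that by blast
qed

text \<open>
  A regular pair does not lie in the sum of two of the three primes: that ideal has depth one, because
  it multiplies the element of the normalization with single component \<open>indexed_var v\<close> into \<open>T / I\<close>.
\<close>

lemma regular_pair_not_both:
  assumes pq: "p \<in> carrier T" "q \<in> carrier T"
    and N2: "\<forall>g\<in>carrier T. \<forall>h\<in>carrier T. q \<bullet> g \<boxminus> p \<bullet> h \<in> I \<longrightarrow> (\<exists>a\<in>carrier T. g \<boxminus> p \<bullet> a \<in> I)"
    and I: "\<And>f. f \<in> I \<longleftrightarrow> f \<in> carrier T \<and> restr W f = 0\<^sub>T \<and> restr W' f = 0\<^sub>T \<and> restr W'' f = 0\<^sub>T"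
    and v: "v \<in> V" "v \<in> W" "v \<in> W'" "v \<notin> W''"
    and nz: "restr W p \<noteq> 0\<^sub>T" "restr W' p \<noteq> 0\<^sub>T"
    and both: "restr (W' \<inter> W) p = 0\<^sub>T" "restr (W' \<inter> W) q = 0\<^sub>T"
  shows False
proof -
  define b where "b = indexed_var v"
  have b: "b \<in> carrier T" "restr W b = b" "restr W' b = b" "restr W'' b = 0\<^sub>T" "b \<noteq> 0\<^sub>T"
    using v by (simp_all add: b_def)
  \<comment> \<open>\<open>gp\<close> and \<open>gq\<close> are \<open>p\<close> and
    \<open>q\<close> times the element of \<open>B\<close> that is \<open>b\<close> on
    \<open>W\<close> and zero on the other two components; they lie in \<open>A\<close> because
    \<open>p\<close> and \<open>q\<close> vanish on the overlap. From \<open>q gp = p gq\<close>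
    regularity gives \<open>gp = p a\<close> in \<open>A\<close>. Then \<open>a\<close> is
    \<open>b\<close> on \<open>W\<close> and zero on \<open>W'\<close>, although \<open>b\<close> is
    nonzero on the overlap.\<close>
  define gp where "gp = restr W p \<bullet> b"
  define gq where "gq = restr W q \<bullet> b"
  have g: "gp \<in> carrier T" "gq \<in> carrier T" using pq b by (simp_all add: gp_def gq_def)
  have r: "restr W gp = restr W p \<bullet> b" "restr W gq = restr W q \<bullet> b" "restr W' gp = 0\<^sub>T" "restr W' gq = 0\<^sub>T"
    "restr W'' gp = 0\<^sub>T" "restr W'' gq = 0\<^sub>T"
    using pq b both by (simp_all add: gp_def gq_def)
  have "restr W q \<bullet> (restr W p \<bullet> b) \<boxminus> restr W p \<bullet> (restr W q \<bullet> b) = 0\<^sub>T"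
    using pq b T.m_lcomm[of "restr W q" "restr W p" b] by simp
  then have "q \<bullet> gp \<boxminus> p \<bullet> gq \<in> I"
    unfolding I using pq g r by simp
  then obtain a where a: "a \<in> carrier T" "gp \<boxminus> p \<bullet> a \<in> I"
    using N2 g by blast
  have A: "restr W (gp \<boxminus> p \<bullet> a) = 0\<^sub>T" "restr W' (gp \<boxminus> p \<bullet> a) = 0\<^sub>T"
    using a(2) unfolding I by blast+
  have "restr W gp \<boxminus> restr W p \<bullet> restr W a = 0\<^sub>T" "restr W' gp \<boxminus> restr W' p \<bullet> restr W' a = 0\<^sub>T"
    using A pq a(1) g by simp_all
  then have "restr W gp = restr W p \<bullet> restr W a" "restr W' gp = restr W' p \<bullet> restr W' a"
    using pq a(1) g by simp_all
  then have 1: "restr W p \<bullet> b = restr W p \<bullet> restr W a" and 2: "restr W' p \<bullet> restr W' a = 0\<^sub>T"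
    using r by simp_all
  have "b = restr W a" using 1 nz pq a(1) b(1) by (simp add: T.m_lcancel)
  moreover have "restr W' a = 0\<^sub>T" using 2 nz pq a(1) by (simp add: T.integral_iff)
  then have "restr W (restr W' a) = 0\<^sub>T" by simp
  then have "restr W' (restr W a) = 0\<^sub>T" by (simp add: Int_commute)
  ultimately have "restr W' b = 0\<^sub>T" by simp
  then show False using b by simp
qed

text \<open>
  The cokernel of the diagonal embedding sits inside the sum of the three rings \<open>K[[U]]\<close>, where \<open>U\<close> is one block.
  For \<open>r\<close> in the maximal ideal the element with single component \<open>restr U3 r\<close> is the image of
  \<open>(restr U3 r, 0, 0)\<close>, and \<open>w\<close> is the resulting Koszul combination of \<open>p\<close> and \<open>q\<close>.
\<close>

theorem socle_element:
  assumes pq: "p \<in> carrier T" "q \<in> carrier T" "restr {} p = 0\<^sub>T" "restr {} q = 0\<^sub>T"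
    and N1': "\<forall>g\<in>carrier T. p \<bullet> g \<in> I \<longrightarrow> g \<in> I"
    and N2': "\<forall>g\<in>carrier T. \<forall>h\<in>carrier T. q \<bullet> g \<boxminus> p \<bullet> h \<in> I \<longrightarrow> (\<exists>a\<in>carrier T. g \<boxminus> p \<bullet> a \<in> I)"
  shows "\<exists>w\<in>carrier T. (\<forall>a\<in>carrier T. \<forall>b\<in>carrier T. w \<boxminus> (p \<bullet> a \<boxplus> q \<bullet> b) \<notin> I) \<and>
    (\<forall>r\<in>carrier T. restr {} r = 0\<^sub>T \<longrightarrow> (\<exists>a\<in>carrier T. \<exists>b\<in>carrier T. r \<bullet> w \<boxminus> (p \<bullet> a \<boxplus> q \<bullet> b) \<in> I))"
proof -
  have N1: "g \<in> I" if "g \<in> carrier T" "p \<bullet> g \<in> I" for g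
    using N1' that by blast
  have N2: "\<exists>a\<in>carrier T. g \<boxminus> p \<bullet> a \<in> I" if "g \<in> carrier T" "h \<in> carrier T" "q \<bullet> g \<boxminus> p \<bullet> h \<in> I" for g h
    using N2' that by blast
  define w where "w = \<delta>1 p \<bullet> restr U3 q \<boxminus> \<delta>1 q \<bullet> restr U3 p"
  have w: "w \<in> carrier T" using pq by (simp add: w_def)
  have w1: "\<delta>1 w = w" using pq by (simp add: w_def)
  have w2: "\<delta>2 w = 0\<^sub>T"
  proof -
    have "\<delta>2 w = restr U3 p \<bullet> restr U3 q \<boxminus> restr U3 q \<bullet> restr U3 p" using pq by (simp add: w_def)
    also have "\<dots> = 0\<^sub>T" using pq T.m_comm[of "restr U3 p" "restr U3 q"] by simp
    finally show ?thesis .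
  qed
  have w3: "\<delta>3 w = 0\<^sub>T" using pq by (simp add: w_def)
  have small: "\<exists>a\<in>carrier T. \<exists>b\<in>carrier T. r \<bullet> w \<boxminus> (p \<bullet> a \<boxplus> q \<bullet> b) \<in> I"
    if r: "r \<in> carrier T" "restr {} r = 0\<^sub>T" for r
  proof -
    define a where "a = \<delta>1 r \<bullet> restr U3 q \<boxminus> \<delta>1 q \<bullet> restr U3 r"
    define b where "b = \<delta>1 p \<bullet> restr U3 r \<boxminus> \<delta>1 r \<bullet> restr U3 p"
    have ab: "a \<in> carrier T" "b \<in> carrier T" using pq r by (simp_all add: a_def b_def)
    have "\<delta>2 a = restr U3 r \<bullet> restr U3 q \<boxminus> restr U3 q \<bullet> restr U3 r"
      "\<delta>2 b = restr U3 p \<bullet> restr U3 r \<boxminus> restr U3 r \<bullet> restr U3 p"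
      using pq r by (simp_all add: a_def b_def)
    then have ab2: "\<delta>2 a = 0\<^sub>T" "\<delta>2 b = 0\<^sub>T"
      using pq r T.m_comm[of "restr U3 r" "restr U3 q"] T.m_comm[of "restr U3 p" "restr U3 r"] by simp_all
    have ab3: "\<delta>3 a = 0\<^sub>T" "\<delta>3 b = 0\<^sub>T" using pq r by (simp_all add: a_def b_def)
    have ab1: "\<delta>1 a = a" "\<delta>1 b = b" using pq r by (simp_all add: a_def b_def)
    \<comment> \<open>This expands the vanishing determinant with rows \<open>(r, p, q)\<close>,
      \<open>(r, p, q)\<close> and the restriction of that row to \<open>U3\<close>. The components
      of \<open>a\<close> and \<open>b\<close> on \<open>W3\<close> vanished above because
      \<open>p\<close>, \<open>q\<close> and \<open>r\<close> have no constant term.\<close>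
    have "\<delta>1 r \<bullet> w = \<delta>1 p \<bullet> a \<boxplus> \<delta>1 q \<bullet> b"
    proof -
      have cl: "\<delta>1 r \<in> carrier T" "\<delta>1 p \<in> carrier T" "\<delta>1 q \<in> carrier T" "restr U3 p \<in> carrier T" "restr U3 q \<in> carrier T" "restr U3 r \<in> carrier T"
        using pq r by simp_all
      show ?thesis unfolding a_def b_def w_def using cl by algebra
    qed
    then have "r \<bullet> w \<boxminus> (p \<bullet> a \<boxplus> q \<bullet> b) \<in> I"
      using pq r w ab w1 w2 w3 ab1 ab2 ab3 by (simp add: minus_mem_I)
    then show ?thesis using ab by blast
  qed
  have "w \<boxminus> (p \<bullet> a \<boxplus> q \<bullet> b) \<notin> I" if ab: "a \<in> carrier T" "b \<in> carrier T" for a b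
  proof
    assume "w \<boxminus> (p \<bullet> a \<boxplus> q \<bullet> b) \<in> I"
    moreover have m: "p \<bullet> a \<boxplus> q \<bullet> b \<in> carrier T" using pq ab by simp
    ultimately have "\<delta>1 w = \<delta>1 (p \<bullet> a \<boxplus> q \<bullet> b)" "\<delta>2 w = \<delta>2 (p \<bullet> a \<boxplus> q \<bullet> b)" "\<delta>3 w = \<delta>3 (p \<bullet> a \<boxplus> q \<bullet> b)"
      unfolding minus_mem_I[OF w m] by blast+
    then have eq: "w = \<delta>1 p \<bullet> \<delta>1 a \<boxplus> \<delta>1 q \<bullet> \<delta>1 b" "0\<^sub>T = \<delta>2 p \<bullet> \<delta>2 a \<boxplus> \<delta>2 q \<bullet> \<delta>2 b" "0\<^sub>T = \<delta>3 p \<bullet> \<delta>3 a \<boxplus> \<delta>3 q \<bullet> \<delta>3 b"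
      unfolding w1 w2 w3 using pq(1,2) ab by simp_all
    \<comment> \<open>On \<open>B\<close> the element \<open>w\<close> is \<open>p\<close> times
      \<open>(restr U3 q, 0, 0)\<close> minus \<open>q\<close> times
      \<open>(restr U3 p, 0, 0)\<close>. Subtracting the supposed expression over \<open>A\<close>
      leaves a relation \<open>p s = q t\<close> on \<open>B\<close>, so \<open>s = q d\<close> and
      \<open>t = p d\<close>.\<close>
    define s1 where "s1 = restr U3 q \<boxminus> \<delta>1 a"
    define s2 where "s2 = 0\<^sub>T \<boxminus> \<delta>2 a"
    define s3 where "s3 = 0\<^sub>T \<boxminus> \<delta>3 a"
    define t1 where "t1 = restr U3 p \<boxplus> \<delta>1 b"
    have cl: "\<delta>1 p \<in> carrier T" "\<delta>2 p \<in> carrier T" "\<delta>3 p \<in> carrier T" "\<delta>1 q \<in> carrier T" "\<delta>2 q \<in> carrier T" "\<delta>3 q \<in> carrier T"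
      "\<delta>1 a \<in> carrier T" "\<delta>2 a \<in> carrier T" "\<delta>3 a \<in> carrier T" "\<delta>1 b \<in> carrier T" "\<delta>2 b \<in> carrier T" "\<delta>3 b \<in> carrier T"
      "restr U3 p \<in> carrier T" "restr U3 q \<in> carrier T"
      using pq ab by simp_all
    have st1: "\<delta>1 p \<bullet> s1 = \<delta>1 q \<bullet> t1"
    proof -
      have "\<delta>1 p \<bullet> s1 = (w \<boxplus> \<delta>1 q \<bullet> restr U3 p) \<boxminus> \<delta>1 p \<bullet> \<delta>1 a"
        unfolding s1_def w_def using cl by algebra
      also have "\<dots> = \<delta>1 q \<bullet> t1"
        unfolding eq(1) t1_def using cl by algebra
      finally show ?thesis .
    qed
    have neg: "p' \<bullet> (0\<^sub>T \<boxminus> a') = q' \<bullet> b'" if "0\<^sub>T = p' \<bullet> a' \<boxplus> q' \<bullet> b'"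
      "p' \<in> carrier T" "q' \<in> carrier T" "a' \<in> carrier T" "b' \<in> carrier T" for p' q' a' b'
    proof -
      have "p' \<bullet> (0\<^sub>T \<boxminus> a') = 0\<^sub>T \<boxminus> p' \<bullet> a'" using that(2-) by algebra
      also have "\<dots> = (p' \<bullet> a' \<boxplus> q' \<bullet> b') \<boxminus> p' \<bullet> a'" using that(1) by simp
      also have "\<dots> = q' \<bullet> b'" using that(2-) by algebra
      finally show ?thesis .
    qed
    have st2: "\<delta>2 p \<bullet> s2 = \<delta>2 q \<bullet> \<delta>2 b" unfolding s2_def using eq(2) cl by (intro neg)
    have st3: "\<delta>3 p \<bullet> s3 = \<delta>3 q \<bullet> \<delta>3 b" unfolding s3_def using eq(3) cl by (intro neg)
    have s_cl: "s1 \<in> carrier T" "s2 \<in> carrier T" "s3 \<in> carrier T" "\<delta>1 s1 = s1" "\<delta>2 s2 = s2" "\<delta>3 s3 = s3"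
      using pq ab by (simp_all add: s1_def s2_def s3_def)
    have t_cl: "t1 \<in> carrier T" "\<delta>2 b \<in> carrier T" "\<delta>3 b \<in> carrier T" "\<delta>1 t1 = t1" "\<delta>2 (\<delta>2 b) = \<delta>2 b" "\<delta>3 (\<delta>3 b) = \<delta>3 b"
      using pq ab by (simp_all add: t1_def)
    obtain d1 d2 d3 where d: "d1 \<in> carrier T" "d2 \<in> carrier T" "d3 \<in> carrier T"
      "s1 = \<delta>1 q \<bullet> d1" "t1 = \<delta>1 p \<bullet> d1" "s2 = \<delta>2 q \<bullet> d2" "\<delta>2 b = \<delta>2 p \<bullet> d2" "s3 = \<delta>3 q \<bullet> d3" "\<delta>3 b = \<delta>3 p \<bullet> d3"
      by (rule common_divisor[OF pq(1,2) N1 N2 s_cl t_cl st1 st2 st3])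
    note nz = regular_nonzero[OF pq(1) N1]
    have lin: "e \<bullet> u = e \<bullet> v \<Longrightarrow> e \<noteq> 0\<^sub>T \<Longrightarrow> u = v" if "e \<in> carrier T" "u \<in> carrier T" "v \<in> carrier T" for e u v
      using that by (simp add: T.m_lcancel)
    have eqU1: "restr U1 q \<bullet> restr U1 d2 = restr U1 q \<bullet> restr U1 d3" "restr U1 p \<bullet> restr U1 d2 = restr U1 p \<bullet> restr U1 d3"
    proof -
      have "restr U1 s2 = restr U1 s3" using ab by (simp add: s2_def s3_def)
      then show "restr U1 q \<bullet> restr U1 d2 = restr U1 q \<bullet> restr U1 d3"
        unfolding d(6,8) using pq d by simp
      have "restr U1 (\<delta>2 b) = restr U1 (\<delta>3 b)" by simp
      then show "restr U1 p \<bullet> restr U1 d2 = restr U1 p \<bullet> restr U1 d3"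
        unfolding d(7,9) using pq d by simp
    qed
    have eqU2: "restr U2 q \<bullet> restr U2 d1 = restr U2 q \<bullet> restr U2 d3" "restr U2 p \<bullet> restr U2 d1 = restr U2 p \<bullet> restr U2 d3"
    proof -
      have "restr U2 s1 = restr U2 s3" using ab pq by (simp add: s1_def s3_def)
      then show "restr U2 q \<bullet> restr U2 d1 = restr U2 q \<bullet> restr U2 d3"
        unfolding d(4,8) using pq d by simp
      have "restr U2 t1 = restr U2 (\<delta>3 b)" using ab pq by (simp add: t1_def)
      then show "restr U2 p \<bullet> restr U2 d1 = restr U2 p \<bullet> restr U2 d3"
        unfolding d(5,9) using pq d by simp
    qed
    have eqU3: "restr U3 q \<bullet> restr U3 d1 = restr U3 q \<bullet> (1\<^sub>T \<boxplus> restr U3 d2)" "restr U3 p \<bullet> restr U3 d1 = restr U3 p \<bullet> (1\<^sub>T \<boxplus> restr U3 d2)"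
    proof -
      have c: "restr U3 p \<in> carrier T" "restr U3 q \<in> carrier T" "restr U3 a \<in> carrier T" "restr U3 b \<in> carrier T" "restr U3 d2 \<in> carrier T"
        using pq ab d by simp_all
      have s2': "restr U3 s2 = restr U3 q \<bullet> restr U3 d2" unfolding d(6) using pq d by simp
      have b': "restr U3 b = restr U3 p \<bullet> restr U3 d2" using arg_cong[OF d(7), of "restr U3"] pq d(2) by simp
      have "restr U3 q \<bullet> restr U3 d1 = restr U3 s1" unfolding d(4) using pq d by simp
      also have "\<dots> = restr U3 q \<boxminus> restr U3 a" using pq ab by (simp add: s1_def)
      also have "\<dots> = restr U3 q \<boxplus> (0\<^sub>T \<boxminus> restr U3 a)" using c by algebra
      also have "0\<^sub>T \<boxminus> restr U3 a = restr U3 s2" using ab by (simp add: s2_def)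
      also have "restr U3 q \<boxplus> restr U3 s2 = restr U3 q \<boxplus> restr U3 q \<bullet> restr U3 d2" unfolding s2' ..
      also have "\<dots> = restr U3 q \<bullet> (1\<^sub>T \<boxplus> restr U3 d2)" using c by (simp add: T.r_distr)
      finally show "restr U3 q \<bullet> restr U3 d1 = restr U3 q \<bullet> (1\<^sub>T \<boxplus> restr U3 d2)" .
      have "restr U3 p \<bullet> restr U3 d1 = restr U3 t1" unfolding d(5) using pq d by simp
      also have "\<dots> = restr U3 p \<boxplus> restr U3 b" using pq ab c by (simp add: t1_def)
      also have "\<dots> = restr U3 p \<bullet> (1\<^sub>T \<boxplus> restr U3 d2)" unfolding b' using c by (simp add: T.r_distr)
      finally show "restr U3 p \<bullet> restr U3 d1 = restr U3 p \<bullet> (1\<^sub>T \<boxplus> restr U3 d2)" .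
    qed
    note not_both = regular_pair_not_both[OF pq(1,2) N2']
    have nb1: "restr U1 p \<noteq> 0\<^sub>T \<or> restr U1 q \<noteq> 0\<^sub>T"
      by (rule ccontr, rule not_both[where W = W2 and W' = W3 and W'' = W1 and v = v1]) (use nz in \<open>auto simp: mem_I\<close>)
    have nb2: "restr U2 p \<noteq> 0\<^sub>T \<or> restr U2 q \<noteq> 0\<^sub>T"
      by (rule ccontr, rule not_both[where W = W1 and W' = W3 and W'' = W2 and v = v2]) (use nz in \<open>auto simp: mem_I\<close>)
    have nb3: "restr U3 p \<noteq> 0\<^sub>T \<or> restr U3 q \<noteq> 0\<^sub>T"
      by (rule ccontr, rule not_both[where W = W1 and W' = W2 and W'' = W3 and v = v3]) (use nz in \<open>auto simp: mem_I\<close>)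
    have 1: "restr U1 d2 = restr U1 d3"
      using nb1 eqU1 lin[of "restr U1 p" "restr U1 d2" "restr U1 d3"] lin[of "restr U1 q" "restr U1 d2" "restr U1 d3"] pq d by auto
    have 2: "restr U2 d1 = restr U2 d3"
      using nb2 eqU2 lin[of "restr U2 p" "restr U2 d1" "restr U2 d3"] lin[of "restr U2 q" "restr U2 d1" "restr U2 d3"] pq d by auto
    have 3: "restr U3 d1 = 1\<^sub>T \<boxplus> restr U3 d2"
      using nb3 eqU3 lin[of "restr U3 p" "restr U3 d1" "1\<^sub>T \<boxplus> restr U3 d2"] lin[of "restr U3 q" "restr U3 d1" "1\<^sub>T \<boxplus> restr U3 d2"] pq d by auto
    \<comment> \<open>As \<open>a\<close> and \<open>b\<close> come from \<open>A\<close>, the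
      components of \<open>d\<close> agree on the overlaps except on \<open>U3\<close>, where they
      differ by one. All overlaps share the constant term, so going around the three components
      gives \<open>0 = 1\<close>.\<close>
    have "restr {} d2 = restr {} d3" using arg_cong[OF 1, of "restr {}"] by simp
    moreover have "restr {} d1 = restr {} d3" using arg_cong[OF 2, of "restr {}"] by simp
    moreover have "restr {} d1 = 1\<^sub>T \<boxplus> restr {} d2" using arg_cong[OF 3, of "restr {}"] d by simp
    ultimately have "0\<^sub>T \<boxplus> restr {} d3 = 1\<^sub>T \<boxplus> restr {} d3" using d by simp
    then have "0\<^sub>T = 1\<^sub>T" using d by (subst (asm) T.add.r_cancel) auto
    then show False by simp
  qed
  then show ?thesis using w small by blast
qed

end


section \<open>Depth and dimension of A\<close>

context cring
begin

lemma regular_mod_ideal_iff: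
  assumes J: "ideal J R" and a: "a \<in> carrier R"
  shows "J +> a \<in> nonzerodivisors (R Quot J) \<longleftrightarrow> (\<forall>b\<in>carrier R. a \<otimes> b \<in> J \<longrightarrow> b \<in> J)"
proof -
  interpret J: ideal J R by fact
  interpret h: surj_ring_hom R "R Quot J" "(+>) J" by (rule J.quot_surj_hom[OF is_cring])
  have z: "J +> b = \<zero>\<^bsub>R Quot J\<^esub> \<longleftrightarrow> b \<in> J" if "b \<in> carrier R" for b
    using that J.quot_Ker[OF is_cring] h.Ker_iff by blast
  have "J +> a \<in> nonzerodivisors (R Quot J) \<longleftrightarrow>
    (\<forall>b\<in>carrier R. (J +> a) \<otimes>\<^bsub>R Quot J\<^esub> (J +> b) = \<zero>\<^bsub>R Quot J\<^esub> \<longrightarrow> J +> b = \<zero>\<^bsub>R Quot J\<^esub>)"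
    unfolding nonzerodivisors_def h.surj[symmetric] using a by blast
  also have "\<dots> \<longleftrightarrow> (\<forall>b\<in>carrier R. a \<otimes> b \<in> J \<longrightarrow> b \<in> J)"
    using z a by (metis (no_types, lifting) h.hom_mult m_closed)
  finally show ?thesis .
qed

lemma Idl_empty: "Idl {} = {\<zero>}"
  using genideal_minimal[OF zeroideal, of "{}"] additive_subgroup.zero_closed[OF ideal.axioms(1)[OF genideal_ideal[of "{}"]]]
  by blast

lemma Idl_single: "a \<in> carrier R \<Longrightarrow> b \<in> Idl {a} \<longleftrightarrow> (\<exists>u\<in>carrier R. b = a \<otimes> u)"
  by (subst cgenideal_eq_genideal[symmetric]) (auto simp: cgenideal_def m_comm)

lemma Idl_pair:
  assumes ab: "a \<in> carrier R" "b \<in> carrier R"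
  shows "c \<in> Idl {a, b} \<longleftrightarrow> (\<exists>u\<in>carrier R. \<exists>v\<in>carrier R. c = a \<otimes> u \<oplus> b \<otimes> v)"
proof
  have sub: "{a, b} \<subseteq> carrier R" using ab by simp
  interpret J: ideal "Idl {a, b}" R using sub by (rule genideal_ideal)
  assume "\<exists>u\<in>carrier R. \<exists>v\<in>carrier R. c = a \<otimes> u \<oplus> b \<otimes> v"
  then show "c \<in> Idl {a, b}"
    using genideal_self[OF sub] J.I_r_closed J.a_closed by blast
next
  assume c: "c \<in> Idl {a, b}"
  have "ideal (PIdl a <+> PIdl b) R"
    using ab by (intro add_ideals cgenideal_ideal)
  moreover have "{a, b} \<subseteq> PIdl a <+> PIdl b"
  proof -
    have "a = \<one> \<otimes> a \<oplus> \<zero> \<otimes> b" "b = \<zero> \<otimes> a \<oplus> \<one> \<otimes> b" using ab by simp_all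
    then show ?thesis
      unfolding set_add_def' cgenideal_def by blast
  qed
  ultimately have "c \<in> PIdl a <+> PIdl b"
    using c genideal_minimal by blast
  then obtain u v where "u \<in> carrier R" "v \<in> carrier R" "c = u \<otimes> a \<oplus> v \<otimes> b"
    unfolding set_add_def' cgenideal_def by blast
  then show "\<exists>u\<in>carrier R. \<exists>v\<in>carrier R. c = a \<otimes> u \<oplus> b \<otimes> v"
    using ab by (metis m_comm)
qed

end

lemma (in primeideal) prime_contains_Int:
  assumes "ideal A R" "ideal B R" "ideal C R" "A \<inter> B \<inter> C \<subseteq> I"
  shows "A \<subseteq> I \<or> B \<subseteq> I \<or> C \<subseteq> I"
proof (rule ccontr)
  assume "\<not> ?thesis"
  then obtain a b c where abc: "a \<in> A" "a \<notin> I" "b \<in> B" "b \<notin> I" "c \<in> C" "c \<notin> I" by blast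
  have cl: "a \<in> carrier R" "b \<in> carrier R" "c \<in> carrier R"
    using abc ideal.Icarr assms by metis+
  have "a \<otimes> (b \<otimes> c) \<in> A" "a \<otimes> (b \<otimes> c) \<in> B" "a \<otimes> (b \<otimes> c) \<in> C"
    using abc cl assms ideal.I_l_closed ideal.I_r_closed by (metis m_closed)+
  then have "a \<otimes> (b \<otimes> c) \<in> I" using assms(4) by blast
  then show False using I_prime abc cl by blast
qed

context three_blocks
begin

abbreviation \<pi> where "\<pi> \<equiv> (+>\<^bsub>T\<^esub>) I"
abbreviation A where "A \<equiv> T Quot I"

sublocale I: ideal I "PS V"
  by (rule I_ideal)

sublocale h: surj_ring_hom "PS V" "PS V Quot I" "(+>\<^bsub>PS V\<^esub>) I"
  by (rule I.quot_surj_hom[OF T.is_cring])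

lemma \<pi>_eq: "f \<in> carrier T \<Longrightarrow> g \<in> carrier T \<Longrightarrow> \<pi> f = \<pi> g \<longleftrightarrow> f \<boxminus> g \<in> I"
  using T.quotient_eq_iff_same_a_r_cos[OF I_ideal] by blast

lemma Ker_eq: "h.Ker = I"
  by (rule I.quot_Ker[OF T.is_cring])

lemma \<pi>_zero: "f \<in> carrier T \<Longrightarrow> \<pi> f = \<zero>\<^bsub>A\<^esub> \<longleftrightarrow> f \<in> I"
  using Ker_eq h.Ker_iff by blast

lemma mem_vanishing_empty: "f \<in> vanishing V {} \<longleftrightarrow> f \<in> carrier T \<and> restr {} f = 0\<^sub>T"
  by (simp add: vanishing_def PS_ops)

lemma I_subset: "W \<in> {W1, W2, W3} \<Longrightarrow> I \<subseteq> vanishing V W"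
  by (auto simp: I_def)

lemma A_local: "local_with A (\<pi> ` vanishing V {})"
proof -
  have "I \<subseteq> vanishing V {}"
    using I_subset[of W1] vanishing_mono[of "{}" W1 V] by blast
  then show ?thesis
    by (intro h.image_local PS_local) (simp add: Ker_eq)
qed

lemma A_maximal: "maximal_ideal_of A = \<pi> ` vanishing V {}"
  by (rule h.S.local_with_local(2)[OF A_local])

theorem depth_A: "depth A = 2"
proof -
  have len: "length xs \<le> 2" if xs: "set xs \<subseteq> maximal_ideal_of A" "regular_sequence A xs" for xs
  proof (rule ccontr)
    assume "\<not> length xs \<le> 2"
    then obtain a b c ys where ys: "xs = a # b # c # ys"
      by (metis One_nat_def Suc_1 Suc_leI length_Cons less_2_cases_iff list.size(3) not_less_eq_eq neq_Nil_conv nle_le numeral_2_eq_2 zero_le)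
    obtain p where p: "a = \<pi> p" "p \<in> vanishing V {}" using xs(1) ys by (auto simp: A_maximal)
    obtain q where q: "b = \<pi> q" "q \<in> vanishing V {}" using xs(1) ys by (auto simp: A_maximal)
    obtain r where r: "c = \<pi> r" "r \<in> vanishing V {}" using xs(1) ys by (auto simp: A_maximal)
    note pqr = p(2)[unfolded mem_vanishing_empty] q(2)[unfolded mem_vanishing_empty] r(2)[unfolded mem_vanishing_empty]
    have cl: "a \<in> carrier A" "b \<in> carrier A" "c \<in> carrier A"
      unfolding p(1) q(1) r(1) using pqr by auto
    have reg: "Idl\<^bsub>A\<^esub> (set (take i xs)) +>\<^bsub>A\<^esub> (xs ! i) \<in> nonzerodivisors (A Quot Idl\<^bsub>A\<^esub> (set (take i xs)))" if "i < 3" for i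
      using xs(2) that ys by (simp add: regular_sequence_def Let_def)
    have r0: "\<forall>v\<in>carrier A. a \<otimes>\<^bsub>A\<^esub> v \<in> {\<zero>\<^bsub>A\<^esub>} \<longrightarrow> v \<in> {\<zero>\<^bsub>A\<^esub>}"
    proof (rule iffD1[OF h.S.regular_mod_ideal_iff[OF h.S.zeroideal cl(1)]])
      show "{\<zero>\<^bsub>A\<^esub>} +>\<^bsub>A\<^esub> a \<in> nonzerodivisors (A Quot {\<zero>\<^bsub>A\<^esub>})"
        using reg[of 0] by (simp add: ys h.S.Idl_empty)
    qed
    have r1: "\<forall>v\<in>carrier A. b \<otimes>\<^bsub>A\<^esub> v \<in> Idl\<^bsub>A\<^esub> {a} \<longrightarrow> v \<in> Idl\<^bsub>A\<^esub> {a}"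
    proof (rule iffD1[OF h.S.regular_mod_ideal_iff[OF h.S.genideal_ideal cl(2)]])
      show "Idl\<^bsub>A\<^esub> {a} +>\<^bsub>A\<^esub> b \<in> nonzerodivisors (A Quot Idl\<^bsub>A\<^esub> {a})"
        using reg[of 1] by (simp add: ys)
    qed (use cl in simp)
    have r2: "\<forall>v\<in>carrier A. c \<otimes>\<^bsub>A\<^esub> v \<in> Idl\<^bsub>A\<^esub> {a, b} \<longrightarrow> v \<in> Idl\<^bsub>A\<^esub> {a, b}"
    proof (rule iffD1[OF h.S.regular_mod_ideal_iff[OF h.S.genideal_ideal cl(3)]])
      show "Idl\<^bsub>A\<^esub> {a, b} +>\<^bsub>A\<^esub> c \<in> nonzerodivisors (A Quot Idl\<^bsub>A\<^esub> {a, b})"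
        using reg[of 2] by (simp add: ys numeral_2_eq_2)
    qed (use cl in simp)
    have N1: "g \<in> I" if g: "g \<in> carrier T" "p \<bullet> g \<in> I" for g
    proof -
      have "a \<otimes>\<^bsub>A\<^esub> \<pi> g = \<pi> (p \<bullet> g)" using g pqr by (simp add: p)
      also have "\<dots> = \<zero>\<^bsub>A\<^esub>" using g pqr by (subst \<pi>_zero) auto
      finally show ?thesis
        using bspec[OF r0 h.hom_closed[OF g(1)]] \<pi>_zero[OF g(1)] by simp
    qed
    have N2: "\<exists>u\<in>carrier T. g \<boxminus> p \<bullet> u \<in> I" if g: "g \<in> carrier T" "k \<in> carrier T" "q \<bullet> g \<boxminus> p \<bullet> k \<in> I" for g k
    proof -
      have "b \<otimes>\<^bsub>A\<^esub> \<pi> g = \<pi> (q \<bullet> g)" using g pqr by (simp add: q)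
      also have "\<dots> = \<pi> (p \<bullet> k)" using g pqr by (subst \<pi>_eq) auto
      also have "\<dots> = a \<otimes>\<^bsub>A\<^esub> \<pi> k" using g pqr by (simp add: p)
      finally have "b \<otimes>\<^bsub>A\<^esub> \<pi> g \<in> Idl\<^bsub>A\<^esub> {a}"
        using h.S.Idl_single[OF cl(1)] h.hom_closed g(2) by blast
      then have "\<pi> g \<in> Idl\<^bsub>A\<^esub> {a}" using r1 h.hom_closed g(1) by blast
      then obtain v where v: "v \<in> carrier A" "\<pi> g = a \<otimes>\<^bsub>A\<^esub> v"
        using h.S.Idl_single[OF cl(1)] by blast
      obtain u where u: "u \<in> carrier T" "v = \<pi> u" using v(1) by (rule h.surjE)
      have "\<pi> g = \<pi> (p \<bullet> u)" unfolding v(2) u(2) using u(1) pqr by (simp add: p)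
      then have "g \<boxminus> p \<bullet> u \<in> I" using g u pqr by (subst (asm) \<pi>_eq) auto
      then show ?thesis using u(1) by blast
    qed
    have pq0: "p \<in> carrier T" "q \<in> carrier T" "restr {} p = 0\<^sub>T" "restr {} q = 0\<^sub>T"
      using pqr by simp_all
    have N1': "\<forall>g\<in>carrier T. p \<bullet> g \<in> I \<longrightarrow> g \<in> I" using N1 by blast
    have N2': "\<forall>g\<in>carrier T. \<forall>k\<in>carrier T. q \<bullet> g \<boxminus> p \<bullet> k \<in> I \<longrightarrow> (\<exists>a\<in>carrier T. g \<boxminus> p \<bullet> a \<in> I)"
      using N2 by blast
    obtain w where w: "w \<in> carrier T"
      "\<forall>a\<in>carrier T. \<forall>b\<in>carrier T. w \<boxminus> (p \<bullet> a \<boxplus> q \<bullet> b) \<notin> I"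
      "\<forall>r\<in>carrier T. restr {} r = 0\<^sub>T \<longrightarrow> (\<exists>a\<in>carrier T. \<exists>b\<in>carrier T. r \<bullet> w \<boxminus> (p \<bullet> a \<boxplus> q \<bullet> b) \<in> I)"
      using socle_element[OF pq0 N1' N2'] by blast
    have comb: "\<pi> k \<in> Idl\<^bsub>A\<^esub> {a, b} \<longleftrightarrow> (\<exists>u\<in>carrier T. \<exists>v\<in>carrier T. k \<boxminus> (p \<bullet> u \<boxplus> q \<bullet> v) \<in> I)"
      if k: "k \<in> carrier T" for k
    proof -
      have "(\<exists>u\<in>carrier A. \<exists>v\<in>carrier A. \<pi> k = a \<otimes>\<^bsub>A\<^esub> u \<oplus>\<^bsub>A\<^esub> b \<otimes>\<^bsub>A\<^esub> v)
        \<longleftrightarrow> (\<exists>u\<in>carrier T. \<exists>v\<in>carrier T. \<pi> k = a \<otimes>\<^bsub>A\<^esub> \<pi> u \<oplus>\<^bsub>A\<^esub> b \<otimes>\<^bsub>A\<^esub> \<pi> v)"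
        unfolding h.surj[symmetric] by blast
      moreover have "\<pi> k = a \<otimes>\<^bsub>A\<^esub> \<pi> u \<oplus>\<^bsub>A\<^esub> b \<otimes>\<^bsub>A\<^esub> \<pi> v \<longleftrightarrow> k \<boxminus> (p \<bullet> u \<boxplus> q \<bullet> v) \<in> I"
        if "u \<in> carrier T" "v \<in> carrier T" for u v
      proof -
        have "a \<otimes>\<^bsub>A\<^esub> \<pi> u \<oplus>\<^bsub>A\<^esub> b \<otimes>\<^bsub>A\<^esub> \<pi> v = \<pi> (p \<bullet> u \<boxplus> q \<bullet> v)"
          using that pqr by (simp add: p q)
        then show ?thesis using that k pqr \<pi>_eq[of k "p \<bullet> u \<boxplus> q \<bullet> v"] by simp
      qed
      ultimately show ?thesis unfolding h.S.Idl_pair[OF cl(1,2)] by blast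
    qed
    \<comment> \<open>The third element multiplies the class of \<open>w\<close> into
      \<open>(a, b)\<close> while \<open>w\<close> itself stays outside, against regularity of the
      third element.\<close>
    have "\<pi> (r \<bullet> w) \<in> Idl\<^bsub>A\<^esub> {a, b}"
      using bspec[OF w(3), of r] pqr w(1) by (subst comb) auto
    then have "c \<otimes>\<^bsub>A\<^esub> \<pi> w \<in> Idl\<^bsub>A\<^esub> {a, b}" using w(1) pqr by (simp add: r)
    then have "\<pi> w \<in> Idl\<^bsub>A\<^esub> {a, b}" using r2 w(1) h.hom_closed by blast
    then show False using comb[OF w(1)] w(2) by blast
  qed
  have e0: "e2 \<in> vanishing V {}" "e1 \<in> vanishing V {}"
    unfolding mem_vanishing_empty by (simp_all add: e1_def e2_def)
  have ec: "\<pi> e2 \<in> carrier A" "\<pi> e1 \<in> carrier A" by simp_all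
  have reg: "regular_sequence A [\<pi> e2, \<pi> e1]"
    unfolding regular_sequence_def Let_def
  proof (intro conjI allI impI)
    show "set [\<pi> e2, \<pi> e1] \<subseteq> carrier A" using ec by simp
    have M: "ideal (\<pi> ` vanishing V {}) A" "\<one>\<^bsub>A\<^esub> \<notin> \<pi> ` vanishing V {}"
      using A_local by (simp_all add: local_with_def)
    have "Idl\<^bsub>A\<^esub> (set [\<pi> e2, \<pi> e1]) \<subseteq> \<pi> ` vanishing V {}"
      using e0 by (intro h.S.genideal_minimal M) auto
    then show "Idl\<^bsub>A\<^esub> (set [\<pi> e2, \<pi> e1]) \<noteq> carrier A" using M(2) h.S.one_closed by blast
    fix i assume "i < length [\<pi> e2, \<pi> e1]"
    then have "i = 0 \<or> i = 1" by auto
    then show "Idl\<^bsub>A\<^esub> (set (take i [\<pi> e2, \<pi> e1])) +>\<^bsub>A\<^esub> [\<pi> e2, \<pi> e1] ! i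
      \<in> nonzerodivisors (A Quot Idl\<^bsub>A\<^esub> (set (take i [\<pi> e2, \<pi> e1])))"
    proof
      assume i: "i = 0"
      have "v = \<zero>\<^bsub>A\<^esub>" if v: "v \<in> carrier A" "\<pi> e2 \<otimes>\<^bsub>A\<^esub> v = \<zero>\<^bsub>A\<^esub>" for v
      proof -
        obtain g where g: "g \<in> carrier T" "v = \<pi> g" using v(1) by (rule h.surjE)
        have "\<pi> (e2 \<bullet> g) = \<zero>\<^bsub>A\<^esub>" using v(2) g by simp
        then have "e2 \<bullet> g \<in> I" using g by (subst (asm) \<pi>_zero) auto
        then show ?thesis using e2_regular[OF g(1)] g \<pi>_zero by blast
      qed
      then show ?thesis
        unfolding i using h.S.regular_mod_ideal_iff[OF h.S.zeroideal ec(1)] by (simp add: h.S.Idl_empty)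
    next
      assume i: "i = 1"
      have step: "v \<in> Idl\<^bsub>A\<^esub> {\<pi> e2}" if v: "v \<in> carrier A" "\<pi> e1 \<otimes>\<^bsub>A\<^esub> v \<in> Idl\<^bsub>A\<^esub> {\<pi> e2}" for v
      proof -
        obtain g where g: "g \<in> carrier T" "v = \<pi> g" using v(1) by (rule h.surjE)
        obtain k where k: "k \<in> carrier A" "\<pi> e1 \<otimes>\<^bsub>A\<^esub> v = \<pi> e2 \<otimes>\<^bsub>A\<^esub> k"
          using v(2) h.S.Idl_single[OF ec(1)] by blast
        obtain u where u: "u \<in> carrier T" "k = \<pi> u" using k(1) by (rule h.surjE)
        have "\<pi> (e1 \<bullet> g) = \<pi> (e2 \<bullet> u)" using k(2) g u by simp
        then have "e1 \<bullet> g \<boxminus> e2 \<bullet> u \<in> I" using g u by (subst (asm) \<pi>_eq) auto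
        then obtain b where b: "b \<in> carrier T" "g \<boxminus> e2 \<bullet> b \<in> I"
          using e2_e1_regular[OF g(1) u(1)] by blast
        have "v = \<pi> (e2 \<bullet> b)" using g b by (simp only: \<pi>_eq T.m_closed e_closed)
        then show ?thesis using h.S.Idl_single[OF ec(1)] b(1) h.hom_closed by auto
      qed
      show ?thesis
      proof -
        have "{\<pi> e2} \<subseteq> carrier A" using ec(1) by simp
        then have "Idl\<^bsub>A\<^esub> {\<pi> e2} +>\<^bsub>A\<^esub> \<pi> e1 \<in> nonzerodivisors (A Quot Idl\<^bsub>A\<^esub> {\<pi> e2})"
          using step by (intro iffD2[OF h.S.regular_mod_ideal_iff[OF h.S.genideal_ideal ec(2)]]) blast+
        then show ?thesis unfolding i by simp
      qed
    qed
  qed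
  have mem: "set [\<pi> e2, \<pi> e1] \<subseteq> maximal_ideal_of A"
    using e0 by (auto simp: A_maximal)
  show ?thesis
    unfolding depth_def
  proof (rule antisym)
    show "Sup {enat (length xs) |xs. set xs \<subseteq> maximal_ideal_of A \<and> regular_sequence A xs} \<le> 2"
      using len by (intro Sup_least) (auto simp: numeral_eq_enat)
    have "enat (length [\<pi> e2, \<pi> e1]) \<le> Sup {enat (length xs) |xs. set xs \<subseteq> maximal_ideal_of A \<and> regular_sequence A xs}"
      using mem reg by (intro Sup_upper) blast
    then show "2 \<le> Sup {enat (length xs) |xs. set xs \<subseteq> maximal_ideal_of A \<and> regular_sequence A xs}"
      by (simp add: numeral_eq_enat numeral_2_eq_2)
  qed
qed

lemma prime_cover:
  assumes P: "primeideal P T" "I \<subseteq> P"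
  shows "\<exists>W\<in>{W1, W2, W3}. vanishing V W \<subseteq> P"
  using primeideal.prime_contains_Int[OF P(1) vanishing_ideal vanishing_ideal vanishing_ideal, of W1 W2 W3] P(2)
  by (auto simp: I_def)

theorem krull_dim_A:
  assumes "card U1 = m" "card U2 = m" "card U3 = m"
  shows "krull_dim A = enat (2 * m)"
proof (rule krull_dim_quotient[where Ws = "{W1, W2, W3}"])
  show "finite V" using fin by (simp add: V_def)
  show "W \<subseteq> V \<and> card W = 2 * m \<and> I \<subseteq> vanishing V W" if "W \<in> {W1, W2, W3}" for W
    using that assms fin disj I_subset[OF that]
    by (auto simp: W1_def W2_def W3_def V_def card_Un_disjoint)
qed (use prime_cover I_ideal in auto)

end


section \<open>The total ring of fractions and the embedding of B\<close>

context three_blocks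
begin

text \<open>The representatives in \<open>T\<close> of the nonzerodivisors of \<open>A\<close>; with
  them fractions are computed on series instead of cosets.\<close>

definition nzd where "nzd = {s \<in> carrier T. \<forall>g\<in>carrier T. s \<bullet> g \<in> I \<longrightarrow> g \<in> I}"

lemma nzd_nonzero: "s \<in> nzd \<Longrightarrow> \<delta>1 s \<noteq> 0\<^sub>T \<and> \<delta>2 s \<noteq> 0\<^sub>T \<and> \<delta>3 s \<noteq> 0\<^sub>T"
proof -
  assume s: "s \<in> nzd"
  have "g \<in> I" if "g \<in> carrier T" "s \<bullet> g \<in> I" for g
    using s that unfolding nzd_def by blast
  moreover have "s \<in> carrier T"
    using s unfolding nzd_def by blast
  ultimately show ?thesis
    using regular_nonzero[of s] by blast
qed

lemma nzd_carrier: "s \<in> nzd \<Longrightarrow> s \<in> carrier T"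
  unfolding nzd_def by blast

lemma e2_nzd: "e2 \<in> nzd"
  unfolding nzd_def using e2_regular e_closed(1) by blast

lemma one_nzd: "1\<^sub>T \<in> nzd"
  by (simp add: nzd_def)

lemma nonzerodivisors_A: "nonzerodivisors A = \<pi> ` nzd"
proof -
  have *: "\<pi> s \<in> nonzerodivisors A \<longleftrightarrow> s \<in> nzd" if s: "s \<in> carrier T" for s
  proof -
    have "\<pi> s \<otimes>\<^bsub>A\<^esub> \<pi> g = \<zero>\<^bsub>A\<^esub> \<longleftrightarrow> s \<bullet> g \<in> I" if g: "g \<in> carrier T" for g
      using \<pi>_zero[of "s \<bullet> g"] s g by simp
    then show ?thesis
      unfolding nonzerodivisors_def nzd_def h.surj[symmetric] using s \<pi>_zero by auto
  qed
  show ?thesis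
  proof
    show "nonzerodivisors A \<subseteq> \<pi> ` nzd"
    proof
      fix a assume a: "a \<in> nonzerodivisors A"
      then have "a \<in> carrier A" by (simp add: nonzerodivisors_def)
      then obtain s where s: "s \<in> carrier T" "a = \<pi> s" by (rule h.surjE)
      then show "a \<in> \<pi> ` nzd" using * a by blast
    qed
    show "\<pi> ` nzd \<subseteq> nonzerodivisors A" using * nzd_carrier by blast
  qed
qed

sublocale Q: mult_subset "PS V Quot I" "nonzerodivisors (PS V Quot I)"
  by (rule h.S.mult_subset_nonzerodivisors)

definition frac where "frac f s = fraction A (nonzerodivisors A) (\<pi> f) (\<pi> s)"

text \<open>The multiplier in the equality of fractions is a nonzerodivisor and cancels.\<close>

lemma frac_eq:
  assumes "f \<in> carrier T" "s \<in> nzd" "g \<in> carrier T" "t \<in> nzd"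
  shows "frac f s = frac g t \<longleftrightarrow> t \<bullet> f \<boxminus> s \<bullet> g \<in> I"
proof -
  note cl = assms(1,3) assms(2,4)[THEN nzd_carrier]
  have m: "\<pi> s \<in> nonzerodivisors A" "\<pi> t \<in> nonzerodivisors A"
    using assms nonzerodivisors_A by auto
  have "frac f s = frac g t \<longleftrightarrow>
      (\<exists>u\<in>nzd. \<pi> u \<otimes>\<^bsub>A\<^esub> (\<pi> t \<otimes>\<^bsub>A\<^esub> \<pi> f) = \<pi> u \<otimes>\<^bsub>A\<^esub> (\<pi> s \<otimes>\<^bsub>A\<^esub> \<pi> g))"
    unfolding frac_def using cl m by (subst Q.fraction_eq_iff) (auto simp: nonzerodivisors_A)
  also have "\<dots> \<longleftrightarrow> (\<exists>u\<in>nzd. u \<bullet> (t \<bullet> f \<boxminus> s \<bullet> g) \<in> I)"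
  proof (rule bex_cong[OF refl])
    fix u assume u: "u \<in> nzd"
    note uc = nzd_carrier[OF u]
    have "u \<bullet> (t \<bullet> f) \<boxminus> u \<bullet> (s \<bullet> g) = u \<bullet> (t \<bullet> f \<boxminus> s \<bullet> g)"
      using uc cl by algebra
    moreover have "\<pi> u \<otimes>\<^bsub>A\<^esub> (\<pi> t \<otimes>\<^bsub>A\<^esub> \<pi> f) = \<pi> (u \<bullet> (t \<bullet> f))" "\<pi> u \<otimes>\<^bsub>A\<^esub> (\<pi> s \<otimes>\<^bsub>A\<^esub> \<pi> g) = \<pi> (u \<bullet> (s \<bullet> g))"
      using uc cl by simp_all
    ultimately show "(\<pi> u \<otimes>\<^bsub>A\<^esub> (\<pi> t \<otimes>\<^bsub>A\<^esub> \<pi> f) = \<pi> u \<otimes>\<^bsub>A\<^esub> (\<pi> s \<otimes>\<^bsub>A\<^esub> \<pi> g)) = (u \<bullet> (t \<bullet> f \<boxminus> s \<bullet> g) \<in> I)"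
      using \<pi>_eq[of "u \<bullet> (t \<bullet> f)" "u \<bullet> (s \<bullet> g)"] uc cl by simp
  qed
  also have "\<dots> \<longleftrightarrow> t \<bullet> f \<boxminus> s \<bullet> g \<in> I"
  proof
    have d: "t \<bullet> f \<boxminus> s \<bullet> g \<in> carrier T" using cl by simp
    show "t \<bullet> f \<boxminus> s \<bullet> g \<in> I" if "\<exists>u\<in>nzd. u \<bullet> (t \<bullet> f \<boxminus> s \<bullet> g) \<in> I"
      using that d unfolding nzd_def by blast
    show "\<exists>u\<in>nzd. u \<bullet> (t \<bullet> f \<boxminus> s \<bullet> g) \<in> I" if "t \<bullet> f \<boxminus> s \<bullet> g \<in> I"
      using that d one_nzd by (intro bexI[of _ "1\<^sub>T"]) auto
  qed
  finally show ?thesis .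
qed

lemma frac_eqI:
  assumes "f \<in> carrier T" "s \<in> nzd" "g \<in> carrier T" "t \<in> nzd"
    and "\<delta>1 t \<bullet> \<delta>1 f = \<delta>1 s \<bullet> \<delta>1 g" "\<delta>2 t \<bullet> \<delta>2 f = \<delta>2 s \<bullet> \<delta>2 g" "\<delta>3 t \<bullet> \<delta>3 f = \<delta>3 s \<bullet> \<delta>3 g"
  shows "frac f s = frac g t"
  using assms nzd_carrier[OF assms(2)] nzd_carrier[OF assms(4)]
  by (simp add: frac_eq minus_mem_I)

lemma frac_carrier: "F \<in> carrier (total_fractions A) \<longleftrightarrow> (\<exists>f\<in>carrier T. \<exists>s\<in>nzd. F = frac f s)"
  unfolding total_fractions_def Q.carrier_localization frac_def
  unfolding h.surj[symmetric] nonzerodivisors_A by blast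

lemma nzd_mult: "s \<in> nzd \<Longrightarrow> t \<in> nzd \<Longrightarrow> s \<bullet> t \<in> nzd"
proof -
  assume s: "s \<in> nzd" and t: "t \<in> nzd"
  note st = nzd_carrier[OF s] nzd_carrier[OF t]
  have "g \<in> I" if g: "g \<in> carrier T" "s \<bullet> t \<bullet> g \<in> I" for g
  proof -
    have "s \<bullet> (t \<bullet> g) \<in> I" "t \<bullet> g \<in> carrier T"
      using g st by (simp_all only: T.m_assoc T.m_closed)
    then show ?thesis
      using s t g(1) unfolding nzd_def by blast
  qed
  then show ?thesis
    unfolding nzd_def using st T.m_closed by blast
qed

lemma frac_mult:
  assumes "f \<in> carrier T" "s \<in> nzd" "g \<in> carrier T" "t \<in> nzd"
  shows "frac f s \<otimes>\<^bsub>total_fractions A\<^esub> frac g t = frac (f \<bullet> g) (s \<bullet> t)"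
  using assms assms(2,4)[THEN nzd_carrier] unfolding total_fractions_def frac_def
  by (subst Q.localization_mult) (auto simp: nonzerodivisors_A)

lemma frac_add:
  assumes "f \<in> carrier T" "s \<in> nzd" "g \<in> carrier T" "t \<in> nzd"
  shows "frac f s \<oplus>\<^bsub>total_fractions A\<^esub> frac g t = frac (t \<bullet> f \<boxplus> s \<bullet> g) (s \<bullet> t)"
  using assms assms(2,4)[THEN nzd_carrier] unfolding total_fractions_def frac_def
  by (subst Q.localization_add) (auto simp: nonzerodivisors_A)

lemma frac_one: "\<one>\<^bsub>total_fractions A\<^esub> = frac 1\<^sub>T 1\<^sub>T"
  unfolding total_fractions_def Q.localization_one_zero frac_def by simp

lemma to_fractions_\<pi>: "to_fractions A (\<pi> f) = frac f 1\<^sub>T"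
  by (simp add: to_fractions_def frac_def)

lemma frac_mult_mem_iff:
  assumes "f \<in> carrier T" "g \<in> carrier T" "s \<in> nzd"
  shows "to_fractions A (\<pi> f) \<otimes>\<^bsub>total_fractions A\<^esub> frac g s \<in> to_fractions A ` carrier A
    \<longleftrightarrow> (\<exists>k\<in>carrier T. f \<bullet> g \<boxminus> s \<bullet> k \<in> I)"
proof -
  have "to_fractions A (\<pi> f) \<otimes>\<^bsub>total_fractions A\<^esub> frac g s = frac (f \<bullet> g) s"
    using assms one_nzd nzd_carrier by (simp add: to_fractions_\<pi> frac_mult)
  moreover have "frac (f \<bullet> g) s = to_fractions A (\<pi> k) \<longleftrightarrow> f \<bullet> g \<boxminus> s \<bullet> k \<in> I" if "k \<in> carrier T" for k
    using assms one_nzd that by (simp add: to_fractions_\<pi> frac_eq)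
  ultimately show ?thesis
    unfolding h.surj[symmetric] by (auto simp: image_iff)
qed

abbreviation P1 where "P1 \<equiv> vanishing V W1"
abbreviation P2 where "P2 \<equiv> vanishing V W2"
abbreviation P3 where "P3 \<equiv> vanishing V W3"
abbreviation B where "B \<equiv> RDirProd (T Quot P1) (RDirProd (T Quot P2) (T Quot P3))"
definition diag where "diag b1 b2 b3 = (P1 +>\<^bsub>T\<^esub> b1, P2 +>\<^bsub>T\<^esub> b2, P3 +>\<^bsub>T\<^esub> b3)"

sublocale h1: surj_ring_hom "PS V" "PS V Quot vanishing V W1" "(+>\<^bsub>PS V\<^esub>) (vanishing V W1)"
  by (intro ideal.quot_surj_hom vanishing_ideal T.is_cring) simp
sublocale h2: surj_ring_hom "PS V" "PS V Quot vanishing V W2" "(+>\<^bsub>PS V\<^esub>) (vanishing V W2)"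
  by (intro ideal.quot_surj_hom vanishing_ideal T.is_cring) simp
sublocale h3: surj_ring_hom "PS V" "PS V Quot vanishing V W3" "(+>\<^bsub>PS V\<^esub>) (vanishing V W3)"
  by (intro ideal.quot_surj_hom vanishing_ideal T.is_cring) simp

lemma coset_eq:
  assumes "W \<subseteq> V" "b \<in> carrier T" "c \<in> carrier T"
  shows "vanishing V W +>\<^bsub>T\<^esub> b = vanishing V W +>\<^bsub>T\<^esub> c \<longleftrightarrow> restr W b = restr W c"
  using T.quotient_eq_iff_same_a_r_cos[OF vanishing_ideal[OF assms(1)] assms(2,3)] vanishing_minus[OF assms] by simp

lemma diag_eq:
  assumes "b1 \<in> carrier T" "b2 \<in> carrier T" "b3 \<in> carrier T" "c1 \<in> carrier T" "c2 \<in> carrier T" "c3 \<in> carrier T"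
  shows "diag b1 b2 b3 = diag c1 c2 c3 \<longleftrightarrow> \<delta>1 b1 = \<delta>1 c1 \<and> \<delta>2 b2 = \<delta>2 c2 \<and> \<delta>3 b3 = \<delta>3 c3"
  using assms coset_eq by (simp add: diag_def)

lemma carrier_B: "F \<in> carrier B \<longleftrightarrow> (\<exists>b1\<in>carrier T. \<exists>b2\<in>carrier T. \<exists>b3\<in>carrier T. F = diag b1 b2 b3)"
  unfolding RDirProd_simps h1.surj[symmetric] h2.surj[symmetric] h3.surj[symmetric] diag_def by auto

lemma diag_closed: "b1 \<in> carrier T \<Longrightarrow> b2 \<in> carrier T \<Longrightarrow> b3 \<in> carrier T \<Longrightarrow> diag b1 b2 b3 \<in> carrier B"
  using carrier_B by blast

lemma diag_ops:
  assumes "b1 \<in> carrier T" "b2 \<in> carrier T" "b3 \<in> carrier T" "c1 \<in> carrier T" "c2 \<in> carrier T" "c3 \<in> carrier T"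
  shows "diag b1 b2 b3 \<otimes>\<^bsub>B\<^esub> diag c1 c2 c3 = diag (b1 \<bullet> c1) (b2 \<bullet> c2) (b3 \<bullet> c3)"
    "diag b1 b2 b3 \<oplus>\<^bsub>B\<^esub> diag c1 c2 c3 = diag (b1 \<boxplus> c1) (b2 \<boxplus> c2) (b3 \<boxplus> c3)"
    "\<one>\<^bsub>B\<^esub> = diag 1\<^sub>T 1\<^sub>T 1\<^sub>T" "\<zero>\<^bsub>B\<^esub> = diag 0\<^sub>T 0\<^sub>T 0\<^sub>T"
  using assms by (simp_all add: diag_def RDirProd_simps)

text \<open>An element of \<open>B\<close> is multiplied by \<open>e2\<close> into \<open>A\<close>
  and divided by \<open>e2\<close> again. All representatives of the three cosets yield the same
  fraction, since only their restrictions enter.\<close>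

definition \<phi> where "\<phi> F = (SOME G. \<exists>b1\<in>carrier T. \<exists>b2\<in>carrier T. \<exists>b3\<in>carrier T.
  F = diag b1 b2 b3 \<and> G = frac (\<Gamma> b1 b2 b3) e2)"

lemma \<phi>_diag:
  assumes b: "b1 \<in> carrier T" "b2 \<in> carrier T" "b3 \<in> carrier T"
  shows "\<phi> (diag b1 b2 b3) = frac (\<Gamma> b1 b2 b3) e2"
proof -
  have "\<exists>c1\<in>carrier T. \<exists>c2\<in>carrier T. \<exists>c3\<in>carrier T. diag b1 b2 b3 = diag c1 c2 c3 \<and> \<phi> (diag b1 b2 b3) = frac (\<Gamma> c1 c2 c3) e2"
    unfolding \<phi>_def by (rule someI_ex) (use b in blast)
  then obtain c1 c2 c3 where c: "c1 \<in> carrier T" "c2 \<in> carrier T" "c3 \<in> carrier T"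
    "diag b1 b2 b3 = diag c1 c2 c3" "\<phi> (diag b1 b2 b3) = frac (\<Gamma> c1 c2 c3) e2" by blast
  have "frac (\<Gamma> c1 c2 c3) e2 = frac (\<Gamma> b1 b2 b3) e2"
    using c(4) b c(1-3) e2_nzd by (intro frac_eqI) (simp_all add: diag_eq \<delta>_\<Gamma>)
  then show ?thesis using c(5) by simp
qed

lemma \<phi>_hom: "\<phi> \<in> ring_hom B (total_fractions A)"
proof (rule ring_hom_memI)
  show "\<phi> F \<in> carrier (total_fractions A)" if F: "F \<in> carrier B" for F
  proof -
    obtain b1 b2 b3 where b: "b1 \<in> carrier T" "b2 \<in> carrier T" "b3 \<in> carrier T" "F = diag b1 b2 b3"
      using F carrier_B by blast
    then show ?thesis using \<phi>_diag \<Gamma>_closed e2_nzd frac_carrier by metis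
  qed
  fix F G assume F: "F \<in> carrier B" and G: "G \<in> carrier B"
  obtain b1 b2 b3 where b: "b1 \<in> carrier T" "b2 \<in> carrier T" "b3 \<in> carrier T" "F = diag b1 b2 b3"
    using F carrier_B by blast
  obtain c1 c2 c3 where c: "c1 \<in> carrier T" "c2 \<in> carrier T" "c3 \<in> carrier T" "G = diag c1 c2 c3"
    using G carrier_B by blast
  note bc = b(1-3) c(1-3)
  have mult: "m \<bullet> m \<bullet> (m \<bullet> (u \<bullet> v)) = m \<bullet> (m \<bullet> u \<bullet> (m \<bullet> v))" if "m \<in> carrier T" "u \<in> carrier T" "v \<in> carrier T" for m u v
    using that by algebra
  have add: "m \<bullet> m \<bullet> (m \<bullet> (u \<boxplus> v)) = m \<bullet> (m \<bullet> (m \<bullet> u) \<boxplus> m \<bullet> (m \<bullet> v))" if "m \<in> carrier T" "u \<in> carrier T" "v \<in> carrier T" for m u v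
    using that by algebra
  have "\<phi> (F \<otimes>\<^bsub>B\<^esub> G) = frac (\<Gamma> (b1 \<bullet> c1) (b2 \<bullet> c2) (b3 \<bullet> c3)) e2"
    unfolding b(4) c(4) diag_ops(1)[OF bc] using bc by (intro \<phi>_diag) auto
  also have "\<dots> = frac (\<Gamma> b1 b2 b3 \<bullet> \<Gamma> c1 c2 c3) (e2 \<bullet> e2)"
    using bc e2_nzd nzd_mult by (intro frac_eqI) (simp_all add: \<delta>_\<Gamma> \<delta>_e2 mult)
  also have "\<dots> = \<phi> F \<otimes>\<^bsub>total_fractions A\<^esub> \<phi> G"
    unfolding b(4) c(4) \<phi>_diag[OF b(1-3)] \<phi>_diag[OF c(1-3)] using bc e2_nzd by (intro frac_mult[symmetric]) auto
  finally show "\<phi> (F \<otimes>\<^bsub>B\<^esub> G) = \<phi> F \<otimes>\<^bsub>total_fractions A\<^esub> \<phi> G" .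
  have "\<phi> (F \<oplus>\<^bsub>B\<^esub> G) = frac (\<Gamma> (b1 \<boxplus> c1) (b2 \<boxplus> c2) (b3 \<boxplus> c3)) e2"
    unfolding b(4) c(4) diag_ops(2)[OF bc] using bc by (intro \<phi>_diag) auto
  also have "\<dots> = frac (e2 \<bullet> \<Gamma> b1 b2 b3 \<boxplus> e2 \<bullet> \<Gamma> c1 c2 c3) (e2 \<bullet> e2)"
    using bc e2_nzd nzd_mult by (intro frac_eqI) (simp_all add: \<delta>_\<Gamma> \<delta>_e2 add)
  also have "\<dots> = \<phi> F \<oplus>\<^bsub>total_fractions A\<^esub> \<phi> G"
    unfolding b(4) c(4) \<phi>_diag[OF b(1-3)] \<phi>_diag[OF c(1-3)] using bc e2_nzd by (intro frac_add[symmetric]) auto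
  finally show "\<phi> (F \<oplus>\<^bsub>B\<^esub> G) = \<phi> F \<oplus>\<^bsub>total_fractions A\<^esub> \<phi> G" .
next
  have "frac (\<Gamma> 1\<^sub>T 1\<^sub>T 1\<^sub>T) e2 = frac 1\<^sub>T 1\<^sub>T"
    using e2_nzd one_nzd by (intro frac_eqI) (simp_all add: \<delta>_\<Gamma> \<delta>_e2)
  then show "\<phi> \<one>\<^bsub>B\<^esub> = \<one>\<^bsub>total_fractions A\<^esub>"
    unfolding diag_ops(3)[OF T.one_closed T.one_closed T.one_closed T.one_closed T.one_closed T.one_closed] frac_one
    by (simp only: \<phi>_diag T.one_closed)
qed

lemma \<phi>_inj: "inj_on \<phi> (carrier B)"
proof (rule inj_onI)
  fix F G assume F: "F \<in> carrier B" and G: "G \<in> carrier B" and eq: "\<phi> F = \<phi> G"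
  obtain b1 b2 b3 where b: "b1 \<in> carrier T" "b2 \<in> carrier T" "b3 \<in> carrier T" "F = diag b1 b2 b3"
    using F carrier_B by blast
  obtain c1 c2 c3 where c: "c1 \<in> carrier T" "c2 \<in> carrier T" "c3 \<in> carrier T" "G = diag c1 c2 c3"
    using G carrier_B by blast
  note bc = b(1-3) c(1-3)
  have cancel: "u = v" if "m \<bullet> (m \<bullet> u) = m \<bullet> (m \<bullet> v)" "m \<in> carrier T" "u \<in> carrier T" "v \<in> carrier T" "m \<noteq> 0\<^sub>T" for m u v
    using that by (simp add: T.m_lcancel)
  have "frac (\<Gamma> b1 b2 b3) e2 = frac (\<Gamma> c1 c2 c3) e2"
    using eq unfolding b(4) c(4) \<phi>_diag[OF b(1-3)] \<phi>_diag[OF c(1-3)] .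
  then have "e2 \<bullet> \<Gamma> b1 b2 b3 \<boxminus> e2 \<bullet> \<Gamma> c1 c2 c3 \<in> I"
    using bc e2_nzd by (subst (asm) frac_eq) auto
  then have "\<delta>1 (e2 \<bullet> \<Gamma> b1 b2 b3) = \<delta>1 (e2 \<bullet> \<Gamma> c1 c2 c3)" "\<delta>2 (e2 \<bullet> \<Gamma> b1 b2 b3) = \<delta>2 (e2 \<bullet> \<Gamma> c1 c2 c3)"
    "\<delta>3 (e2 \<bullet> \<Gamma> b1 b2 b3) = \<delta>3 (e2 \<bullet> \<Gamma> c1 c2 c3)"
    unfolding minus_mem_I[OF T.m_closed[OF e_closed(1) \<Gamma>_closed[OF b(1-3)]] T.m_closed[OF e_closed(1) \<Gamma>_closed[OF c(1-3)]]]
    by blast+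
  then have eqs: "(y \<bullet> z) \<bullet> ((y \<bullet> z) \<bullet> \<delta>1 b1) = (y \<bullet> z) \<bullet> ((y \<bullet> z) \<bullet> \<delta>1 c1)"
    "(x \<bullet> z) \<bullet> ((x \<bullet> z) \<bullet> \<delta>2 b2) = (x \<bullet> z) \<bullet> ((x \<bullet> z) \<bullet> \<delta>2 c2)"
    "(x \<bullet> y) \<bullet> ((x \<bullet> y) \<bullet> \<delta>3 b3) = (x \<bullet> y) \<bullet> ((x \<bullet> y) \<bullet> \<delta>3 c3)"
    using bc by (simp_all add: \<delta>_\<Gamma> \<delta>_e2)
  have "\<delta>1 b1 = \<delta>1 c1" by (rule cancel[OF eqs(1)]) (use bc in \<open>simp_all add: T.integral_iff\<close>)
  moreover have "\<delta>2 b2 = \<delta>2 c2" by (rule cancel[OF eqs(2)]) (use bc in \<open>simp_all add: T.integral_iff\<close>)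
  moreover have "\<delta>3 b3 = \<delta>3 c3" by (rule cancel[OF eqs(3)]) (use bc in \<open>simp_all add: T.integral_iff\<close>)
  ultimately show "F = G"
    unfolding b(4) c(4) using bc by (subst diag_eq) auto
qed

lemma diagonal_map_\<pi>:
  assumes f: "f \<in> carrier T"
  shows "diagonal_map T P1 P2 P3 (\<pi> f) = diag f f f"
proof -
  have "diag g g g = diag f f f" if g: "g \<in> \<pi> f" for g
  proof -
    have gc: "g \<in> carrier T" using I.a_elemrcos_carrier[OF f g] .
    have "\<pi> g = \<pi> f" using T.a_repr_independence[OF g f I.a_subgroup] by simp
    then have "g \<boxminus> f \<in> I" using \<pi>_eq gc f by blast
    then show ?thesis using gc f by (simp add: minus_mem_I diag_eq)
  qed
  moreover have "f \<in> \<pi> f" using f I.a_rcos_self by blast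
  ultimately have "(\<lambda>g. (P1 +>\<^bsub>T\<^esub> g, P2 +>\<^bsub>T\<^esub> g, P3 +>\<^bsub>T\<^esub> g)) ` \<pi> f = {diag f f f}"
    unfolding diag_def by blast
  then show ?thesis by (simp add: diagonal_map_def)
qed

lemma \<phi>_diagonal:
  assumes "a \<in> carrier A"
  shows "\<phi> (diagonal_map T P1 P2 P3 a) = to_fractions A a"
proof -
  obtain f where f: "f \<in> carrier T" "a = \<pi> f" using assms by (rule h.surjE)
  have "frac (\<Gamma> f f f) e2 = frac f 1\<^sub>T"
    using f(1) e2_nzd one_nzd by (intro frac_eqI) (simp_all add: \<delta>_\<Gamma> \<delta>_e2)
  then show ?thesis
    using f by (simp add: diagonal_map_\<pi> \<phi>_diag to_fractions_\<pi>)
qed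

section \<open>The conductor and the \<open>S2\<close>-ification\<close>

lemma chain_to_prime:
  assumes W: "W \<subseteq> V" "U \<subseteq> W" "v \<in> W - U" "v' \<in> W - U" "v \<noteq> v'" and Q: "primeideal Q T" "vanishing V U \<subseteq> Q"
  shows "\<exists>c. prime_chain T c 2 \<and> c 0 = vanishing V W \<and> c 2 = Q"
proof -
  define c where "c = (\<lambda>i::nat. if i = 0 then vanishing V W else if i = 1 then vanishing V (W - {v}) else Q)"
  have "vanishing V W \<subset> vanishing V (W - {v})"
    using vanishing_mono_iff[of "W - {v}" V W] vanishing_mono_iff[of W V "W - {v}"] W by auto
  \<comment> \<open>The variable \<open>v'\<close> lies in \<open>vanishing V U\<close> but not in
    the middle prime, which makes this second step strict.\<close>
  moreover have "vanishing V (W - {v}) \<subset> Q"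
  proof -
    have "vanishing V (W - {v}) \<subseteq> vanishing V U" "\<not> vanishing V U \<subseteq> vanishing V (W - {v})"
      using vanishing_mono_iff[of U V "W - {v}"] vanishing_mono_iff[of "W - {v}" V U] W by auto
    then show ?thesis using Q(2) by blast
  qed
  ultimately have "prime_chain T c 2"
    using Q(1) vanishing_prime[of W V] vanishing_prime[of "W - {v}" V] W(1)
    by (auto simp: prime_chain_def c_def less_2_cases_iff)
  then show ?thesis by (intro exI[of _ c]) (simp add: c_def)
qed

text \<open>The preimage in \<open>T\<close> of the conductor of \<open>A\<close> in
  \<open>B\<close>: a triple supported on one component lies in \<open>A\<close> iff it vanishes on
  both overlaps of that component, and \<open>vanishing V U3\<close> is \<open>P1 + P2\<close>,
  similarly for the other blocks.\<close>

definition J where "J = vanishing V U1 \<inter> vanishing V U2 \<inter> vanishing V U3"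

lemma J_ideal: "ideal J T"
  unfolding J_def by (intro T.i_intersect vanishing_ideal) (auto simp: V_def)

text \<open>A prime above \<open>J\<close> contains \<open>vanishing V U\<close> for some block
  \<open>U\<close>. In a union of two blocks \<open>W\<close> containing \<open>U\<close> the other
  block has two variables, which gives two strict steps above the minimal prime
  \<open>vanishing V W\<close>.\<close>

lemma height_J: "ideal_height A (\<pi> ` J) \<ge> 2"
  unfolding ideal_height_def
proof (rule Inf_greatest)
  fix k assume "k \<in> {prime_height A P |P. primeideal P A \<and> \<pi> ` J \<subseteq> P}"
  then obtain P where P: "k = prime_height A P" "primeideal P A" "\<pi> ` J \<subseteq> P" by blast
  define Q where "Q = h.preim P"
  have Q: "primeideal Q T" unfolding Q_def using P(2) by (rule h.preim_prime)
  have JQ: "J \<subseteq> Q" using P(3) ideal.Icarr[OF J_ideal] by (auto simp: Q_def h.preim_def)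
  have U: "ideal (vanishing V U1) T" "ideal (vanishing V U2) T" "ideal (vanishing V U3) T"
    by (auto intro!: vanishing_ideal simp: V_def)
  have "vanishing V U1 \<subseteq> Q \<or> vanishing V U2 \<subseteq> Q \<or> vanishing V U3 \<subseteq> Q"
    using primeideal.prime_contains_Int[OF Q U] JQ unfolding J_def by blast
  then obtain c where c: "prime_chain T c 2" "I \<subseteq> c 0" "c 2 = Q"
  proof (elim disjE)
    assume a: "vanishing V U1 \<subseteq> Q"
    have "\<exists>c. prime_chain T c 2 \<and> c 0 = vanishing V W2 \<and> c 2 = Q"
      by (rule chain_to_prime[OF _ _ _ _ v_neq(3) Q a]) (auto simp: W2_def V_def)
    then show thesis using that I_subset[of W2] by blast
  next
    assume a: "vanishing V U2 \<subseteq> Q"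
    have "\<exists>c. prime_chain T c 2 \<and> c 0 = vanishing V W1 \<and> c 2 = Q"
      by (rule chain_to_prime[OF _ _ _ _ v_neq(3) Q a]) (auto simp: W1_def V_def)
    then show thesis using that I_subset[of W1] by blast
  next
    assume a: "vanishing V U3 \<subseteq> Q"
    have "\<exists>c. prime_chain T c 2 \<and> c 0 = vanishing V W1 \<and> c 2 = Q"
      by (rule chain_to_prime[OF _ _ _ _ v_neq(2) Q a]) (auto simp: W1_def V_def)
    then show thesis using that I_subset[of W1] by blast
  qed
  have "prime_chain A (\<lambda>i. \<pi> ` c i) 2"
    using h.image_chain[OF c(1)] c(2) Ker_eq by simp
  moreover have "\<pi> ` c 2 = P"
    unfolding c(3) Q_def using ideal.Icarr[OF primeideal.axioms(1)[OF P(2)]] by (intro h.image_preim) blast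
  ultimately have "enat 2 \<le> prime_height A P"
    unfolding prime_height_def by (intro Sup_upper) blast
  then show "2 \<le> k" using P(1) by (simp add: numeral_eq_enat)
qed

text \<open>Multiplied by \<open>f\<close>, all components vanish on the overlaps, so they
  glue.\<close>

lemma J_conductor:
  assumes f: "f \<in> J" and b: "b1 \<in> carrier T" "b2 \<in> carrier T" "b3 \<in> carrier T"
  shows "\<exists>k\<in>carrier T. f \<bullet> \<Gamma> b1 b2 b3 \<boxminus> e2 \<bullet> k \<in> I"
proof -
  have f0: "f \<in> carrier T" "restr U1 f = 0\<^sub>T" "restr U2 f = 0\<^sub>T" "restr U3 f = 0\<^sub>T"
    using f by (auto simp: J_def vanishing_def PS_ops)
  have fb: "f \<bullet> b1 \<in> carrier T" "f \<bullet> b2 \<in> carrier T" "f \<bullet> b3 \<in> carrier T" using f0 b by simp_all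
  obtain k where k: "k \<in> carrier T" "\<delta>1 k = \<delta>1 (f \<bullet> b1)" "\<delta>2 k = \<delta>2 (f \<bullet> b2)" "\<delta>3 k = \<delta>3 (f \<bullet> b3)"
    using gluing[OF fb] f0 b by auto
  have "f \<bullet> \<Gamma> b1 b2 b3 \<boxminus> e2 \<bullet> k \<in> I"
    using f0 b k by (simp add: minus_mem_I \<delta>_\<Gamma> \<delta>_e2) (simp add: T.m_ac)
  then show ?thesis using k(1) by blast
qed

text \<open>The division takes place in \<open>PS W\<close>: if it failed, the image of
  \<open>K\<close> would lie in a prime \<open>P\<close> of height at most one there. The hypothesis
  on heights refers to primes above \<open>I\<close>, so the chain below the preimage
  \<open>Q\<close> of \<open>P\<close> may start from the minimal prime of another component; both
  cases contradict the bound on \<open>P\<close>.\<close>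

lemma component_divides:
  assumes W: "W \<in> {W1, W2, W3}" and K: "K \<subseteq> carrier T"
    and height: "\<And>Q. primeideal Q T \<Longrightarrow> K \<subseteq> Q \<Longrightarrow>
      \<exists>c0 c1. primeideal c0 T \<and> primeideal c1 T \<and> c0 \<subset> c1 \<and> c1 \<subset> Q \<and> I \<subseteq> c0"
    and a: "a \<in> carrier T" and s: "s \<in> carrier T" "restr W s \<noteq> 0\<^sub>T"
    and Ka: "\<And>f. f \<in> K \<Longrightarrow> \<exists>g\<in>carrier T. f \<bullet> a \<boxminus> s \<bullet> g \<in> I"
  shows "\<exists>b\<in>carrier T. restr W b = b \<and> restr W a = restr W s \<bullet> b"
proof -
  have WV: "W \<subseteq> V" using W W_subset by blast
  then have finW: "finite W" using fin finite_subset[of W V] by (simp add: V_def)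
  interpret N: noetherian_domain "PS W"
    by (intro noetherian_domain.intro PS_noetherian finW PS_domain)
  interpret r: surj_ring_hom "PS V" "PS W" "restr W" using WV by (rule restr_hom)
  have ops: "f \<otimes>\<^bsub>PS W\<^esub> g = f \<bullet> g" "\<zero>\<^bsub>PS W\<^esub> = 0\<^sub>T" for f g
    by (simp_all add: PS_ops)
  have rK: "restr W ` K \<subseteq> carrier (PS W)" using K by auto
  have ra: "restr W a \<in> carrier (PS W)" and rs: "restr W s \<in> carrier (PS W)" "restr W s \<noteq> \<zero>\<^bsub>PS W\<^esub>"
    using a s r.hom_closed ops by auto
  have div: "restr W s divides\<^bsub>PS W\<^esub> (f \<otimes>\<^bsub>PS W\<^esub> restr W a)" if f: "f \<in> restr W ` K" for f
  proof -
    obtain g where g: "f = restr W g" "g \<in> K" using f by (rule imageE)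
    obtain k where k: "k \<in> carrier T" "g \<bullet> a \<boxminus> s \<bullet> k \<in> I" using Ka[OF g(2)] by blast
    have gc: "g \<in> carrier T" using g K by blast
    have "restr W (g \<bullet> a) = restr W (s \<bullet> k)"
      using k W minus_mem_I[of "g \<bullet> a" "s \<bullet> k"] gc a s by auto
    then have "f \<otimes>\<^bsub>PS W\<^esub> restr W a = restr W s \<otimes>\<^bsub>PS W\<^esub> restr W k"
      unfolding ops g(1) using gc a s k by simp
    then show ?thesis using k(1) r.hom_closed by (auto simp: factor_def)
  qed
  have "restr W s divides\<^bsub>PS W\<^esub> restr W a"
  proof (rule ccontr)
    assume nd: "\<not> ?thesis"
    have "\<exists>P. primeideal P (PS W) \<and> restr W ` K \<subseteq> P \<and> (\<forall>c. primeideal c (PS W) \<longrightarrow> c \<subset> P \<longrightarrow> c = {\<zero>\<^bsub>PS W\<^esub>})"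
      by (rule N.completely_integrally_closed_S2[OF PS_completely_integrally_closed rK ra rs div nd]) blast+
    then obtain P where P: "primeideal P (PS W)" "restr W ` K \<subseteq> P"
      and Pmin: "\<And>c. primeideal c (PS W) \<Longrightarrow> c \<subset> P \<Longrightarrow> c = {\<zero>\<^bsub>PS W\<^esub>}"
      by blast
    define Q where "Q = r.preim P"
    have Q: "primeideal Q T" unfolding Q_def using P(1) by (rule r.preim_prime)
    interpret Q: primeideal Q "PS V" by (rule Q)
    have KQ: "K \<subseteq> Q" unfolding Q_def r.preim_def using P(2) K by blast
    obtain c0 c1 where c: "primeideal c0 T" "primeideal c1 T" "c0 \<subset> c1" "c1 \<subset> Q" "I \<subseteq> c0"
      using height[OF Q KQ] by blast
    have rKer: "r.Ker = vanishing V W" using vanishing_Ker[OF WV] by simp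
    have KerQ: "vanishing V W \<subseteq> Q"
      using r.Ker_subset_preim[OF primeideal.axioms(1)[OF P(1)]] rKer by (simp add: Q_def)
    \<comment> \<open>The bound on \<open>P\<close> lifted to \<open>T\<close>: no prime lies
      strictly between \<open>vanishing V W\<close> and \<open>Q\<close>.\<close>
    have min: "c = vanishing V W" if c: "primeideal c T" "vanishing V W \<subseteq> c" "c \<subset> Q" for c
    proof -
      interpret c: primeideal c "PS V" by (rule c(1))
      have "primeideal (restr W ` c) (PS W)"
        using c(1,2) rKer by (intro r.image_prime) simp_all
      moreover have "restr W ` c \<subset> restr W ` Q"
        using c Q.a_subset rKer by (intro r.image_mono_strict c.is_ideal) simp_all
      moreover have "restr W ` Q = P"
        unfolding Q_def using ideal.Icarr[OF primeideal.axioms(1)[OF P(1)]] by (intro r.image_preim) blast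
      ultimately have "restr W ` c = {\<zero>\<^bsub>PS W\<^esub>}" using Pmin by simp
      then have "c \<subseteq> vanishing V W"
        unfolding vanishing_def PS_ops using c.a_Hcarr by blast
      then show ?thesis using c(2) by blast
    qed
    obtain W' where W': "W' \<in> {W1, W2, W3}" "vanishing V W' \<subseteq> c0"
      using prime_cover[OF c(1,5)] by blast
    show False
    proof (cases "W' = W")
      case True
      then have "c0 = vanishing V W" "c1 = vanishing V W"
        using min[OF c(1)] min[OF c(2)] W'(2) c(3,4) by blast+
      then show False using c(3) by blast
    next
      case False
      \<comment> \<open>If the chain starts at another component, \<open>Q\<close> contains both
        minimal primes, hence two variables \<open>v\<close>, \<open>v'\<close> of \<open>W\<close>.
        Then \<open>vanishing V (W - {v})\<close> lies strictly between \<open>vanishing V W\<close>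
        and \<open>Q\<close>.\<close>
      then have "\<exists>v v'. v \<in> W - W' \<and> v' \<in> W - W' \<and> v \<noteq> v'"
        using W W'(1) v_neq by (elim insertE emptyE) (simp_all, (use v_mem in blast)+)
      then obtain v v' where v: "v \<in> W - W'" "v' \<in> W - W'" "v \<noteq> v'" by blast
      have vV: "v \<in> V" "v' \<in> V" using v WV by auto
      have "indexed_var u \<in> vanishing V W'" if "u \<in> V" "u \<notin> W'" for u
        using that by (simp add: vanishing_def restr_var)
      then have vQ: "indexed_var v \<in> Q" "indexed_var v' \<in> Q"
        using v vV W'(2) c(3,4) by blast+
      have "V - (V - (W - {v})) = W - {v}" using WV by blast
      then have "vanishing V (W - {v}) = Idl\<^bsub>T\<^esub> (indexed_var ` (V - (W - {v})))"
        using fin Idl_vars_eq_vanishing[of "V - (W - {v})" V] by (simp add: V_def)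
      also have "\<dots> \<subseteq> Q"
      proof (rule T.genideal_minimal[OF Q.is_ideal])
        show "indexed_var ` (V - (W - {v})) \<subseteq> Q"
        proof
          fix f assume "f \<in> indexed_var ` (V - (W - {v}))"
          then obtain u where u: "f = indexed_var u" "u \<in> V" "u \<notin> W \<or> u = v" by blast
          have "indexed_var u \<in> vanishing V W" if "u \<notin> W"
            using that u(2) by (simp add: vanishing_def restr_var)
          then show "f \<in> Q" using u vQ KerQ by blast
        qed
      qed
      finally have "vanishing V (W - {v}) \<subseteq> Q" .
      moreover have "indexed_var v' \<notin> vanishing V (W - {v})"
        using v vV indexed_var_nonzero[of v' V] by (simp add: vanishing_def PS_ops)
      ultimately have "vanishing V (W - {v}) \<subset> Q" using vQ by blast
      moreover have "primeideal (vanishing V (W - {v})) T" using WV by (intro vanishing_prime) blast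
      moreover have "vanishing V W \<subseteq> vanishing V (W - {v})" by (intro vanishing_mono) blast
      ultimately have "vanishing V (W - {v}) = vanishing V W" by (intro min)
      moreover have "indexed_var v \<in> vanishing V (W - {v})" using vV by (simp add: vanishing_def restr_var)
      moreover have "indexed_var v \<notin> vanishing V W"
        using v indexed_var_nonzero[of v V] by (simp add: vanishing_def PS_ops)
      ultimately show False by blast
    qed
  qed
  then obtain b where b: "b \<in> carrier (PS W)" "restr W a = restr W s \<bullet> b"
    by (auto simp: factor_def ops)
  then show ?thesis using restr_id[OF b(1)] PS_mono[OF WV b(1)] by blast
qed

text \<open>The conductor serves as an ideal of denominators for all of \<open>B\<close>.
  Conversely, a fraction whose denominators have height at least two is divided out on each
  component separately, and the quotients are free to differ on the overlaps because
  \<open>B\<close> is the full product.\<close>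

theorem S2_ification_A: "S2_ification A = \<phi> ` carrier B"
proof
  show "\<phi> ` carrier B \<subseteq> S2_ification A"
  proof
    fix F assume "F \<in> \<phi> ` carrier B"
    then obtain b where b: "F = \<phi> b" "b \<in> carrier B" by (rule imageE)
    obtain b1 b2 b3 where bs: "b1 \<in> carrier T" "b2 \<in> carrier T" "b3 \<in> carrier T" "b = diag b1 b2 b3"
      using b(2) carrier_B by blast
    have F: "F = frac (\<Gamma> b1 b2 b3) e2" using b(1) bs \<phi>_diag by simp
    have "to_fractions A x' \<otimes>\<^bsub>total_fractions A\<^esub> F \<in> to_fractions A ` carrier A" if "x' \<in> \<pi> ` J" for x'
    proof -
      obtain f where f: "x' = \<pi> f" "f \<in> J" using \<open>x' \<in> \<pi> ` J\<close> by (rule imageE)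
      have fc: "f \<in> carrier T" using f(2) ideal.Icarr[OF J_ideal] by blast
      show ?thesis
        unfolding f(1) F using frac_mult_mem_iff[OF fc _ e2_nzd] J_conductor[OF f(2) bs(1-3)] bs(1-3) by simp
    qed
    moreover have "F \<in> carrier (total_fractions A)"
      unfolding F frac_carrier using bs(1-3) e2_nzd \<Gamma>_closed by blast
    moreover have "ideal (\<pi> ` J) A" using J_ideal by (rule h.image_ideal)
    ultimately show "F \<in> S2_ification A"
      unfolding S2_ification_def using height_J by blast
  qed
  show "S2_ification A \<subseteq> \<phi> ` carrier B"
  proof
    fix F assume "F \<in> S2_ification A"
    then obtain K where FQ: "F \<in> carrier (total_fractions A)" and K: "ideal K A" "ideal_height A K \<ge> 2"
      "\<forall>x\<in>K. to_fractions A x \<otimes>\<^bsub>total_fractions A\<^esub> F \<in> to_fractions A ` carrier A"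
      unfolding S2_ification_def by blast
    obtain a s where as: "a \<in> carrier T" "s \<in> nzd" "F = frac a s" using FQ frac_carrier by blast
    have sc: "s \<in> carrier T" using as(2) by (rule nzd_carrier)
    define K' where "K' = h.preim K"
    have K'c: "K' \<subseteq> carrier T" by (auto simp: K'_def h.preim_def)
    have Ka: "\<exists>g\<in>carrier T. f \<bullet> a \<boxminus> s \<bullet> g \<in> I" if f: "f \<in> K'" for f
    proof -
      have "f \<in> carrier T" "\<pi> f \<in> K" using f by (simp_all add: K'_def h.preim_def)
      then show ?thesis using K(3) as(3) frac_mult_mem_iff[OF _ as(1,2)] by blast
    qed
    have height: "\<exists>c0 c1. primeideal c0 T \<and> primeideal c1 T \<and> c0 \<subset> c1 \<and> c1 \<subset> Q \<and> I \<subseteq> c0"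
      if Q: "primeideal Q T" "K' \<subseteq> Q" for Q
    proof -
      have "I \<subseteq> K'" using h.Ker_subset_preim[OF K(1)] Ker_eq by (simp add: K'_def)
      then have IQ: "I \<subseteq> Q" using Q(2) by blast
      have prime: "primeideal (\<pi> ` Q) A" using Q(1) IQ Ker_eq by (intro h.image_prime) simp_all
      have "\<pi> ` K' = K" unfolding K'_def using ideal.Icarr[OF K(1)] by (intro h.image_preim) blast
      then have "K \<subseteq> \<pi> ` Q" using Q(2) by blast
      then have "ideal_height A K \<le> prime_height A (\<pi> ` Q)"
        unfolding ideal_height_def using prime by (intro Inf_lower) blast
      then have "2 \<le> prime_height A (\<pi> ` Q)" using K(2) by (rule order_trans[rotated])
      moreover have "\<not> (2::enat) \<le> 1" by (simp add: numeral_eq_enat one_enat_def)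
      \<comment> \<open>A supremum exceeding one has a member exceeding one, also when it is
        infinite. The last two steps of that chain provide \<open>c0\<close> and
        \<open>c1\<close>.\<close>
      ultimately have "\<not> prime_height A (\<pi> ` Q) \<le> 1"
        using order_trans by blast
      then obtain n c where c: "prime_chain A c n" "c n = \<pi> ` Q" "\<not> enat n \<le> 1"
        unfolding prime_height_def by (auto simp: Sup_le_iff)
      then have n: "n \<ge> 2" by (simp add: one_enat_def)
      then obtain k where k: "n = Suc (Suc k)" by (metis Suc_1 add_2_eq_Suc le_add_diff_inverse)
      have ch: "prime_chain T (\<lambda>i. h.preim (c i)) n" using c(1) by (rule h.preim_chain)
      have "h.preim (c n) = Q"
        unfolding c(2) using Q(1) IQ Ker_eq by (intro h.preim_image) (simp_all add: primeideal.axioms(1))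
      moreover have "primeideal (c k) A" using c(1) k by (simp add: prime_chain_def)
      then have "I \<subseteq> h.preim (c k)" using h.Ker_subset_preim[of "c k"] Ker_eq primeideal.axioms(1) by blast
      ultimately show ?thesis
        using ch k unfolding prime_chain_def by (metis lessI less_SucI less_imp_le_nat order_refl)
    qed
    note nz = nzd_nonzero[OF as(2)]
    obtain b1 where b1: "b1 \<in> carrier T" "\<delta>1 b1 = b1" "\<delta>1 a = \<delta>1 s \<bullet> b1"
      using component_divides[OF _ K'c height as(1) sc _ Ka, of W1] nz by auto
    obtain b2 where b2: "b2 \<in> carrier T" "\<delta>2 b2 = b2" "\<delta>2 a = \<delta>2 s \<bullet> b2"
      using component_divides[OF _ K'c height as(1) sc _ Ka, of W2] nz by auto
    obtain b3 where b3: "b3 \<in> carrier T" "\<delta>3 b3 = b3" "\<delta>3 a = \<delta>3 s \<bullet> b3"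
      using component_divides[OF _ K'c height as(1) sc _ Ka, of W3] nz by auto
    have "F = frac (\<Gamma> b1 b2 b3) e2"
      unfolding as(3) using as(1,2) e2_nzd b1 b2 b3 sc
      by (intro frac_eqI) (simp_all add: \<delta>_\<Gamma> \<delta>_e2 T.m_lcomm)
    also have "\<dots> = \<phi> (diag b1 b2 b3)" using b1 b2 b3 by (simp add: \<phi>_diag)
    finally show "F \<in> \<phi> ` carrier B"
      using diag_closed[OF b1(1) b2(1) b3(1)] by (simp add: image_eqI)
  qed
qed

end


section \<open>Regularity of the product B\<close>

lemma surj_ring_hom_comp:
  assumes "surj_ring_hom R S f" "surj_ring_hom S U g"
  shows "surj_ring_hom R U (g \<circ> f)"
proof -
  interpret f: surj_ring_hom R S f by fact
  interpret g: surj_ring_hom S U g by fact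
  have "ring_hom_cring R U (g \<circ> f)"
    by (rule ring_hom_cringI[OF f.R.is_cring g.S.is_cring ring_hom_trans[OF f.homh g.homh]])
  moreover have "(g \<circ> f) ` carrier R = carrier U"
    by (simp only: image_comp[symmetric] f.surj g.surj)
  ultimately show ?thesis
    by (simp add: surj_ring_hom_def surj_ring_hom_axioms_def)
qed

text \<open>The three idempotents add up to one, so a maximal ideal misses one of them, and
  localizing there gives the corresponding factor, which is already local.\<close>

lemma RDirProd3_regular:
  assumes R1: "cring R1" "noetherian_ring R1" and R2: "cring R2" "noetherian_ring R2" and R3: "cring R3" "noetherian_ring R3"
    and G1: "local_with R1 (Idl\<^bsub>R1\<^esub> G1)" "finite G1" "G1 \<subseteq> carrier R1" "enat (card G1) = krull_dim R1"
    and G2: "local_with R2 (Idl\<^bsub>R2\<^esub> G2)" "finite G2" "G2 \<subseteq> carrier R2" "enat (card G2) = krull_dim R2"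
    and G3: "local_with R3 (Idl\<^bsub>R3\<^esub> G3)" "finite G3" "G3 \<subseteq> carrier R3" "enat (card G3) = krull_dim R3"
  shows "regular_ring (RDirProd R1 (RDirProd R2 R3))"
proof -
  let ?B = "RDirProd R1 (RDirProd R2 R3)"
  interpret R1: cring R1 by fact
  interpret R2: cring R2 by fact
  interpret R3: cring R3 by fact
  have R23: "cring (RDirProd R2 R3)" "noetherian_ring (RDirProd R2 R3)"
    using R2 R3 by (auto intro: RDirProd_cring RDirProd_noetherian)
  have B: "cring ?B" "noetherian_ring ?B"
    using R1 R23 by (auto intro: RDirProd_cring RDirProd_noetherian)
  interpret B: cring ?B by fact
  have pr1: "surj_ring_hom ?B R1 fst" using R1(1) R23(1) by (rule RDirProd_fst)
  have pr23: "surj_ring_hom ?B (RDirProd R2 R3) snd" using R1(1) R23(1) by (rule RDirProd_snd)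
  have pr2: "surj_ring_hom ?B R2 (fst \<circ> snd)" using pr23 RDirProd_fst[OF R2(1) R3(1)] by (rule surj_ring_hom_comp)
  have pr3: "surj_ring_hom ?B R3 (snd \<circ> snd)" using pr23 RDirProd_snd[OF R2(1) R3(1)] by (rule surj_ring_hom_comp)
  define i1 where "i1 = (\<one>\<^bsub>R1\<^esub>, \<zero>\<^bsub>R2\<^esub>, \<zero>\<^bsub>R3\<^esub>)"
  define i2 where "i2 = (\<zero>\<^bsub>R1\<^esub>, \<one>\<^bsub>R2\<^esub>, \<zero>\<^bsub>R3\<^esub>)"
  define i3 where "i3 = (\<zero>\<^bsub>R1\<^esub>, \<zero>\<^bsub>R2\<^esub>, \<one>\<^bsub>R3\<^esub>)"
  have i: "i1 \<in> carrier ?B" "i2 \<in> carrier ?B" "i3 \<in> carrier ?B"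
    by (simp_all add: i1_def i2_def i3_def RDirProd_simps)
  have "regular_local_ring (localization ?B (carrier ?B - M))" if M: "maximalideal M ?B" for M
  proof -
    interpret M: maximalideal M ?B by (rule M)
    have "\<not> (i1 \<in> M \<and> i2 \<in> M \<and> i3 \<in> M)"
    proof
      assume "i1 \<in> M \<and> i2 \<in> M \<and> i3 \<in> M"
      then have "i1 \<oplus>\<^bsub>?B\<^esub> (i2 \<oplus>\<^bsub>?B\<^esub> i3) \<in> M" using M.a_closed by blast
      then have "\<one>\<^bsub>?B\<^esub> \<in> M" by (simp add: i1_def i2_def i3_def RDirProd_simps)
      then show False using M.one_imp_carrier M.I_notcarr by blast
    qed
    then consider "i1 \<notin> M" | "i2 \<notin> M" | "i3 \<notin> M" by blast
    then show ?thesis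
    proof cases
      case 1
      show ?thesis
        by (rule surj_ring_hom.localization_regular_local[OF pr1 G1(1) M i(1) 1 _ R1(2) refl G1(2-4)])
          (auto simp: i1_def RDirProd_simps)
    next
      case 2
      show ?thesis
        by (rule surj_ring_hom.localization_regular_local[OF pr2 G2(1) M i(2) 2 _ R2(2) refl G2(2-4)])
          (auto simp: i2_def RDirProd_simps)
    next
      case 3
      show ?thesis
        by (rule surj_ring_hom.localization_regular_local[OF pr3 G3(1) M i(3) 3 _ R3(2) refl G3(2-4)])
          (auto simp: i3_def RDirProd_simps)
    qed
  qed
  then show ?thesis using B by (simp add: regular_ring_def)
qed

theorem (in three_blocks) B_regular: "regular_ring B"
proof -
  have finV: "finite V" using fin by (simp add: V_def)
  have T: "noetherian_ring T" using finV by (rule PS_noetherian)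
  obtain G1 where G1: "local_with (T Quot P1) (Idl\<^bsub>T Quot P1\<^esub> G1)" "finite G1"
    "G1 \<subseteq> carrier (T Quot P1)" "enat (card G1) = krull_dim (T Quot P1)"
    using vanishing_quotient_regular[OF finV W_subset(1)] by blast
  obtain G2 where G2: "local_with (T Quot P2) (Idl\<^bsub>T Quot P2\<^esub> G2)" "finite G2"
    "G2 \<subseteq> carrier (T Quot P2)" "enat (card G2) = krull_dim (T Quot P2)"
    using vanishing_quotient_regular[OF finV W_subset(2)] by blast
  obtain G3 where G3: "local_with (T Quot P3) (Idl\<^bsub>T Quot P3\<^esub> G3)" "finite G3"
    "G3 \<subseteq> carrier (T Quot P3)" "enat (card G3) = krull_dim (T Quot P3)"
    using vanishing_quotient_regular[OF finV W_subset(3)] by blast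
  show ?thesis
    by (rule RDirProd3_regular[OF h1.S.is_cring h1.image_noetherian[OF T] h2.S.is_cring h2.image_noetherian[OF T]
      h3.S.is_cring h3.image_noetherian[OF T] G1 G2 G3])
qed

section \<open>Specialization to the variables X, Y, Z\<close>

instance xyz :: countable
  by countable_datatype

theorem proposition5p7:
  fixes K :: "('a, 'b) ring_scheme" and m :: nat
    and T :: "(xyz multiset \<Rightarrow> 'a) ring"
  assumes "field K"
    and "m \<ge> 2"
    and T: "T = power_series_ring K (X_var ` {1..m} \<union> Y_var ` {1..m} \<union> Z_var ` {1..m})"
    and P1: "P1 = Idl\<^bsub>T\<^esub> ((\<lambda>i. ring.indexed_var K (X_var i)) ` {1..m})"
    and P2: "P2 = Idl\<^bsub>T\<^esub> ((\<lambda>i. ring.indexed_var K (Y_var i)) ` {1..m})"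
    and P3: "P3 = Idl\<^bsub>T\<^esub> ((\<lambda>i. ring.indexed_var K (Z_var i)) ` {1..m})"
    and A: "A = T Quot (P1 \<inter> P2 \<inter> P3)"
    and B: "B = RDirProd (T Quot P1) (RDirProd (T Quot P2) (T Quot P3))"
  shows "krull_dim A = enat (2 * m) \<and> 2 * m \<ge> 4 \<and>
    depth A = 2 \<and>
    (\<exists>\<phi>. \<phi> \<in> ring_hom B (total_fractions A) \<and> inj_on \<phi> (carrier B) \<and>
          (\<forall>a\<in>carrier A. \<phi> (diagonal_map T P1 P2 P3 a) = to_fractions A a) \<and>
          S2_ification A = \<phi> ` carrier B) \<and>
    regular_ring B"
proof -
  interpret K: field K by fact
  \<comment> \<open>Since \<open>m \<ge> 2\<close>, the indices \<open>1\<close> and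
    \<open>2\<close> supply two distinct variables in each block.\<close>
  interpret b: three_blocks K "X_var ` {1..m}" "Y_var ` {1..m}" "Z_var ` {1..m}"
      "X_var 1" "Y_var 1" "Z_var 1" "X_var 2" "Y_var 2" "Z_var 2"
    using \<open>m \<ge> 2\<close> by unfold_locales auto
  have T': "T = power_series_ring K b.V"
    unfolding T b.V_def ..
  have Idl: "Idl\<^bsub>T\<^esub> ((\<lambda>i. K.indexed_var (v i)) ` {1..m}) = K.vanishing b.V (b.V - v ` {1..m})"
    if "v ` {1..m} \<subseteq> b.V" for v :: "nat \<Rightarrow> xyz"
    using K.Idl_vars_eq_vanishing[OF _ that] by (simp add: T' image_image)
  have diff: "b.V - X_var ` {1..m} = b.W1" "b.V - Y_var ` {1..m} = b.W2" "b.V - Z_var ` {1..m} = b.W3"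
    unfolding b.V_def b.W1_def b.W2_def b.W3_def by blast+
  have sub: "X_var ` {1..m} \<subseteq> b.V" "Y_var ` {1..m} \<subseteq> b.V" "Z_var ` {1..m} \<subseteq> b.V"
    unfolding b.V_def by blast+
  have P: "P1 = K.vanishing b.V b.W1" "P2 = K.vanishing b.V b.W2" "P3 = K.vanishing b.V b.W3"
    unfolding P1 P2 P3 Idl[OF sub(1)] Idl[OF sub(2)] Idl[OF sub(3)] diff by (rule refl)+
  have A': "A = power_series_ring K b.V Quot b.I"
    unfolding A T' P b.I_def ..
  have card: "card (X_var ` {1..m}) = m" "card (Y_var ` {1..m}) = m" "card (Z_var ` {1..m}) = m"
    by (simp_all add: card_image inj_on_def del: One_nat_def)
  show ?thesis
    unfolding A' B T' P
  proof (intro conjI exI[of _ b.\<phi>] ballI)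
    show "krull_dim b.A = enat (2 * m)" by (rule b.krull_dim_A[OF card])
    show "2 * m \<ge> 4" using \<open>m \<ge> 2\<close> by simp
  qed (fact b.depth_A b.\<phi>_hom b.\<phi>_inj b.S2_ification_A b.B_regular | erule b.\<phi>_diagonal)+
qed

end
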